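(* Given a multiset $W=\{w_1,\ldots,w_n\}$ of $n$ real weights, a minimax tree for $W$ can be built in $O(n)$ time on a word RAM with $\Omega(\log n)$-bit words.
   Context: All trees are binary (each internal node has at most two children). For a multiset $W=\{w_1,\ldots,w_n\}$ of weights, consider binary trees with $n$ leaves whose leaves are labelled bijectively by the elements of $W$. Each leaf has weight equal to its label, and each internal node has weight equal to the maximum of its children's weights plus $1$; equivalently, the root's weight is $\max_i\{w_i+\ell_i\}$, where $\ell_i$ is the depth of the leaf labelled $w_i$. A minimax tree for $W$ is such a tree whose root weight is as small as possible. This minimum root weight is called the minimax cost of $W$, denoted $M(W)$. *)

theory Defs
  imports Complex_Main "HOL-Library.Multiset"
begin

section \<open>Minimax trees\<close>

datatype 'a btree = Leaf 'a | Unary "'a btree" | Binary "'a btree" "'a btree"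

primrec leaves :: "'a btree \<Rightarrow> 'a multiset" where
  "leaves (Leaf x) = {#x#}"
| "leaves (Unary t) = leaves t"
| "leaves (Binary l r) = leaves l + leaves r"

primrec root_weight :: "real btree \<Rightarrow> real" where
  "root_weight (Leaf w) = w"
| "root_weight (Unary t) = root_weight t + 1"
| "root_weight (Binary l r) = max (root_weight l) (root_weight r) + 1"

definition minimax_tree :: "real multiset \<Rightarrow> real btree \<Rightarrow> bool" where
  "minimax_tree W = is_arg_min root_weight (\<lambda>t. leaves t = W)"


section \<open>A word RAM with read-only real weights\<close>

text \<open>
  Words are the natural numbers below \<open>2 ^ b\<close>, where the word length \<open>b\<close> is a parameter of the
  semantics; programs do not depend on it. An instruction names registers and memory banks by
  constants, so a fixed program uses constantly many registers and constantly many banks, each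
  bank having \<open>2 ^ b\<close> cells of one word. Every instruction costs one unit of time. For \<open>n\<close> weights
  the words suffice as soon as \<open>n < 2 ^ b\<close>, i.e. \<open>n\<close> is a word; this is what \<open>\<Omega>(log n)\<close>-bit words
  amount to when a weight is to be addressed by a word.

  The weights are real numbers of unbounded magnitude and precision. They lie in a read-only
  array indexed by words, and only two instructions look at them: a comparison of two weights,
  each shifted by a word, and the integer part of the difference of two weights, which is
  available only if it is a word. All computed quantities are words; in particular there are no
  writable real cells, in which arbitrary-precision arithmetic could be done at unit cost.
\<close>

datatype binop = Add | Sub | Mul | Div | Mod | BitAnd | BitOr | BitXor | ShiftL | ShiftR

datatype instr =
    Const nat nat                    \<comment> \<open>target register, constant\<close>
  | Move nat nat                     \<comment> \<open>target register, source register\<close>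
  | Op binop nat nat nat             \<comment> \<open>target register, two source registers\<close>
  | Load nat nat nat                 \<comment> \<open>target register, bank, address register\<close>
  | Store nat nat nat                \<comment> \<open>bank, address register, source register\<close>
  | FloorDiff nat nat nat            \<comment> \<open>target register, two registers holding weight indices\<close>
  | Jump nat
  | JumpLess nat nat nat             \<comment> \<open>two registers, jump target\<close>
  | JumpEq nat nat nat
  | JumpWeightLe nat nat nat nat nat \<comment> \<open>index, shift, index, shift registers, jump target\<close>
  | Halt

type_synonym program = "instr list"

record config =
  pc :: nat
  regs :: "nat \<Rightarrow> nat"
  mem :: "nat \<Rightarrow> nat \<Rightarrow> nat"      \<comment> \<open>bank, address\<close>

primrec eval_binop :: "nat \<Rightarrow> binop \<Rightarrow> nat \<Rightarrow> nat \<Rightarrow> nat" where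
  "eval_binop b Add x y = take_bit b (x + y)"
| "eval_binop b Sub x y = take_bit b (x + 2 ^ b - y)"
| "eval_binop b Mul x y = take_bit b (x * y)"
| "eval_binop b Div x y = x div y"
| "eval_binop b Mod x y = x mod y"
| "eval_binop b BitAnd x y = and x y"
| "eval_binop b BitOr x y = or x y"
| "eval_binop b BitXor x y = xor x y"
| "eval_binop b ShiftL x y = take_bit b (push_bit y x)"
| "eval_binop b ShiftR x y = drop_bit y x"

definition set_reg :: "nat \<Rightarrow> nat \<Rightarrow> config \<Rightarrow> config" where
  "set_reg r x s = s\<lparr>pc := Suc (pc s), regs := (regs s)(r := x)\<rparr>"

definition branch :: "bool \<Rightarrow> nat \<Rightarrow> config \<Rightarrow> config" where
  "branch c l s = s\<lparr>pc := (if c then l else Suc (pc s))\<rparr>"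

text \<open>
  The value \<^const>\<open>None\<close> means that there is no successor: regular termination for \<open>Halt\<close>, and
  a crash for a weight index out of range or an integer part that is not a word.
\<close>

fun exec_instr :: "nat \<Rightarrow> real list \<Rightarrow> instr \<Rightarrow> config \<Rightarrow> config option" where
  "exec_instr b ws (Const r k) s = Some (set_reg r (take_bit b k) s)"
| "exec_instr b ws (Move r q) s = Some (set_reg r (regs s q) s)"
| "exec_instr b ws (Op f r p q) s = Some (set_reg r (eval_binop b f (regs s p) (regs s q)) s)"
| "exec_instr b ws (Load r m a) s = Some (set_reg r (mem s m (regs s a)) s)"
| "exec_instr b ws (Store m a r) s =
     Some (s\<lparr>pc := Suc (pc s),
             mem := (mem s)(m := (mem s m)(regs s a := regs s r))\<rparr>)"
| "exec_instr b ws (FloorDiff r i j) s =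
     (if regs s i < length ws \<and> regs s j < length ws then
        let d = \<lfloor>ws ! regs s i - ws ! regs s j\<rfloor>
        in if 0 \<le> d \<and> d < 2 ^ b then Some (set_reg r (nat d) s) else None
      else None)"
| "exec_instr b ws (Jump l) s = Some (branch True l s)"
| "exec_instr b ws (JumpLess p q l) s = Some (branch (regs s p < regs s q) l s)"
| "exec_instr b ws (JumpEq p q l) s = Some (branch (regs s p = regs s q) l s)"
| "exec_instr b ws (JumpWeightLe i c j d l) s =
     (if regs s i < length ws \<and> regs s j < length ws then
        Some (branch (ws ! regs s i + real (regs s c) \<le> ws ! regs s j + real (regs s d)) l s)
      else None)"
| "exec_instr b ws Halt s = None"

text \<open>
  \<open>halts_in b ws P s t s'\<close>: started in \<open>s\<close>, the program reaches a \<open>Halt\<close> instruction in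
  configuration \<open>s'\<close> after exactly \<open>t\<close> steps. Crashed runs do not halt in this sense.
\<close>

inductive halts_in :: "nat \<Rightarrow> real list \<Rightarrow> program \<Rightarrow> config \<Rightarrow> nat \<Rightarrow> config \<Rightarrow> bool"
  for b :: nat and ws :: "real list" and P :: program where
  halt: "pc s < length P \<Longrightarrow> P ! pc s = Halt \<Longrightarrow> halts_in b ws P s 0 s"
| step: "pc s < length P \<Longrightarrow> exec_instr b ws (P ! pc s) s = Some s' \<Longrightarrow>
         halts_in b ws P s' t s'' \<Longrightarrow> halts_in b ws P s (Suc t) s''"

definition initial_config :: "nat \<Rightarrow> config" where
  "initial_config n = \<lparr>pc = 0, regs = (\<lambda>_. 0)(0 := n), mem = (\<lambda>_ _. 0)\<rparr>"


section \<open>Trees in memory\<close>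

text \<open>
  A pointer is a pair of words, kind and index: kind 1 points to the leaf labelled by the weight
  with that index, kind 2 to the internal node with that index, and kind 0 marks a missing second
  child. The child pointers of internal node \<open>v\<close> are at address \<open>v\<close> of banks 0, 1 (first child)
  and 2, 3 (second child). Leaves and internal nodes are numbered separately, so that indices
  below \<open>n\<close> suffice for a tree with \<open>n\<close> leaves all of whose internal nodes have two children.
\<close>

inductive tree_at :: "(nat \<Rightarrow> nat \<Rightarrow> nat) \<Rightarrow> nat \<Rightarrow> nat \<Rightarrow> nat btree \<Rightarrow> bool"
  for m :: "nat \<Rightarrow> nat \<Rightarrow> nat" where
  "tree_at m 1 i (Leaf i)"
| "tree_at m (m 0 v) (m 1 v) t \<Longrightarrow> m 2 v = 0 \<Longrightarrow> tree_at m 2 v (Unary t)"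
| "tree_at m (m 0 v) (m 1 v) l \<Longrightarrow> tree_at m (m 2 v) (m 3 v) r \<Longrightarrow> tree_at m 2 v (Binary l r)"

text \<open>
  The root pointer is returned in registers 0 and 1. The leaves are in bijection with the positions
  of the input list; since every subtree has a leaf, this rules out shared nodes.
\<close>

definition outputs_minimax_tree :: "real list \<Rightarrow> config \<Rightarrow> bool" where
  "outputs_minimax_tree ws s \<longleftrightarrow>
     (\<exists>t. tree_at (mem s) (regs s 0) (regs s 1) t \<and>
          leaves t = mset [0..<length ws] \<and>
          minimax_tree (mset ws) (map_btree ((!) ws) t))"

end

theory Submission
  imports Defs
begin

text \<open>
  Let \<open>m\<close> be the largest of the \<open>n\<close> weights. A tree with \<open>n\<close> leaves need not be deeper than \<open>n - 1\<close>,
  so weights below \<open>m - (n - 1)\<close> may be raised to that value. Write the raised weights as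
  \<open>v\<^sub>i - d\<^sub>i\<close> with \<open>d\<^sub>i\<close> a natural number and \<open>m - 1 < v\<^sub>i \<le> m\<close>. The minimax cost has the form
  \<open>v\<^sub>p + h\<close> for an item \<open>p\<close> and an integer \<open>h\<close>; leaf \<open>i\<close> may then have depth
  \<open>h + d\<^sub>i - [v\<^sub>i > v\<^sub>p]\<close>, and by Kraft's inequality a tree exists if and only if the sum of
  \<open>2 ^ - (h + d\<^sub>i - [v\<^sub>i > v\<^sub>p])\<close> is at most 1. Hence \<open>h\<close> is determined by the \<open>d\<^sub>i\<close>, and finding \<open>p\<close> is a
  selection problem in which item \<open>i\<close> has weight \<open>2 ^ - d\<^sub>i\<close>.

  It is solved by prune and search: test a pivot, then discard a constant fraction of the
  undecided items. Sums of the numbers \<open>2 ^ - d\<^sub>i\<close> do not fit into words, so a test counts tree nodes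
  level by level instead, and the effect of the decided items on the count between two undecided
  ones is condensed into two words. An approximate median serves as pivot; it comes from merging
  sorted blocks and dropping every other item after every third merge. Once \<open>p\<close> is known, the tree is
  built bottom-up by pairing the nodes of each level.
\<close>

section \<open>Structured programs\<close>

datatype test = Lt nat nat | WLe nat nat nat nat

datatype com =
    Skip
  | Ins instr
  | Seq com com (infixr ";;" 60)
  | Cond test com com
  | While nat nat com

primrec jump_on :: "test \<Rightarrow> nat \<Rightarrow> instr" where
  "jump_on (Lt p q) l = JumpLess p q l"
| "jump_on (WLe i c j d) l = JumpWeightLe i c j d l"

primrec code_size :: "com \<Rightarrow> nat" where
  "code_size Skip = 0"
| "code_size (Ins i) = 1"
| "code_size (c ;; d) = code_size c + code_size d"
| "code_size (Cond x c d) = code_size c + code_size d + 2"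
| "code_size (While p q c) = code_size c + 3"

primrec compile :: "com \<Rightarrow> nat \<Rightarrow> program" where
  "compile Skip a = []"
| "compile (Ins i) a = [i]"
| "compile (c ;; d) a = compile c a @ compile d (a + code_size c)"
| "compile (Cond x c d) a =
     jump_on x (a + code_size d + 2) # compile d (Suc a) @
     Jump (a + code_size d + 2 + code_size c) # compile c (a + code_size d + 2)"
| "compile (While p q c) a =
     JumpLess p q (a + 2) # Jump (a + code_size c + 3) # compile c (a + 2) @ [Jump a]"

type_synonym regfile = "nat \<Rightarrow> nat"
type_synonym memory = "nat \<Rightarrow> nat \<Rightarrow> nat"

fun is_basic :: "instr \<Rightarrow> bool" where
  "is_basic (Jump l) = False"
| "is_basic (JumpLess p q l) = False"
| "is_basic (JumpEq p q l) = False"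
| "is_basic (JumpWeightLe i c j d l) = False"
| "is_basic Halt = False"
| "is_basic _ = True"

fun holds :: "real list \<Rightarrow> test \<Rightarrow> regfile \<Rightarrow> bool" where
  "holds ws (Lt p q) R = (R p < R q)"
| "holds ws (WLe i c j d) R = (ws ! R i + real (R c) \<le> ws ! R j + real (R d))"

fun safe :: "real list \<Rightarrow> test \<Rightarrow> regfile \<Rightarrow> bool" where
  "safe ws (Lt p q) R = True"
| "safe ws (WLe i c j d) R = (R i < length ws \<and> R j < length ws)"

inductive run :: "nat \<Rightarrow> real list \<Rightarrow> com \<Rightarrow> regfile \<Rightarrow> memory \<Rightarrow> nat \<Rightarrow> regfile \<Rightarrow> memory \<Rightarrow> bool"
  for b ws where
  Skip: "run b ws Skip R M 0 R M"
| Ins: "is_basic i \<Longrightarrow> exec_instr b ws i \<lparr>pc = 0, regs = R, mem = M\<rparr> = Some s \<Longrightarrow>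
    run b ws (Ins i) R M 1 (regs s) (mem s)"
| Seq: "run b ws c R M k R' M' \<Longrightarrow> run b ws d R' M' l R'' M'' \<Longrightarrow> run b ws (c ;; d) R M (k + l) R'' M''"
| CondTrue: "safe ws x R \<Longrightarrow> holds ws x R \<Longrightarrow> run b ws c R M k R' M' \<Longrightarrow>
    run b ws (Cond x c d) R M (k + 1) R' M'"
| CondFalse: "safe ws x R \<Longrightarrow> \<not> holds ws x R \<Longrightarrow> run b ws d R M k R' M' \<Longrightarrow>
    run b ws (Cond x c d) R M (k + 2) R' M'"
| WhileFalse: "\<not> R p < R q \<Longrightarrow> run b ws (While p q c) R M 2 R M"
| WhileTrue: "R p < R q \<Longrightarrow> run b ws c R M k R' M' \<Longrightarrow> run b ws (While p q c) R' M' l R'' M'' \<Longrightarrow>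
    run b ws (While p q c) R M (k + 2 + l) R'' M''"

lemma length_compile [simp]: "length (compile c a) = code_size c"
  by (induction c arbitrary: a) auto

primrec code_at :: "program \<Rightarrow> nat \<Rightarrow> program \<Rightarrow> bool" where
  "code_at P a [] \<longleftrightarrow> True"
| "code_at P a (x # xs) \<longleftrightarrow> a < length P \<and> P ! a = x \<and> code_at P (Suc a) xs"

lemma code_at_append:
  "code_at P a (xs @ ys) \<longleftrightarrow> code_at P a xs \<and> code_at P (a + length xs) ys"
  by (induction xs arbitrary: a) auto

lemma code_at_self: "code_at (pre @ xs @ post) (length pre) xs"
proof (induction xs arbitrary: pre)
  case (Cons x xs)
  from Cons[of "pre @ [x]"] show ?case by (simp add: nth_append)
qed simp

lemma exec_basic_pc:
  assumes "is_basic i" "exec_instr b ws i \<lparr>pc = 0, regs = R, mem = M\<rparr> = Some s"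
  shows "exec_instr b ws i \<lparr>pc = a, regs = R, mem = M\<rparr> = Some \<lparr>pc = Suc a, regs = regs s, mem = mem s\<rparr>"
  using assms
  by (cases i) (auto simp: set_reg_def Let_def split: if_splits)

lemma exec_jump_on:
  "safe ws x R \<Longrightarrow> exec_instr b ws (jump_on x l) \<lparr>pc = a, regs = R, mem = M\<rparr> =
     Some \<lparr>pc = (if holds ws x R then l else Suc a), regs = R, mem = M\<rparr>"
  by (cases x) (auto simp: branch_def)

lemma halts_in_step:
  assumes "a < length P" "P ! a = i"
    and "exec_instr b ws i \<lparr>pc = a, regs = R, mem = M\<rparr> = Some s'"
    and "halts_in b ws P s' t s''"
  shows "halts_in b ws P \<lparr>pc = a, regs = R, mem = M\<rparr> (Suc t) s''"
  using assms by (intro halts_in.step) auto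

lemma halts_in_jump:
  assumes "a < length P" "P ! a = Jump l"
    and "halts_in b ws P \<lparr>pc = l, regs = R, mem = M\<rparr> t s''"
  shows "halts_in b ws P \<lparr>pc = a, regs = R, mem = M\<rparr> (Suc t) s''"
  using assms by (intro halts_in_step) (auto simp: branch_def)

lemma compile_correct:
  assumes "run b ws c R M k R' M'" "code_at P a (compile c a)"
    and "halts_in b ws P \<lparr>pc = a + code_size c, regs = R', mem = M'\<rparr> t s"
  shows "halts_in b ws P \<lparr>pc = a, regs = R, mem = M\<rparr> (k + t) s"
  using assms
proof (induction arbitrary: a t rule: run.induct)
  case (Ins i R M s')
  from halts_in_step[OF _ _ exec_basic_pc[OF Ins.hyps]] Ins.prems show ?case by simp
next
  case (Seq c R M k R' M' d l R'' M'')
  have "halts_in b ws P \<lparr>pc = a + code_size c, regs = R', mem = M'\<rparr> (l + t) s"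
    using Seq.prems by (intro Seq.IH(2)) (auto simp: code_at_append add.assoc)
  with Seq.IH(1)[of a "l + t"] Seq.prems show ?case by (auto simp: code_at_append add.assoc)
next
  case (CondTrue x R c M k R' M' d)
  have "halts_in b ws P \<lparr>pc = a + code_size d + 2, regs = R, mem = M\<rparr> (k + t) s"
    using CondTrue.prems by (intro CondTrue.IH) (auto simp: code_at_append algebra_simps)
  with halts_in_step[OF _ _ exec_jump_on[OF CondTrue.hyps(1)]] CondTrue.hyps CondTrue.prems
  show ?case by (auto simp: code_at_append)
next
  case (CondFalse x R d M k R' M' c)
  have "halts_in b ws P \<lparr>pc = Suc a + code_size d, regs = R', mem = M'\<rparr> (Suc t) s"
    using CondFalse.prems by (intro halts_in_jump) (auto simp: code_at_append algebra_simps)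
  then have "halts_in b ws P \<lparr>pc = Suc a, regs = R, mem = M\<rparr> (k + Suc t) s"
    using CondFalse.prems by (intro CondFalse.IH) (auto simp: code_at_append algebra_simps)
  with halts_in_step[OF _ _ exec_jump_on[OF CondFalse.hyps(1)]] CondFalse.hyps CondFalse.prems
  show ?case by (auto simp: code_at_append)
next
  case (WhileFalse R p q c M)
  have "halts_in b ws P \<lparr>pc = Suc a, regs = R, mem = M\<rparr> (Suc t) s"
    using WhileFalse.prems by (intro halts_in_jump) (auto simp: code_at_append algebra_simps)
  with halts_in_step[of a P "JumpLess p q (a + 2)" b ws R M] WhileFalse.hyps WhileFalse.prems
  show ?case by (auto simp: branch_def)
next
  case (WhileTrue R p q c M k R' M' l R'' M'')
  have "halts_in b ws P \<lparr>pc = a, regs = R', mem = M'\<rparr> (l + t) s"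
    using WhileTrue.prems by (intro WhileTrue.IH(2)) auto
  then have "halts_in b ws P \<lparr>pc = a + 2 + code_size c, regs = R', mem = M'\<rparr> (Suc (l + t)) s"
    using WhileTrue.prems by (intro halts_in_jump) (auto simp: code_at_append algebra_simps)
  then have "halts_in b ws P \<lparr>pc = a + 2, regs = R, mem = M\<rparr> (k + Suc (l + t)) s"
    using WhileTrue.prems by (intro WhileTrue.IH(1)) (auto simp: code_at_append)
  with halts_in_step[of a P "JumpLess p q (a + 2)" b ws R M] WhileTrue.hyps WhileTrue.prems
  show ?case by (auto simp: branch_def algebra_simps)
qed simp

abbreviation agree_off :: "'a set \<Rightarrow> ('a \<Rightarrow> 'b) \<Rightarrow> ('a \<Rightarrow> 'b) \<Rightarrow> bool" where
  "agree_off A f g \<equiv> \<forall>x. x \<notin> A \<longrightarrow> f x = g x"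

definition wp :: "nat \<Rightarrow> real list \<Rightarrow> com \<Rightarrow> (regfile \<Rightarrow> memory \<Rightarrow> nat \<Rightarrow> bool) \<Rightarrow>
    regfile \<Rightarrow> memory \<Rightarrow> nat \<Rightarrow> bool" where
  "wp b ws c Q R M t \<longleftrightarrow> (\<exists>k R' M'. run b ws c R M k R' M' \<and> Q R' M' (t + k))"

inductive_cases run_SkipE: "run b ws Skip R M k R' M'"
inductive_cases run_InsE: "run b ws (Ins i) R M k R' M'"
inductive_cases run_SeqE: "run b ws (c ;; d) R M k R' M'"
inductive_cases run_CondE: "run b ws (Cond x c d) R M k R' M'"

lemma wp_cong_state:
  "wp b ws c Q R M t \<Longrightarrow> R = R' \<Longrightarrow> M = M' \<Longrightarrow> t = t' \<Longrightarrow> wp b ws c Q R' M' t'"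
  by simp

lemma wp_Skip [simp]: "wp b ws Skip Q R M t \<longleftrightarrow> Q R M t"
proof
  assume "Q R M t"
  then show "wp b ws Skip Q R M t"
    unfolding wp_def using run.Skip by (intro exI[of _ 0] exI[of _ R] exI[of _ M]) simp
qed (auto simp: wp_def elim: run_SkipE)

lemma wp_Seq [simp]: "wp b ws (c ;; d) Q R M t \<longleftrightarrow> wp b ws c (wp b ws d Q) R M t"
proof
  assume "wp b ws (c ;; d) Q R M t"
  then obtain k R'' M'' where "run b ws (c ;; d) R M k R'' M''" "Q R'' M'' (t + k)"
    unfolding wp_def by blast
  then show "wp b ws c (wp b ws d Q) R M t"
    unfolding wp_def by (elim run_SeqE) (metis add.assoc)
next
  assume "wp b ws c (wp b ws d Q) R M t"
  then obtain k R' M' l R'' M'' where "run b ws c R M k R' M'" "run b ws d R' M' l R'' M''"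
    "Q R'' M'' (t + k + l)" unfolding wp_def by blast
  then show "wp b ws (c ;; d) Q R M t"
    unfolding wp_def by (intro exI[of _ "k + l"] exI[of _ R''] exI[of _ M''] conjI run.Seq)
      (simp_all add: add.assoc)
qed

lemma wp_Seq_fun: "wp b ws (c ;; d) Q = wp b ws c (wp b ws d Q)"
  by (intro ext) simp

lemma wp_Ins:
  assumes "is_basic i"
  shows "wp b ws (Ins i) Q R M t \<longleftrightarrow>
    (\<exists>s. exec_instr b ws i \<lparr>pc = 0, regs = R, mem = M\<rparr> = Some s \<and> Q (regs s) (mem s) (Suc t))"
    (is "_ \<longleftrightarrow> ?r")
proof
  assume "wp b ws (Ins i) Q R M t"
  then obtain k R' M' where "run b ws (Ins i) R M k R' M'" "Q R' M' (t + k)"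
    unfolding wp_def by blast
  then show ?r by (elim run_InsE) auto
next
  assume ?r
  then obtain s where "exec_instr b ws i \<lparr>pc = 0, regs = R, mem = M\<rparr> = Some s"
    "Q (regs s) (mem s) (Suc t)" by blast
  with run.Ins[OF assms this(1)] show "wp b ws (Ins i) Q R M t"
    unfolding wp_def by (intro exI[of _ 1] exI[of _ "regs s"] exI[of _ "mem s"]) simp
qed

lemma wp_instrs [simp]:
  "wp b ws (Ins (Const r k)) Q R M t \<longleftrightarrow> Q (R(r := take_bit b k)) M (Suc t)"
  "wp b ws (Ins (Move r q)) Q R M t \<longleftrightarrow> Q (R(r := R q)) M (Suc t)"
  "wp b ws (Ins (Op f r p q)) Q R M t \<longleftrightarrow> Q (R(r := eval_binop b f (R p) (R q))) M (Suc t)"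
  "wp b ws (Ins (Load r m p)) Q R M t \<longleftrightarrow> Q (R(r := M m (R p))) M (Suc t)"
  "wp b ws (Ins (Store m p r)) Q R M t \<longleftrightarrow> Q R (M(m := (M m)(R p := R r))) (Suc t)"
  by (simp_all add: wp_Ins set_reg_def)

lemma wp_FloorDiff:
  assumes "R i < length ws" "R j < length ws"
    and "0 \<le> \<lfloor>ws ! R i - ws ! R j\<rfloor>" "\<lfloor>ws ! R i - ws ! R j\<rfloor> < 2 ^ b"
  shows "wp b ws (Ins (FloorDiff r i j)) Q R M t \<longleftrightarrow>
    Q (R(r := nat \<lfloor>ws ! R i - ws ! R j\<rfloor>)) M (Suc t)"
  using assms by (simp add: wp_Ins set_reg_def Let_def)

lemma wp_Cond: "safe ws x R \<Longrightarrow> wp b ws (Cond x c d) Q R M t \<longleftrightarrow>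
    (if holds ws x R then wp b ws c Q R M (t + 1) else wp b ws d Q R M (t + 2))"
proof -
  assume s: "safe ws x R"
  show ?thesis
  proof (cases "holds ws x R")
    case True
    have "wp b ws (Cond x c d) Q R M t" if "wp b ws c Q R M (t + 1)"
    proof -
      from that obtain k R' M' where k: "run b ws c R M k R' M'" "Q R' M' (t + 1 + k)"
        unfolding wp_def by blast
      from run.CondTrue[OF s True k(1)] k(2) show ?thesis
        unfolding wp_def by (intro exI[of _ "k + 1"] exI[of _ R'] exI[of _ M']) (simp add: add.commute)
    qed
    moreover have "wp b ws c Q R M (t + 1)" if "wp b ws (Cond x c d) Q R M t"
    proof -
      from that obtain k R' M' where k: "run b ws (Cond x c d) R M k R' M'" "Q R' M' (t + k)"
        unfolding wp_def by blast
      from k(1) True obtain l where "k = l + 1" "run b ws c R M l R' M'"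
        by (auto elim: run_CondE)
      with k(2) show ?thesis
        unfolding wp_def by (intro exI[of _ l] exI[of _ R'] exI[of _ M']) (simp add: add.commute)
    qed
    ultimately show ?thesis using True by auto
  next
    case False
    have "wp b ws (Cond x c d) Q R M t" if "wp b ws d Q R M (t + 2)"
    proof -
      from that obtain k R' M' where k: "run b ws d R M k R' M'" "Q R' M' (t + 2 + k)"
        unfolding wp_def by blast
      from run.CondFalse[OF s False k(1)] k(2) show ?thesis
        unfolding wp_def by (intro exI[of _ "k + 2"] exI[of _ R'] exI[of _ M']) (simp add: add.commute)
    qed
    moreover have "wp b ws d Q R M (t + 2)" if "wp b ws (Cond x c d) Q R M t"
    proof -
      from that obtain k R' M' where k: "run b ws (Cond x c d) R M k R' M'" "Q R' M' (t + k)"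
        unfolding wp_def by blast
      from k(1) False obtain l where "k = l + 2" "run b ws d R M l R' M'"
        by (auto elim: run_CondE)
      with k(2) show ?thesis
        unfolding wp_def by (intro exI[of _ l] exI[of _ R'] exI[of _ M']) (simp add: add.commute)
    qed
    ultimately show ?thesis using False by auto
  qed
qed

lemma wp_Cond_Lt [simp]: "wp b ws (Cond (Lt p q) c d) Q R M t \<longleftrightarrow>
    (if R p < R q then wp b ws c Q R M (t + 1) else wp b ws d Q R M (t + 2))"
  by (simp add: wp_Cond)

text \<open>The time counter makes termination part of the invariant: it grows and is bounded.\<close>

lemma wp_While:
  assumes "I R M t"
    and bound: "\<And>R M t. I R M t \<Longrightarrow> t \<le> T"
    and body: "\<And>R M t. I R M t \<Longrightarrow> R p < R q \<Longrightarrow> wp b ws c I R M (t + 2)"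
    and exit: "\<And>R M t. I R M t \<Longrightarrow> \<not> R p < R q \<Longrightarrow> Q R M (t + 2)"
  shows "wp b ws (While p q c) Q R M t"
  using assms(1)
proof (induction "T - t" arbitrary: R M t rule: less_induct)
  case less
  show ?case
  proof (cases "R p < R q")
    case False
    with exit[OF less.prems] run.WhileFalse[of R p q] show ?thesis
      unfolding wp_def by (intro exI[of _ 2] exI[of _ R] exI[of _ M]) simp
  next
    case True
    from body[OF less.prems True] obtain k R' M' where
      k: "run b ws c R M k R' M'" "I R' M' (t + 2 + k)"
      unfolding wp_def by blast
    have "T - (t + 2 + k) < T - t" using bound[OF k(2)] by simp
    from less.hyps[OF this k(2)] obtain l R'' M'' where
      "run b ws (While p q c) R' M' l R'' M''" "Q R'' M'' (t + 2 + k + l)"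
      unfolding wp_def by blast
    with run.WhileTrue[OF True k(1) this(1)] show ?thesis
      unfolding wp_def by (intro exI[of _ "k + 2 + l"] exI[of _ R''] exI[of _ M''])
        (simp add: algebra_simps)
  qed
qed

lemma word_Add: "x + y < 2 ^ b \<Longrightarrow> eval_binop b Add x y = x + y"
  by (simp add: take_bit_nat_eq_self)

lemma word_Sub: "y \<le> x \<Longrightarrow> x < 2 ^ b \<Longrightarrow> eval_binop b Sub x y = x - y"
proof -
  assume "y \<le> x" "x < 2 ^ b"
  then have "x + 2 ^ b - y = (x - y) + 2 ^ b" by linarith
  moreover have "x - y < 2 ^ b" using \<open>x < 2 ^ b\<close> by linarith
  ultimately show ?thesis
    by (simp only: eval_binop.simps take_bit_eq_mod mod_add_self2 mod_less)
qed

lemma word_Mul: "x * y < 2 ^ b \<Longrightarrow> eval_binop b Mul x y = x * y"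
  by (simp add: take_bit_nat_eq_self)

section \<open>Chains\<close>

definition cdiv :: "nat \<Rightarrow> nat \<Rightarrow> nat" where
  "cdiv a g = (a + (g - 1)) div g"

lemma cdiv_le_iff: "0 < g \<Longrightarrow> cdiv a g \<le> q \<longleftrightarrow> a \<le> q * g"
proof -
  assume g: "0 < g"
  have "cdiv a g \<le> q \<longleftrightarrow> a + (g - 1) < Suc q * g"
    unfolding cdiv_def using g by (metis div_less_iff_less_mult less_Suc_eq_le)
  also have "\<dots> \<longleftrightarrow> a \<le> q * g" using g by (cases g) auto
  finally show ?thesis .
qed

lemma eq_if_le_iff: "(\<And>q. (a::nat) \<le> q \<longleftrightarrow> b \<le> q) \<Longrightarrow> a = b"
  by (meson order_antisym order_refl)

lemma cdiv_cdiv_add: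
  assumes "0 < g" "0 < g'"
  shows "cdiv (cdiv a g + c) g' = cdiv (a + c * g) (g * g')"
proof (rule eq_if_le_iff)
  fix q
  have "cdiv (cdiv a g + c) g' \<le> q \<longleftrightarrow> cdiv a g + c \<le> q * g'"
    using assms by (simp add: cdiv_le_iff)
  also have "\<dots> \<longleftrightarrow> a + c * g \<le> q * (g * g')"
  proof (cases "c \<le> q * g'")
    case True
    then have "cdiv a g + c \<le> q * g' \<longleftrightarrow> cdiv a g \<le> q * g' - c" by linarith
    also have "\<dots> \<longleftrightarrow> a \<le> (q * g' - c) * g" using assms by (simp add: cdiv_le_iff)
    also have "\<dots> \<longleftrightarrow> a \<le> q * (g * g') - c * g" by (simp add: diff_mult_distrib mult.assoc mult.commute[of g g'])
    also have "\<dots> \<longleftrightarrow> a + c * g \<le> q * (g * g')"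
    proof -
      have "c * g \<le> q * g' * g" using True by (rule mult_right_mono) simp
      then have "c * g \<le> q * (g * g')" by (simp only: mult.assoc mult.commute[of g g'])
      then show ?thesis by linarith
    qed
    finally show ?thesis .
  next
    case False
    then have "q * g' * g < c * g" using assms by (intro mult_strict_right_mono) auto
    then have "q * (g * g') < c * g" by (simp only: mult.assoc mult.commute[of g g'])
    then show ?thesis using False by linarith
  qed
  also have "\<dots> \<longleftrightarrow> cdiv (a + c * g) (g * g') \<le> q" using assms by (simp add: cdiv_le_iff)
  finally show "cdiv (cdiv a g + c) g' \<le> q \<longleftrightarrow> cdiv (a + c * g) (g * g') \<le> q" .
qed

lemma cdiv_2: "cdiv x 2 = x - x div 2"
  unfolding cdiv_def by presburger

lemma cdiv_pos_eq: "0 < u \<Longrightarrow> cdiv u g = (u - 1) div g + 1" if "0 < g"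
proof -
  assume "0 < u"
  then have "u + (g - 1) = (u - 1) + g" using that by linarith
  then show ?thesis unfolding cdiv_def using that by (metis div_add_self2 less_irrefl)
qed

lemma cdiv_0 [simp]: "cdiv 0 g = 0"
  by (cases g) (auto simp: cdiv_def)

lemma cdiv_1 [simp]: "cdiv a (Suc 0) = a"
  by (simp add: cdiv_def)


text \<open>
  An entry \<open>(i, a, g)\<close> of a chain stands for item \<open>i\<close> followed by the passage to the next level,
  on which \<open>x\<close> extra nodes turn into \<open>\<lceil>(x - a) / g\<rceil>\<close>: \<open>g\<close> nodes merge into one, and \<open>a\<close> extra
  nodes fit into an incomplete group. This form is closed under composition and under fixing
  items, which is what lets the search below forget items in constant time each.
\<close>

definition merged :: "nat \<Rightarrow> nat \<Rightarrow> nat \<Rightarrow> nat" where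
  "merged a g x = cdiv (x - a) g"

lemma merged_le_iff: "0 < g \<Longrightarrow> merged a g x \<le> q \<longleftrightarrow> x \<le> q * g + a"
  unfolding merged_def by (simp add: cdiv_le_iff) linarith

lemma merged_le: "0 < g \<Longrightarrow> merged a g x \<le> x"
  by (cases g) (auto simp: merged_le_iff)

lemma merged_0 [simp]: "merged a g 0 = 0"
  by (simp add: merged_def)

lemma merged_0_1 [simp]: "merged 0 (Suc 0) x = x"
  by (simp add: merged_def)

lemma merged_0_left: "merged 0 g x = cdiv x g"
  by (simp add: merged_def)

lemma merged_merged:
  "0 < g \<Longrightarrow> 0 < g' \<Longrightarrow> merged a' g' (merged a g x) = merged (a + a' * g) (g * g') x"
  by (rule eq_if_le_iff) (simp add: merged_le_iff algebra_simps)

lemma merged_cap: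
  assumes "x \<le> n" "0 < g" "0 < n"
  shows "merged (min n a) (min n g) x = merged a g x"
proof (rule eq_if_le_iff)
  fix q
  have "x \<le> q * min n g + min n a \<longleftrightarrow> x \<le> q * g + a"
  proof (cases "n \<le> a \<or> q = 0 \<or> g \<le> n")
    case False
    then have "n \<le> q * n" "n \<le> q * g" by (auto intro: order.trans[of _ "1 * g"])
    moreover have "x \<le> q * n" "x \<le> q * g" using assms calculation by linarith+
    ultimately show ?thesis using False by (simp add: min_def)
  qed (use assms in \<open>auto simp: min_def\<close>)
  then show "merged (min n a) (min n g) x \<le> q \<longleftrightarrow> merged a g x \<le> q"
    using assms by (simp add: merged_le_iff)
qed

definition shift :: "nat \<Rightarrow> nat \<Rightarrow> nat \<Rightarrow> nat \<times> nat" where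
  "shift a g c = (if c \<le> a then (a - c, 0) else (g - 1 - (c - a - 1) mod g, (c - a - 1) div g + 1))"

lemma merged_shift:
  assumes "0 < g"
  shows "merged a g (x + c) = merged (fst (shift a g c)) g x + snd (shift a g c)"
proof (cases "c \<le> a")
  case True
  then show ?thesis
    by (intro eq_if_le_iff) (auto simp: shift_def merged_le_iff assms)
next
  case False
  define u where "u = c - a - 1"
  define r where "r = u mod g"
  define k where "k = u div g"
  have c: "c = a + k * g + r + 1" using False by (simp add: u_def r_def k_def)
  have r: "r < g" using assms by (simp add: r_def)
  have "merged a g (x + c) = merged (g - 1 - r) g x + (k + 1)"
  proof (rule eq_if_le_iff)
    fix q
    show "merged a g (x + c) \<le> q \<longleftrightarrow> merged (g - 1 - r) g x + (k + 1) \<le> q"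
    proof (cases "k + 1 \<le> q")
      case True
      then obtain q' where q: "q = k + 1 + q'" by (auto simp: le_iff_add)
      have "merged a g (x + c) \<le> q \<longleftrightarrow> x + r + 1 \<le> q' * g + g"
        by (simp add: merged_le_iff assms c q algebra_simps)
      also have "\<dots> \<longleftrightarrow> x \<le> q' * g + (g - 1 - r)" using r by linarith
      also have "\<dots> \<longleftrightarrow> merged (g - 1 - r) g x + (k + 1) \<le> q"
        by (simp add: merged_le_iff assms q)
      finally show ?thesis .
    next
      case False
      then have "q \<le> k" by simp
      then have "q * g \<le> k * g" by (rule mult_right_mono) simp
      then have "\<not> x + c \<le> q * g + a" using c by linarith
      then show ?thesis using False by (simp add: merged_le_iff assms)
    qed
  qed
  then show ?thesis using False by (simp add: shift_def u_def r_def k_def)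
qed

lemma shift_bounds:
  assumes "0 < g" "a \<le> n" "g \<le> n"
  shows "fst (shift a g c) \<le> n" "snd (shift a g c) \<le> c"
proof -
  show "fst (shift a g c) \<le> n" using assms by (auto simp: shift_def)
  have "(c - a - 1) div g \<le> c - a - 1" by simp
  then have "(c - a - 1) div g + 1 \<le> c" if "\<not> c \<le> a" using that by linarith
  then show "snd (shift a g c) \<le> c" by (simp add: shift_def)
qed

lemma shift_0 [simp]: "shift a g 0 = (a, 0)"
  by (simp add: shift_def)

type_synonym chain = "(nat \<times> nat \<times> nat) list"

fun extra :: "nat set \<Rightarrow> nat \<Rightarrow> chain \<Rightarrow> nat" where
  "extra X x [] = x"
| "extra X x ((i, a, g) # cs) = extra X (merged a g (x + of_bool (i \<in> X))) cs"

definition wf_chain :: "nat \<Rightarrow> chain \<Rightarrow> bool" where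
  "wf_chain n cs \<longleftrightarrow> (\<forall>(i, a, g) \<in> set cs. a \<le> n \<and> 0 < g \<and> g \<le> n)"

lemma wf_chain_simps [simp]:
  "wf_chain n []"
  "wf_chain n ((i, a, g) # cs) \<longleftrightarrow> a \<le> n \<and> 0 < g \<and> g \<le> n \<and> wf_chain n cs"
  "wf_chain n (cs @ cs') \<longleftrightarrow> wf_chain n cs \<and> wf_chain n cs'"
  by (auto simp: wf_chain_def ball_Un)

lemma extra_append: "extra X x (cs @ cs') = extra X (extra X x cs) cs'"
  by (induction X x cs rule: extra.induct) auto

lemma extra_le: "wf_chain n cs \<Longrightarrow> extra X x cs \<le> x + length cs"
proof (induction X x cs rule: extra.induct)
  case (2 X x i a g cs)
  then have "extra X (merged a g (x + of_bool (i \<in> X))) cs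
    \<le> merged a g (x + of_bool (i \<in> X)) + length cs" by simp
  also have "merged a g (x + of_bool (i \<in> X)) \<le> x + of_bool (i \<in> X)"
    using 2 by (simp add: merged_le)
  also have "x + of_bool (i \<in> X) \<le> x + 1" by simp
  finally show ?case by simp
qed simp

lemma extra_empty: "extra {} 0 cs = 0"
  by (induction cs) auto

definition comp_last :: "nat \<Rightarrow> chain \<Rightarrow> nat \<Rightarrow> nat \<Rightarrow> chain" where
  "comp_last n cs a' g' = (if cs = [] then [] else
     case last cs of (i, a, g) \<Rightarrow> butlast cs @ [(i, min n (a + a' * g), min n (g * g'))])"

lemma comp_last_props:
  assumes "wf_chain n cs" "0 < g'" "0 < n"
  shows "wf_chain n (comp_last n cs a' g')" "length (comp_last n cs a' g') = length cs"
    "map fst (comp_last n cs a' g') = map fst cs"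
    "length cs \<le> n \<Longrightarrow> extra X 0 (comp_last n cs a' g') = merged a' g' (extra X 0 cs)"
proof -
  have *: "wf_chain n (comp_last n cs a' g') \<and> length (comp_last n cs a' g') = length cs \<and>
    map fst (comp_last n cs a' g') = map fst cs \<and>
    (length cs \<le> n \<longrightarrow> extra X 0 (comp_last n cs a' g') = merged a' g' (extra X 0 cs))"
  proof (cases cs rule: rev_cases)
    case (snoc ds e)
    obtain i a g where e: "e = (i, a, g)" by (cases e)
    have g: "0 < g" using assms snoc by (simp add: e)
    have "extra X 0 (comp_last n cs a' g') = merged a' g' (extra X 0 cs)" if "length cs \<le> n"
    proof -
      have "extra X 0 ds \<le> length ds" using extra_le[of n ds X 0] assms snoc by simp
      then have "extra X 0 ds + of_bool (i \<in> X) \<le> n" using that snoc by auto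
      from merged_cap[OF this, of "g * g'" "a + a' * g"]
      show ?thesis using g assms
        by (simp add: snoc e comp_last_def extra_append merged_merged)
    qed
    then show ?thesis using assms g by (simp add: snoc e comp_last_def)
  qed (simp add: comp_last_def)
  then show "wf_chain n (comp_last n cs a' g')" "length (comp_last n cs a' g') = length cs"
    "map fst (comp_last n cs a' g') = map fst cs"
    "length cs \<le> n \<Longrightarrow> extra X 0 (comp_last n cs a' g') = merged a' g' (extra X 0 cs)"
    by auto
qed

text \<open>The items in \<open>U\<close> become permanently chosen, those in \<open>K\<close> remain, the others are dropped.\<close>

fun reduce :: "nat \<Rightarrow> nat set \<Rightarrow> nat set \<Rightarrow> nat \<Rightarrow> chain \<Rightarrow> chain \<Rightarrow> nat \<times> chain" where
  "reduce n U K c out [] = (c, out)"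
| "reduce n U K c out ((i, a, g) # cs) =
     (case shift a g (c + of_bool (i \<in> U)) of (a', c') \<Rightarrow>
        reduce n U K c' (if i \<in> K then out @ [(i, a', g)] else comp_last n out a' g) cs)"

lemma reduce_extra:
  assumes "reduce n U K c out cs = (c', out')" "wf_chain n cs" "wf_chain n out"
    and "length out + length cs \<le> n" "0 < n" "X \<subseteq> K" "U \<inter> K = {}"
  shows "extra (X \<union> U) (extra X 0 out + c) cs = extra X 0 out' + c'"
  using assms
proof (induction n U K c out cs rule: reduce.induct)
  case (2 n U K c out i a g cs)
  obtain a' c'' where s: "shift a g (c + of_bool (i \<in> U)) = (a', c'')" by fastforce
  define out'' where "out'' = (if i \<in> K then out @ [(i, a', g)] else comp_last n out a' g)"
  have g: "0 < g" "a \<le> n" "g \<le> n" using "2.prems" by auto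
  have a': "a' \<le> n" using shift_bounds(1)[OF g, of "c + of_bool (i \<in> U)"] s by simp
  have wf: "wf_chain n out''" using "2.prems" comp_last_props(1) g a' by (simp add: out''_def)
  have len: "length out'' + length cs \<le> n"
    using "2.prems" comp_last_props(2) g by (simp add: out''_def)
  have "extra (X \<union> U) (extra X 0 out'' + c'') cs = extra X 0 out' + c'"
    using "2.prems" wf len unfolding out''_def by (intro "2.IH"[OF s[symmetric]]) (auto simp: s)
  moreover have "merged a g (extra X 0 out + c + of_bool (i \<in> X \<union> U)) = extra X 0 out'' + c''"
  proof -
    have "merged a g (extra X 0 out + c + of_bool (i \<in> X \<union> U)) =
      merged a g ((extra X 0 out + of_bool (i \<in> X)) + (c + of_bool (i \<in> U)))"
    proof -
      have "of_bool (i \<in> X \<union> U) = (of_bool (i \<in> X) + of_bool (i \<in> U) :: nat)"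
        using "2.prems"(6,7) by (cases "i \<in> U") auto
      then show ?thesis by (simp only: ac_simps)
    qed
    also have "\<dots> = merged a' g (extra X 0 out + of_bool (i \<in> X)) + c''"
      using merged_shift[OF g(1)] s by simp
    also have "merged a' g (extra X 0 out + of_bool (i \<in> X)) = extra X 0 out''"
    proof (cases "i \<in> K")
      case False
      then have "i \<notin> X" using "2.prems" by auto
      with False show ?thesis using "2.prems" comp_last_props(4)[of n out g X a'] g
        by (simp add: out''_def)
    qed (simp add: out''_def extra_append)
    finally show ?thesis .
  qed
  ultimately show ?case by simp
qed simp

lemma reduce_props:
  assumes "reduce n U K c out cs = (c', out')" "wf_chain n cs" "wf_chain n out" "0 < n"
  shows "wf_chain n out'" "map fst out' = map fst out @ filter (\<lambda>i. i \<in> K) (map fst cs)"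
proof -
  have "wf_chain n out' \<and> map fst out' = map fst out @ filter (\<lambda>i. i \<in> K) (map fst cs)"
    using assms
  proof (induction n U K c out cs rule: reduce.induct)
    case (2 n U K c out i a g cs)
    obtain a' c'' where s: "shift a g (c + of_bool (i \<in> U)) = (a', c'')" by fastforce
    define out'' where "out'' = (if i \<in> K then out @ [(i, a', g)] else comp_last n out a' g)"
    have g: "0 < g" "a \<le> n" "g \<le> n" using "2.prems" by auto
    have a': "a' \<le> n" using shift_bounds(1)[OF g, of "c + of_bool (i \<in> U)"] s by simp
    have wf: "wf_chain n out''" using "2.prems" comp_last_props(1) g a' by (simp add: out''_def)
    have "wf_chain n out' \<and> map fst out' = map fst out'' @ filter (\<lambda>i. i \<in> K) (map fst cs)"
      using "2.prems" wf unfolding out''_def by (intro "2.IH"[OF s[symmetric]]) (auto simp: s)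
    moreover have "map fst out'' = map fst out @ (if i \<in> K then [i] else [])"
      using "2.prems" comp_last_props(3) g by (simp add: out''_def)
    ultimately show ?case by auto
  qed simp
  then show "wf_chain n out'" "map fst out' = map fst out @ filter (\<lambda>i. i \<in> K) (map fst cs)"
    by auto
qed

section \<open>Lower bound\<close>

definition kappa :: "real \<Rightarrow> real \<Rightarrow> real" where
  "kappa r x = 2 powr - of_int \<lfloor>r - x\<rfloor>"

lemma kappa_mono: "x \<le> y \<Longrightarrow> kappa r x \<le> kappa r y"
  unfolding kappa_def by (simp add: floor_mono)

lemma kappa_Suc: "kappa r (x - 1) + kappa r (x - 1) = kappa r x"
proof -
  have "\<lfloor>r - (x - 1)\<rfloor> = \<lfloor>r - x\<rfloor> + 1" by linarith
  then have "- real_of_int \<lfloor>r - (x - 1)\<rfloor> = - real_of_int \<lfloor>r - x\<rfloor> - 1" by simp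
  then show ?thesis unfolding kappa_def by (simp only: powr_diff) simp
qed

lemma leaves_nonempty: "leaves t \<noteq> {#}"
  by (induction t) auto

text \<open>
  A tree with \<open>k\<close> leaves needs no depth beyond \<open>k - 1\<close>, so weights can be raised to \<open>c\<close>
  as long as \<open>c + (k - 1)\<close> does not exceed the weight of the root.
\<close>

lemma kraft_inequality:
  "(\<Sum>w\<in>#leaves t. kappa r (max c w)) \<le>
     kappa r (max (root_weight t) (c + real (size (leaves t)) - 1))"
proof (induction t)
  case (Leaf x)
  then show ?case by (simp add: max.commute)
next
  case (Unary t)
  have "kappa r (max (root_weight t) (c + real (size (leaves t)) - 1)) \<le>
    kappa r (max (root_weight (Unary t)) (c + real (size (leaves t)) - 1))"
    by (rule kappa_mono) auto
  with Unary show ?case by simp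
next
  case (Binary t u)
  define z where "z = max (root_weight (Binary t u)) (c + real (size (leaves (Binary t u))) - 1)"
  have "size (leaves t) \<ge> 1" "size (leaves u) \<ge> 1"
    using leaves_nonempty[of t] leaves_nonempty[of u] by (simp_all add: Suc_le_eq nonempty_has_size)
  then have "max (root_weight t) (c + real (size (leaves t)) - 1) \<le> z - 1"
    "max (root_weight u) (c + real (size (leaves u)) - 1) \<le> z - 1"
    by (auto simp: z_def)
  with Binary have "(\<Sum>w\<in>#leaves t. kappa r (max c w)) \<le> kappa r (z - 1)"
    "(\<Sum>w\<in>#leaves u. kappa r (max c w)) \<le> kappa r (z - 1)"
    by (meson kappa_mono order.trans)+
  then show ?case using kappa_Suc[of r z] by (simp add: z_def)
qed

lemma leaf_le_root: "w \<in># leaves t \<Longrightarrow> w \<le> root_weight t"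
  by (induction t) (auto simp: le_max_iff_disj intro: order.trans[of _ "_ :: real"]; force)+

text \<open>
  The raised weight of item \<open>i\<close> is \<open>val ws i - dep ws i\<close>; where raising takes effect,
  \<open>val ws i\<close> is the largest weight.
\<close>

definition top_weight :: "real list \<Rightarrow> real" where
  "top_weight ws = Max (set ws)"

definition near :: "real list \<Rightarrow> nat \<Rightarrow> bool" where
  "near ws i \<longleftrightarrow> top_weight ws - ws ! i \<le> real (length ws - 1)"

definition dep :: "real list \<Rightarrow> nat \<Rightarrow> nat" where
  "dep ws i = (if near ws i then nat \<lfloor>top_weight ws - ws ! i\<rfloor> else length ws - 1)"

definition val :: "real list \<Rightarrow> nat \<Rightarrow> real" where
  "val ws i = (if near ws i then ws ! i + real (dep ws i) else top_weight ws)"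

lemma top_weight_ge: "i < length ws \<Longrightarrow> ws ! i \<le> top_weight ws"
  by (simp add: top_weight_def)

lemma dep_near: "i < length ws \<Longrightarrow> near ws i \<Longrightarrow> real (dep ws i) = of_int \<lfloor>top_weight ws - ws ! i\<rfloor>"
  using top_weight_ge[of i ws] by (simp add: dep_def)

lemma dep_le:
  assumes "i < length ws"
  shows "dep ws i \<le> length ws - 1"
proof (cases "near ws i")
  case True
  then have "real (dep ws i) \<le> real (length ws - 1)"
    using dep_near[OF assms] unfolding near_def by linarith
  then show ?thesis by linarith
qed (simp add: dep_def)

lemma val_le: "i < length ws \<Longrightarrow> val ws i \<le> top_weight ws"
  unfolding val_def using dep_near[of i ws] by (cases "near ws i"; simp; linarith)

lemma val_gt: "i < length ws \<Longrightarrow> top_weight ws - 1 < val ws i"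
  unfolding val_def using dep_near[of i ws] by (cases "near ws i"; simp; linarith)

lemma val_minus_dep:
  assumes "i < length ws"
  shows "val ws i - real (dep ws i) = max (top_weight ws - real (length ws - 1)) (ws ! i)"
  using assms by (auto simp: val_def dep_def near_def)

definition kraft :: "real list \<Rightarrow> nat set \<Rightarrow> nat" where
  "kraft ws X = (\<Sum>i<length ws. (1 + of_bool (i \<in> X)) * 2 ^ (length ws - 1 - dep ws i))"

lemma minimax_lower_bound:
  assumes "ws \<noteq> []" "leaves t = mset ws" "p < length ws"
    and infeasible: "2 ^ (length ws - 1 + h) < kraft ws {i. val ws p \<le> val ws i}"
  shows "val ws p + real h \<le> root_weight t"
proof (rule ccontr)
  assume neg: "\<not> ?thesis"
  define r where "r = root_weight t"
  define n where "n = length ws"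
  define D where "D = n - 1"
  define c where "c = top_weight ws - real D"
  have r: "r < val ws p + real h" using neg by (simp add: r_def)
  have n: "n \<ge> 1" using assms by (simp add: n_def Suc_le_eq)
  have "top_weight ws \<in># leaves t"
    using assms by (simp add: top_weight_def)
  then have top: "top_weight ws \<le> r" unfolding r_def by (rule leaf_le_root)
  have "size (leaves t) = n" using assms by (simp add: n_def)
  then have "max r (c + real (size (leaves t)) - 1) = r"
    using top n by (simp add: c_def D_def of_nat_diff)
  then have "(\<Sum>w\<in>#mset ws. kappa r (max c w)) \<le> kappa r r"
    using kraft_inequality[where t = t and r = r and c = c] assms by (simp add: r_def)
  also have "kappa r r = 1" by (simp add: kappa_def)
  also have "(\<Sum>w\<in>#mset ws. kappa r (max c w)) = (\<Sum>i<n. kappa r (max c (ws ! i)))"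
    by (simp add: n_def sum_mset_sum_list sum_list_sum_nth atLeast0LessThan flip: mset_map)
  finally have le1: "(\<Sum>i<n. kappa r (max c (ws ! i))) \<le> 1" .
  have "real (kraft ws {i. val ws p \<le> val ws i}) \<le>
    (\<Sum>i<n. 2 ^ (D + h) * kappa r (max c (ws ! i)))"
    unfolding kraft_def of_nat_sum n_def[symmetric] D_def[symmetric]
  proof (rule sum_mono)
    fix i assume "i \<in> {..<n}"
    then have i: "i < length ws" by (simp add: n_def)
    define e :: nat where "e = of_bool (val ws p \<le> val ws i)"
    have w: "max c (ws ! i) = val ws i - real (dep ws i)"
      using val_minus_dep[OF i] by (simp add: c_def D_def n_def)
    have d: "dep ws i \<le> D" using dep_le[OF i] by (simp add: D_def n_def)
    have "r - max c (ws ! i) < real h + real (dep ws i) + 1 - real e"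
    proof (cases "val ws p \<le> val ws i")
      case True
      then show ?thesis using r w by (simp add: e_def)
    next
      case False
      have "val ws p \<le> top_weight ws" "top_weight ws - 1 < val ws i"
        using val_le[OF assms(3)] val_gt[OF i] by auto
      then show ?thesis using r w False by (simp add: e_def)
    qed
    then have "\<lfloor>r - max c (ws ! i)\<rfloor> < int h + int (dep ws i) + 1 - int e"
      by (simp add: floor_less_iff)
    then have "\<lfloor>r - max c (ws ! i)\<rfloor> \<le> int h + int (dep ws i) - int e" by simp
    then have "real_of_int \<lfloor>r - max c (ws ! i)\<rfloor> \<le> of_int (int h + int (dep ws i) - int e)"
      by (simp only: of_int_le_iff)
    then have "real_of_int \<lfloor>r - max c (ws ! i)\<rfloor> \<le> real h + real (dep ws i) - real e" by simp
    then have "2 powr (- (real h + real (dep ws i) - real e)) \<le> kappa r (max c (ws ! i))"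
      by (simp add: kappa_def)
    then have "2 ^ (D + h) * 2 powr (- (real h + real (dep ws i) - real e)) \<le>
      2 ^ (D + h) * kappa r (max c (ws ! i))" by simp
    also have "2 ^ (D + h) * (2::real) powr (- (real h + real (dep ws i) - real e)) =
      2 powr (real (D + h) + (- (real h + real (dep ws i) - real e)))"
      by (simp only: powr_add powr_realpow zero_less_numeral)
    also have "real (D + h) + (- (real h + real (dep ws i) - real e)) = real (D - dep ws i + e)"
      using d by (simp add: of_nat_diff)
    also have "2 powr real (D - dep ws i + e) = (2::real) ^ (D - dep ws i + e)"
      by (simp only: powr_realpow zero_less_numeral)
    also have "\<dots> = real ((1 + of_bool (i \<in> {i. val ws p \<le> val ws i})) * 2 ^ (D - dep ws i))"
      by (simp add: e_def)
    finally show "real ((1 + of_bool (i \<in> {i. val ws p \<le> val ws i})) * 2 ^ (D - dep ws i)) \<le>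
      2 ^ (D + h) * kappa r (max c (ws ! i))" .
  qed
  also have "\<dots> = 2 ^ (D + h) * (\<Sum>i<n. kappa r (max c (ws ! i)))" by (simp add: sum_distrib_left)
  also have "\<dots> \<le> 2 ^ (D + h)" using mult_left_mono[OF le1, of "2 ^ (D + h)"] by simp
  also have "\<dots> = real (2 ^ (D + h))" by simp
  finally show False using infeasible by (simp add: n_def D_def)
qed

section \<open>Thinning\<close>

definition cnt :: "(nat \<Rightarrow> bool) \<Rightarrow> (nat \<Rightarrow> nat) \<Rightarrow> nat \<Rightarrow> nat" where
  "cnt P f N = card {k. k < N \<and> P (f k)}"

lemma cnt_eq_sum: "cnt P f N = (\<Sum>k<N. of_bool (P (f k)))"
proof -
  have "{..<N} \<inter> {k. P (f k)} = {k. k < N \<and> P (f k)}" by blast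
  then show ?thesis by (simp add: cnt_def sum_of_bool_eq)
qed

lemma sum_pairs: "(\<Sum>k<N. g k) = (\<Sum>k<(N + 1) div 2. g (2 * k) + (if 2 * k + 1 < N then g (2 * k + 1) else 0))"
  for g :: "nat \<Rightarrow> nat"
proof (induction N rule: nat_less_induct)
  case (1 N)
  consider "N = 0" | "N = 1" | M where "N = M + 2" by (metis One_nat_def add_2_eq_Suc' not0_implies_Suc)
  then show ?case
  proof cases
    case (3 M)
    have IH: "(\<Sum>k<M. g k) = (\<Sum>k<(M + 1) div 2. g (2 * k) + (if 2 * k + 1 < M then g (2 * k + 1) else 0))"
      using 1 3 by simp
    have d: "(N + 1) div 2 = Suc ((M + 1) div 2)" using 3 by simp
    have N: "(\<Sum>k<N. g k) = (\<Sum>k<M. g k) + g M + g (M + 1)" using 3 by simp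
    show ?thesis
    proof (cases "even M")
      case True
      then obtain m where m: "M = 2 * m" by blast
      have "(\<Sum>k<m. g (2 * k) + (if 2 * k + 1 < N then g (2 * k + 1) else 0)) =
        (\<Sum>k<m. g (2 * k) + (if 2 * k + 1 < M then g (2 * k + 1) else 0))"
        by (rule sum.cong) (auto simp: 3 m)
      then show ?thesis unfolding N d IH using 3 m by simp
    next
      case False
      then obtain m where m: "M = 2 * m + 1" by (metis oddE)
      have "(\<Sum>k<m. g (2 * k) + (if 2 * k + 1 < N then g (2 * k + 1) else 0)) =
        (\<Sum>k<m. g (2 * k) + (if 2 * k + 1 < M then g (2 * k + 1) else 0))"
        by (rule sum.cong) (auto simp: 3 m)
      then show ?thesis unfolding N d IH using 3 m by simp
    qed
  qed auto
qed

lemma cnt_thin: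
  assumes closed: "\<And>i j. i < j \<Longrightarrow> j < N \<Longrightarrow> i div (2 * W) = j div (2 * W) \<Longrightarrow> P (f j) \<Longrightarrow> P (f i)"
    and W: "0 < W"
  shows "cnt P f N \<le> 2 * cnt P (\<lambda>k. f (2 * k)) ((N + 1) div 2)"
    and "2 * cnt P (\<lambda>k. f (2 * k)) ((N + 1) div 2) \<le> cnt P f N + cdiv N (2 * W)"
proof -
  let ?H = "(N + 1) div 2"
  let ?e = "\<lambda>k. (of_bool (P (f (2 * k))) :: nat)"
  let ?o = "\<lambda>k. (if 2 * k + 1 < N then of_bool (P (f (2 * k + 1))) else 0 :: nat)"
  have c: "cnt P f N = (\<Sum>k<?H. ?e k + ?o k)"
    unfolding cnt_eq_sum by (rule sum_pairs)
  have div_eq: "(2 * k + 1) div (2 * W) = 2 * k div (2 * W)" for k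
    by (simp add: div_mult2_eq)
  have oe: "?o k \<le> ?e k" for k
    using closed[of "2 * k" "2 * k + 1"] div_eq[of k] by auto
  have "(\<Sum>k<?H. ?e k + ?o k) \<le> (\<Sum>k<?H. 2 * ?e k)"
    using oe by (intro sum_mono) (metis add_le_mono le_refl mult_2)
  then show "cnt P f N \<le> 2 * cnt P (\<lambda>k. f (2 * k)) ?H"
    unfolding c unfolding cnt_eq_sum by (simp add: sum_distrib_left)
  define B where "B = {k. k < ?H \<and> ?o k < ?e k}"
  have "inj_on (\<lambda>k. 2 * k div (2 * W)) B"
  proof (rule linorder_inj_onI')
    fix k l assume kl: "k \<in> B" "l \<in> B" "k < l"
    then have l: "P (f (2 * l))" "2 * l < N" and k: "\<not> (2 * k + 1 < N \<and> P (f (2 * k + 1)))"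
      by (auto simp: B_def split: if_splits)
    show "2 * k div (2 * W) \<noteq> 2 * l div (2 * W)"
    proof
      assume "2 * k div (2 * W) = 2 * l div (2 * W)"
      then have "P (f (2 * k + 1))"
        using closed[of "2 * k + 1" "2 * l"] l kl div_eq[of k] by simp
      then show False using k l kl by simp
    qed
  qed
  moreover have "(\<lambda>k. 2 * k div (2 * W)) ` B \<subseteq> {..<cdiv N (2 * W)}"
  proof
    fix x assume "x \<in> (\<lambda>k. 2 * k div (2 * W)) ` B"
    then obtain k where k: "x = 2 * k div (2 * W)" "k < ?H" by (auto simp: B_def)
    have "\<not> cdiv N (2 * W) \<le> x"
    proof
      assume "cdiv N (2 * W) \<le> x"
      then have "N \<le> x * (2 * W)" using W by (simp add: cdiv_le_iff)
      also have "x * (2 * W) \<le> 2 * k" unfolding k(1) by (rule div_times_less_eq_dividend)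
      finally show False using k(2) by linarith
    qed
    then show "x \<in> {..<cdiv N (2 * W)}" by simp
  qed
  ultimately have B: "card B \<le> cdiv N (2 * W)"
    by (metis card_inj_on_le card_lessThan finite_lessThan)
  have "(\<Sum>k<?H. 2 * ?e k) \<le> (\<Sum>k<?H. ?e k + ?o k + of_bool (k \<in> B))"
    by (intro sum_mono) (auto simp: B_def)
  also have "\<dots> = (\<Sum>k<?H. ?e k + ?o k) + (\<Sum>k<?H. of_bool (k \<in> B))" by (simp only: sum.distrib)
  also have "(\<Sum>k<?H. of_bool (k \<in> B)) = card B"
  proof -
    have "{..<?H} \<inter> {k. k \<in> B} = B" unfolding B_def by blast
    then show ?thesis by (simp add: sum_of_bool_eq)
  qed
  finally show "2 * cnt P (\<lambda>k. f (2 * k)) ?H \<le> cnt P f N + cdiv N (2 * W)"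
    using B unfolding c unfolding cnt_eq_sum by (simp add: sum_distrib_left)
qed

section \<open>Splitting the weights\<close>

text \<open>
  Registers 0, 2, 3, 4 always hold \<open>n\<close>, 0, 1, 2; register 1 is left to the output. Banks 4 and 5
  hold \<^term>\<open>val ws i\<close> as the index of a weight and a shift, so that one instruction compares two of
  these reals, and bank 6 holds \<^term>\<open>dep ws i\<close>. Banks 7, 8 and 15, 16 hold the heads and links of
  bucket lists, 9 to 11 the chain, 12 and 13 the items of the approximate median, 14 the ranks, and
  17 and 18 the roots of the forest.
\<close>

locale ram =
  fixes b :: nat and ws :: "real list"
  assumes two_le: "2 \<le> length ws" and word: "length ws < 2 ^ b"
begin

abbreviation "n \<equiv> length ws"

definition env :: "regfile \<Rightarrow> bool" where
  "env R \<longleftrightarrow> R 0 = n \<and> R 2 = 0 \<and> R 3 = 1 \<and> R 4 = 2"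

definition weights_in :: "memory \<Rightarrow> bool" where
  "weights_in M \<longleftrightarrow> (\<forall>i<n. M 4 i < n \<and> ws ! M 4 i + real (M 5 i) = val ws i \<and> M 6 i = dep ws i)"

lemma wlt: "x \<le> n \<Longrightarrow> x < 2 ^ b"
  using word by linarith

lemma two_le_b: "2 \<le> b"
proof -
  have "(2::nat) ^ 1 < 2 ^ b" using wlt[of 2] two_le by simp
  then show ?thesis using power_less_imp_less_exp[of "2::nat" 1 b] by simp
qed

lemma word_consts: "b \<noteq> 0" "2 \<le> b" "0 < b" "take_bit b 0 = (0::nat)" "take_bit b (Suc 0) = Suc 0"
    "take_bit b 2 = (2::nat)"
  using two_le_b wlt[of 2] two_le by (auto simp: take_bit_nat_eq_self)

lemmas word_ops = word_consts word_Add[OF wlt] word_Sub[OF _ wlt] word_Mul[OF wlt]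

end

declare eval_binop.simps(1,2,3) [simp del]

definition find_top :: com where
  "find_top =
     Ins (Const 2 0) ;; Ins (Const 3 1) ;; Ins (Const 4 2) ;; Ins (Const 5 0) ;; Ins (Const 10 1) ;;
     While 10 0 (Cond (WLe 10 2 5 2) Skip (Ins (Move 5 10)) ;; Ins (Op Add 10 10 3))"

definition split_weights :: com where
  "split_weights =
     Ins (Op Sub 12 0 3) ;; Ins (Const 10 0) ;;
     While 10 0
       (Cond (WLe 5 2 10 12)
         (Ins (FloorDiff 11 5 10) ;; Ins (Store 6 10 11) ;; Ins (Store 4 10 10) ;; Ins (Store 5 10 11))
         (Ins (Store 6 10 12) ;; Ins (Store 4 10 5) ;; Ins (Store 5 10 2)) ;;
        Ins (Op Add 10 10 3))"

definition bucket :: "nat \<Rightarrow> nat \<Rightarrow> nat \<Rightarrow> com" where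
  "bucket key tab nx =
     Ins (Const 10 0) ;;
     While 10 0
       (Ins (Load 11 key 10) ;; Ins (Load 12 tab 11) ;; Ins (Store nx 10 12) ;;
        Ins (Op Add 10 10 3) ;; Ins (Store tab 11 10))"

text \<open>Links are stored incremented by one, so that 0 ends a list.\<close>

fun linked :: "(nat \<Rightarrow> nat) \<Rightarrow> nat \<Rightarrow> nat list \<Rightarrow> bool" where
  "linked nx h [] \<longleftrightarrow> h = 0"
| "linked nx h (x # xs) \<longleftrightarrow> h = Suc x \<and> linked nx (nx x) xs"

lemma linked_upd: "i \<notin> set xs \<Longrightarrow> linked (nx(i := y)) h xs \<longleftrightarrow> linked nx h xs"
  by (induction xs arbitrary: h) auto

definition members :: "(nat \<Rightarrow> nat) \<Rightarrow> nat \<Rightarrow> nat \<Rightarrow> nat list" where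
  "members key l i = rev (filter (\<lambda>j. key j = l) [0..<i])"

lemma members_0 [simp]: "members key l 0 = []"
  by (simp add: members_def)

lemma members_Suc: "members key l (Suc i) = (if key i = l then i # members key l i else members key l i)"
  by (simp add: members_def)

lemma set_members: "set (members key l i) = {j. j < i \<and> key j = l}"
  by (auto simp: members_def)

lemma distinct_members: "distinct (members key l i)"
  by (simp add: members_def)

context ram
begin

lemma find_top_wp:
  assumes "R 0 = n"
    and "\<And>R' t'. env R' \<Longrightarrow> R' 5 < n \<Longrightarrow> ws ! R' 5 = top_weight ws \<Longrightarrow>
      t' \<le> t + 20 * n \<Longrightarrow> Q R' M t'"
  shows "wp b ws find_top Q R M t"
proof -
  let ?I = "\<lambda>R M' t'. M' = M \<and> env R \<and> R 10 \<le> n \<and> R 5 < n \<and> (\<forall>i<R 10. ws ! i \<le> ws ! R 5) \<and>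
    t' \<le> t + 5 + 6 * R 10"
  have "wp b ws (While 10 0 (Cond (WLe 10 2 5 2) Skip (Ins (Move 5 10)) ;; Ins (Op Add 10 10 3))) Q
    (R(2 := 0, 3 := 1, 4 := 2, 5 := 0, 10 := 1)) M (t + 5)"
  proof (rule wp_While[where I = ?I and T = "t + 5 + 6 * n"])
    show "?I (R(2 := 0, 3 := 1, 4 := 2, 5 := 0, 10 := 1)) M (t + 5)"
      using assms two_le by (auto simp: env_def)
  next
    fix R M' t' assume I: "?I R M' t'" and "R 10 < R 0"
    then show "wp b ws (Cond (WLe 10 2 5 2) Skip (Ins (Move 5 10)) ;; Ins (Op Add 10 10 3)) ?I R M' (t' + 2)"
      by (auto simp: env_def wp_Cond word_ops less_Suc_eq intro: order.trans)
  next
    fix R M' t' assume I: "?I R M' t'" and "\<not> R 10 < R 0"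
    then have "R 10 = n" by (simp add: env_def)
    with I have "ws ! R 5 = top_weight ws"
      unfolding top_weight_def
      by (intro Max_eqI[symmetric]) (auto simp: in_set_conv_nth)
    with I \<open>R 10 = n\<close> show "Q R M' (t' + 2)" using two_le by (auto intro!: assms(2))
  qed auto
  from wp_cong_state[OF this] show ?thesis
    by (simp add: find_top_def word_consts)
qed

lemma split_weights_wp:
  assumes "env R" "R 5 < n" "ws ! R 5 = top_weight ws"
    and "\<And>R' M' t'. env R' \<Longrightarrow> weights_in M' \<Longrightarrow> agree_off {4, 5, 6} M' M \<Longrightarrow>
      t' \<le> t + 20 * n \<Longrightarrow> Q R' M' t'"
  shows "wp b ws split_weights Q R M t"
proof -
  let ?W = "\<lambda>M i. M 4 i < n \<and> ws ! M 4 i + real (M 5 i) = val ws i \<and> M 6 i = dep ws i"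
  let ?I = "\<lambda>R M' t'. env R \<and> R 10 \<le> n \<and> R 5 < n \<and> ws ! R 5 = top_weight ws \<and> R 12 = n - 1 \<and>
    (\<forall>i<R 10. ?W M' i) \<and> agree_off {4, 5, 6} M' M \<and> t' \<le> t + 2 + 12 * R 10"
  let ?body = "Cond (WLe 5 2 10 12)
         (Ins (FloorDiff 11 5 10) ;; Ins (Store 6 10 11) ;; Ins (Store 4 10 10) ;; Ins (Store 5 10 11))
         (Ins (Store 6 10 12) ;; Ins (Store 4 10 5) ;; Ins (Store 5 10 2)) ;;
        Ins (Op Add 10 10 3)"
  have "wp b ws (While 10 0 ?body) Q (R(12 := n - 1, 10 := 0)) M (t + 2)"
  proof (rule wp_While[where I = ?I and T = "t + 2 + 12 * n"])
    show "?I (R(12 := n - 1, 10 := 0)) M (t + 2)"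
      using assms two_le by (auto simp: env_def)
  next
    fix R M' t' assume I: "?I R M' t'" and "R 10 < R 0"
    then have i: "R 10 < n" by (simp add: env_def)
    show "wp b ws ?body ?I R M' (t' + 2)"
    proof (cases "near ws (R 10)")
      case True
      have d: "\<lfloor>top_weight ws - ws ! R 10\<rfloor> = int (dep ws (R 10))"
        using dep_near[OF i True] by linarith
      have "dep ws (R 10) < 2 ^ b" using dep_le[OF i] by (intro wlt) simp
      then have "int (dep ws (R 10)) < 2 ^ b" by simp
      then show ?thesis
        using I i True
        by (auto simp: env_def wp_Cond near_def wp_FloorDiff word_ops less_Suc_eq val_def d)
    next
      case False
      then show ?thesis
        using I i by (auto simp: env_def wp_Cond near_def wp_FloorDiff word_ops less_Suc_eq val_def dep_def)
    qed
  next
    fix R M' t' assume I: "?I R M' t'" and "\<not> R 10 < R 0"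
    then show "Q R M' (t' + 2)" using two_le
      by (intro assms(4)) (auto simp: weights_in_def env_def)
  qed auto
  from wp_cong_state[OF this] show ?thesis using assms two_le
    by (simp add: split_weights_def word_ops env_def)
qed

lemma bucket_wp:
  assumes "env R" "\<And>l. M tab l = 0" "key \<noteq> tab" "key \<noteq> nx" "tab \<noteq> nx"
    and "\<And>R' M' t'. env R' \<Longrightarrow> (\<forall>r<10. R' r = R r) \<Longrightarrow>
      (\<forall>l. linked (M' nx) (M' tab l) (members (M key) l n)) \<Longrightarrow>
      (\<forall>m. m \<notin> {tab, nx} \<longrightarrow> M' m = M m) \<Longrightarrow> t' \<le> t + 20 * n \<Longrightarrow> Q R' M' t'"
  shows "wp b ws (bucket key tab nx) Q R M t"
proof -
  let ?I = "\<lambda>R' M' t'. env R' \<and> R' 10 \<le> n \<and> (\<forall>r<10. R' r = R r) \<and>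
     (\<forall>l. linked (M' nx) (M' tab l) (members (M key) l (R' 10))) \<and>
     (\<forall>m. m \<notin> {tab, nx} \<longrightarrow> M' m = M m) \<and> t' \<le> t + 1 + 7 * R' 10"
  let ?body = "Ins (Load 11 key 10) ;; Ins (Load 12 tab 11) ;; Ins (Store nx 10 12) ;;
        Ins (Op Add 10 10 3) ;; Ins (Store tab 11 10)"
  have "wp b ws (While 10 0 ?body) Q (R(10 := 0)) M (t + 1)"
  proof (rule wp_While[where I = ?I and T = "t + 1 + 7 * n"])
    show "?I (R(10 := 0)) M (t + 1)"
      using assms by (auto simp: env_def)
  next
    fix R' M' t' assume I: "?I R' M' t'" and "R' 10 < R' 0"
    then have i: "R' 10 < n" by (simp add: env_def)
    have key: "M' key = M key" using I assms by simp
    let ?i = "R' 10"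
    have "linked ((M' nx)(?i := M' tab (M key ?i))) (((M' tab)(M key ?i := Suc ?i)) l)
      (members (M key) l (Suc ?i))" for l
      using I by (auto simp: members_Suc linked_upd set_members)
    then show "wp b ws ?body ?I R' M' (t' + 2)"
      using I i assms by (auto simp: env_def word_ops key)
  next
    fix R' M' t' assume I: "?I R' M' t'" and "\<not> R' 10 < R' 0"
    then show "Q R' M' (t' + 2)" using two_le
      by (intro assms(6)) (auto simp: env_def)
  qed auto
  then show ?thesis by (simp add: bucket_def word_consts)
qed

end

section \<open>Computing the chain\<close>

definition shift_code :: com where
  "shift_code =
     Cond (Lt 20 22)
       (Ins (Op Sub 23 22 20) ;; Ins (Op Sub 23 23 3) ;; Ins (Op Mod 24 23 21) ;; Ins (Op Sub 20 21 3) ;;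
        Ins (Op Sub 20 20 24) ;; Ins (Op Div 22 23 21) ;; Ins (Op Add 22 22 3))
       (Ins (Op Sub 20 20 22) ;; Ins (Move 22 2))"

definition mul_code :: com where
  "mul_code =
     Cond (Lt 2 31)
       (Ins (Op Div 25 0 31) ;; Cond (Lt 25 32) (Ins (Move 29 0)) (Ins (Op Mul 29 31 32)))
       (Ins (Move 29 2))"

definition compose_code :: com where
  "compose_code =
     Cond (Lt 2 13)
       (Ins (Op Sub 26 13 3) ;; Ins (Load 27 10 26) ;; Ins (Load 28 11 26) ;;
        Ins (Move 31 20) ;; Ins (Move 32 28) ;; mul_code ;; Ins (Op Sub 30 0 27) ;;
        Cond (Lt 30 29) (Ins (Move 27 0)) (Ins (Op Add 27 27 29)) ;;
        Ins (Store 10 26 27) ;; Ins (Move 31 28) ;; Ins (Move 32 21) ;; mul_code ;; Ins (Store 11 26 29))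
       Skip"

definition halve_code :: com where
  "halve_code =
     Ins (Move 20 2) ;; Ins (Move 21 4) ;; Ins (Move 22 14) ;; shift_code ;; Ins (Move 14 22) ;;
     compose_code"

definition fill_code :: com where
  "fill_code =
     While 2 16
       (Ins (Op Sub 16 16 3) ;; Ins (Store 9 13 16) ;; Ins (Store 10 13 2) ;; Ins (Store 11 13 3) ;;
        Ins (Op Add 13 13 3) ;; Ins (Op Add 14 14 3) ;; Ins (Load 16 8 16))"

definition chain_code :: com where
  "chain_code =
     Ins (Const 13 0) ;; Ins (Const 14 0) ;; Ins (Move 15 0) ;;
     While 2 15
       (Ins (Op Sub 15 15 3) ;; Ins (Load 16 7 15) ;;
        fill_code ;;
        halve_code) ;;
     While 3 14 halve_code ;;
     Ins (Move 6 13)"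

definition chain :: "memory \<Rightarrow> nat \<Rightarrow> chain" where
  "chain M s = map (\<lambda>k. (M 9 k, M 10 k, M 11 k)) [0..<s]"

lemma chain_0 [simp]: "chain M 0 = []"
  by (simp add: chain_def)

lemma chain_Suc: "chain M (Suc s) = chain M s @ [(M 9 s, M 10 s, M 11 s)]"
  by (simp add: chain_def)

lemma length_chain [simp]: "length (chain M s) = s"
  by (simp add: chain_def)

lemma chain_cong:
  "(\<And>k. k < s \<Longrightarrow> M 9 k = M' 9 k \<and> M 10 k = M' 10 k \<and> M 11 k = M' 11 k) \<Longrightarrow> chain M s = chain M' s"
  by (simp add: chain_def)

lemma extra_append_members:
  "extra X 0 (cs @ map (\<lambda>i. (i, 0, Suc 0)) is) = extra X 0 cs + (\<Sum>i\<leftarrow>is. of_bool (i \<in> X))"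
proof -
  have "extra X x (map (\<lambda>i. (i, 0, Suc 0)) is) = x + (\<Sum>i\<leftarrow>is. of_bool (i \<in> X))" for x
    by (induction "is" arbitrary: x) auto
  then show ?thesis by (simp add: extra_append)
qed

definition level_count :: "real list \<Rightarrow> nat \<Rightarrow> nat set \<Rightarrow> nat" where
  "level_count ws l X = cdiv (\<Sum>i | i < length ws \<and> l \<le> dep ws i.
     (1 + of_bool (i \<in> X)) * 2 ^ (length ws - 1 - dep ws i)) (2 ^ (length ws - l))"

lemma level_count_top: "ws \<noteq> [] \<Longrightarrow> level_count ws (length ws) X = 0"
proof -
  assume "ws \<noteq> []"
  have "\<not> length ws \<le> dep ws i" if "i < length ws" for i
    using dep_le[OF that] that by linarith
  then have "{i. i < length ws \<and> length ws \<le> dep ws i} = {}" by blast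
  then show ?thesis by (simp add: level_count_def)
qed

lemma level_count_0: "level_count ws 0 X = cdiv (kraft ws X) (2 ^ length ws)"
  by (simp add: level_count_def kraft_def lessThan_def)

lemma level_count_step:
  assumes "l < length ws"
  shows "level_count ws l X =
    cdiv (level_count ws (Suc l) X + (\<Sum>i\<leftarrow>members (dep ws) l (length ws). 1 + of_bool (i \<in> X))) 2"
proof -
  let ?n = "length ws"
  let ?w = "\<lambda>i. 1 + of_bool (i \<in> X) :: nat"
  let ?f = "\<lambda>i. ?w i * 2 ^ (?n - 1 - dep ws i)"
  have un: "{i. i < ?n \<and> l \<le> dep ws i} = {i. i < ?n \<and> Suc l \<le> dep ws i} \<union> set (members (dep ws) l ?n)"
    by (auto simp: set_members)
  have "sum ?f {i. i < ?n \<and> l \<le> dep ws i} =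
    sum ?f {i. i < ?n \<and> Suc l \<le> dep ws i} + sum ?f (set (members (dep ws) l ?n))"
    unfolding un by (rule sum.union_disjoint) (auto simp: set_members)
  also have "sum ?f (set (members (dep ws) l ?n)) = (\<Sum>i\<in>set (members (dep ws) l ?n). ?w i) * 2 ^ (?n - Suc l)"
    unfolding sum_distrib_right by (rule sum.cong) (auto simp: set_members)
  also have "(\<Sum>i\<in>set (members (dep ws) l ?n). ?w i) = (\<Sum>i\<leftarrow>members (dep ws) l ?n. ?w i)"
    by (simp add: sum_list_distinct_conv_sum_set distinct_members)
  finally have s: "sum ?f {i. i < ?n \<and> l \<le> dep ws i} = sum ?f {i. i < ?n \<and> Suc l \<le> dep ws i} +
    (\<Sum>i\<leftarrow>members (dep ws) l ?n. ?w i) * 2 ^ (?n - Suc l)" .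
  have "(2::nat) ^ (?n - l) = 2 ^ (?n - Suc l) * 2"
    using assms by (simp add: Suc_diff_Suc flip: power_Suc2)
  then show ?thesis
    unfolding level_count_def s by (subst cdiv_cdiv_add) auto
qed

lemma kraft_UNIV: "kraft ws UNIV = 2 * kraft ws {}"
  unfolding kraft_def sum_distrib_left by (rule sum.cong) simp_all

context ram
begin

lemma shift_wp:
  assumes "env R" "R 20 \<le> n" "0 < R 21" "R 21 \<le> n" "R 22 \<le> n"
    and "\<And>R' t'. agree_off {20, 22, 23, 24} R' R \<Longrightarrow>
      R' 20 = fst (shift (R 20) (R 21) (R 22)) \<Longrightarrow> R' 22 = snd (shift (R 20) (R 21) (R 22)) \<Longrightarrow>
      t' \<le> t + 10 \<Longrightarrow> Q R' M t'"
  shows "wp b ws shift_code Q R M t"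
proof (cases "R 22 \<le> R 20")
  case True
  then show ?thesis using assms(1-5) unfolding shift_code_def
    by (auto simp: env_def word_ops shift_def intro!: assms(6) split: if_splits)
next
  case False
  have "(R 22 - R 20 - 1) div R 21 \<le> R 22 - R 20 - 1" by simp
  then have "(R 22 - R 20 - 1) div R 21 + 1 \<le> n" using assms(5) False by linarith
  moreover have "(R 22 - R 20 - 1) mod R 21 \<le> R 21 - 1"
    using assms(3) by (metis Suc_leI Suc_pred' le_diff_conv less_Suc_eq_le mod_less_divisor)
  ultimately show ?thesis using False assms(1-5) unfolding shift_code_def
    by (auto simp: env_def word_ops shift_def intro!: assms(6) split: if_splits)
qed

lemma mul_wp:
  assumes "env R" "R 31 \<le> n" "R 32 \<le> n"
    and "\<And>R' t'. (\<forall>s. s \<notin> {25, 29} \<longrightarrow> R' s = R s) \<Longrightarrow> R' 29 = min n (R 31 * R 32) \<Longrightarrow>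
      t' \<le> t + 6 \<Longrightarrow> Q R' M t'"
  shows "wp b ws mul_code Q R M t"
proof (cases "R 31 = 0")
  case True
  then show ?thesis using assms(1-3) unfolding mul_code_def
    by (auto simp: env_def intro!: assms(4) split: if_splits)
next
  case False
  have *: "n div R 31 < R 32 \<longleftrightarrow> n < R 31 * R 32"
    using False by (metis div_less_iff_less_mult mult.commute neq0_conv)
  show ?thesis
  proof (cases "n < R 31 * R 32")
    case True
    then show ?thesis using assms(1-3) False * unfolding mul_code_def
      by (auto simp: env_def intro!: assms(4) split: if_splits)
  next
    case F: False
    from word_Mul[OF wlt[OF leI[OF F]]]
    have "eval_binop b Mul (R 31) (R 32) = R 31 * R 32" .
    then show ?thesis using assms(1-3) False * F unfolding mul_code_def
      by (auto simp: env_def intro!: assms(4) split: if_splits)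
  qed
qed

lemma compose_wp:
  assumes "env R" "R 20 \<le> n" "R 21 \<le> n" "R 13 \<le> n" "wf_chain n (chain M (R 13))"
    and "\<And>R' M' t'. agree_off {25, 26, 27, 28, 29, 30, 31, 32} R' R \<Longrightarrow>
      chain M' (R 13) = comp_last n (chain M (R 13)) (R 20) (R 21) \<Longrightarrow>
      (\<forall>m k. m \<notin> {10, 11} \<or> R 13 \<le> k \<longrightarrow> M' m k = M m k) \<Longrightarrow> t' \<le> t + 40 \<Longrightarrow> Q R' M' t'"
  shows "wp b ws compose_code Q R M t"
proof (cases "R 13")
  case 0
  then show ?thesis using assms(1) unfolding compose_code_def
    by (auto simp: env_def comp_last_def intro!: assms(6) split: if_splits)
next
  case (Suc k)
  define a where "a = M 10 k"
  define g where "g = M 11 k"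
  have ag: "a \<le> n" "0 < g" "g \<le> n" using assms(5) by (auto simp: Suc chain_Suc a_def g_def)
  define c where "c = min n (R 20 * g)"
  define a' where "a' = min n (a + R 20 * g)"
  define g' where "g' = min n (g * R 21)"
  have *: "Q R' M' t'"
    if "agree_off {25, 26, 27, 28, 29, 30, 31, 32} R' R"
      "M' = M(10 := (M 10)(k := a'), 11 := (M 11)(k := g'))"
      "t' \<le> t + 40" for R' M' t'
  proof (rule assms(6))
    have "chain M' k = chain M k" by (rule chain_cong) (simp add: that)
    then show "chain M' (R 13) = comp_last n (chain M (R 13)) (R 20) (R 21)"
      by (simp add: Suc chain_Suc comp_last_def that(2) a_def g_def a'_def g'_def)
  qed (use that Suc in auto)
  have c: "c \<le> n" "n - a < c \<Longrightarrow> a' = n" "\<not> n - a < c \<Longrightarrow> eval_binop b Add a c = a'"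
  proof -
    show "c \<le> n" by (simp add: c_def)
    show "a' = n" if "n - a < c" using that ag unfolding c_def a'_def by linarith
    assume "\<not> n - a < c"
    then have "a + c = a'" "a + c \<le> n" using ag unfolding c_def a'_def by linarith+
    then show "eval_binop b Add a c = a'" by (simp add: word_ops)
  qed
  show ?thesis
    unfolding compose_code_def using assms(1-4) ag c
    apply (simp add: env_def word_ops Suc flip: a_def g_def)
    apply (rule mul_wp)
       apply (simp_all add: env_def flip: c_def)
    subgoal for R' t'
      apply (cases "n - a < c")
      subgoal
        apply (simp add: word_ops)
        apply (rule mul_wp)
           apply (simp_all add: env_def flip: g'_def)
        apply (rule *)
          apply clarsimp
         apply simp
        apply simp
        done
      subgoal
        apply (simp add: word_ops)
        apply (rule mul_wp)
           apply (simp_all add: env_def flip: g'_def)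
        apply (rule *)
          apply clarsimp
         apply simp
        apply simp
        done
      done
    done
qed

end

lemma members_cong: "(\<And>i. i < n \<Longrightarrow> key i = key' i) \<Longrightarrow> members key l n = members key' l n"
  unfolding members_def by (intro arg_cong[of _ _ rev] filter_cong) auto

lemma linked_pos: "linked nx h xs \<Longrightarrow> 0 < h \<longleftrightarrow> xs \<noteq> []"
  by (cases xs) auto

lemma length_le_if_distinct: "distinct xs \<Longrightarrow> set xs \<subseteq> {..<n} \<Longrightarrow> length xs \<le> n"
  by (metis card_lessThan card_mono distinct_card finite_lessThan)

lemma kraft_empty_gt:
  assumes "2 \<le> length ws"
  shows "2 ^ (length ws - 1) < kraft ws {}"
proof -
  let ?n = "length ws"
  let ?f = "\<lambda>i. 2 ^ (?n - 1 - dep ws i) :: nat"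
  have "top_weight ws \<in> set ws" unfolding top_weight_def using assms by (intro Max_in) auto
  then obtain i where i: "i < ?n" "ws ! i = top_weight ws" by (auto simp: in_set_conv_nth)
  then have d: "dep ws i = 0" by (simp add: dep_def near_def)
  obtain j where j: "j < ?n" "j \<noteq> i" using assms
    by (cases "i = 0") (auto intro: that[of 0] that[of 1])
  have "sum ?f {i, j} \<le> sum ?f {..<?n}"
    using i j by (intro sum_mono2) auto
  then have "?f i + ?f j \<le> kraft ws {}" using j by (simp add: kraft_def)
  moreover have "0 < ?f j" "?f i = 2 ^ (?n - 1)" using d by simp_all
  ultimately show ?thesis by linarith
qed

lemma sum_list_Suc: "(\<Sum>i\<leftarrow>xs. 1 + f i) = length xs + (\<Sum>i\<leftarrow>xs. f i)" for f :: "'a \<Rightarrow> nat"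
  by (induction xs) auto

context ram
begin

lemma halve_wp:
  assumes "env R" "R 14 \<le> n" "R 13 \<le> n" "wf_chain n (chain M (R 13))"
    and Q: "\<And>R' M' t'. agree_off {14, 20, 21, 22, 23, 24, 25, 26, 27, 28, 29, 30, 31, 32} R' R \<Longrightarrow>
      R' 14 = cdiv (R 14) 2 \<Longrightarrow> wf_chain n (chain M' (R 13)) \<Longrightarrow>
      map fst (chain M' (R 13)) = map fst (chain M (R 13)) \<Longrightarrow>
      (\<forall>X. cdiv (R 14) 2 + extra X 0 (chain M' (R 13)) = cdiv (R 14 + extra X 0 (chain M (R 13))) 2) \<Longrightarrow>
      agree_off {10, 11} M' M \<Longrightarrow> t' \<le> t + 60 \<Longrightarrow> Q R' M' t'"
  shows "wp b ws halve_code Q R M t"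
proof -
  obtain a c where s: "shift 0 2 (R 14) = (a, c)" by fastforce
  have m: "cdiv (x + R 14) 2 = merged a 2 x + c" for x
    using merged_shift[of 2 0 x "R 14"] by (simp add: s merged_0_left)
  have c: "c = cdiv (R 14) 2" using m[of 0] by simp
  have mm: "cdiv (R 14) 2 + merged a 2 x = cdiv (R 14 + x) 2" for x
    using m[of x] c by (simp add: add.commute)
  have a: "a \<le> n" "c \<le> n"
    using shift_bounds[of 2 0 n "R 14"] two_le assms(2) by (auto simp: s)
  let ?cs = "chain M (R 13)"
  have "0 < n" using two_le by linarith
  note cl = comp_last_props[OF assms(4) _ this, where g' = 2 and a' = a, simplified]
  show ?thesis
    unfolding halve_code_def using assms(1-4) two_le a
    apply (simp add: env_def)
    apply (rule shift_wp)
         apply (simp_all add: env_def s)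
    apply (rule compose_wp)
         apply (simp_all add: env_def)
    apply (rule Q)
          apply clarsimp
         apply (simp add: c)
        apply (simp add: cl)
       apply (simp add: cl)
    subgoal by (simp add: cl(4) mm)
     apply (intro allI impI ext)
     apply simp
    apply simp
    done
qed

lemma fill_wp:
  assumes "env R" "linked (M 8) (R 16) ms" "R 14 \<le> n" "R 13 + length ms \<le> n" "R 14 \<le> R 13" "set ms \<subseteq> {..<n}"
    and Q: "\<And>R' M' t'. agree_off {13, 14, 16} R' R \<Longrightarrow>
      R' 13 = R 13 + length ms \<Longrightarrow> R' 14 = R 14 + length ms \<Longrightarrow>
      chain M' (R' 13) = chain M (R 13) @ map (\<lambda>i. (i, 0, Suc 0)) ms \<Longrightarrow>
      agree_off {9, 10, 11} M' M \<Longrightarrow> t' \<le> t + 2 + 9 * length ms \<Longrightarrow> Q R' M' t'"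
  shows "wp b ws fill_code Q R M t"
proof -
  let ?I = "\<lambda>R' M' t'. \<exists>done rest. ms = done @ rest \<and> linked (M 8) (R' 16) rest \<and>
    agree_off {13, 14, 16} R' R \<and> R' 13 = R 13 + length done \<and> R' 14 = R 14 + length done \<and>
    chain M' (R' 13) = chain M (R 13) @ map (\<lambda>i. (i, 0, Suc 0)) done \<and>
    agree_off {9, 10, 11} M' M \<and> t' \<le> t + 9 * length done"
  show ?thesis
    unfolding fill_code_def
  proof (rule wp_While[where I = ?I and T = "t + 9 * length ms"])
    show "?I R M t" using assms by (intro exI[of _ "[]"] exI[of _ ms]) auto
  next
    fix R' M' t' assume "?I R' M' t'" and pos: "R' 2 < R' 16"
    then obtain d rest where I: "ms = d @ rest" "linked (M 8) (R' 16) rest"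
      "agree_off {13, 14, 16} R' R" "R' 13 = R 13 + length d" "R' 14 = R 14 + length d"
      "chain M' (R' 13) = chain M (R 13) @ map (\<lambda>i. (i, 0, Suc 0)) d"
      "agree_off {9, 10, 11} M' M" "t' \<le> t + 9 * length d" by blast
    obtain i rest' where r: "rest = i # rest'"
      using I(2) pos by (cases rest) auto
    have i: "i < n" using assms(6) by (simp add: I(1) r)
    have h: "R' 16 = Suc i" "linked (M 8) (M 8 i) rest'" using I(2) r by auto
    have e: "R' 2 = 0" "R' 3 = 1" using assms(1) I(3) by (auto simp: env_def)
    have len: "R 13 + length d < n" "R 14 + length d < n" using assms(4,5) by (auto simp: I(1) r)
    let ?M = "M'(9 := (M' 9)(R' 13 := i), 10 := (M' 10)(R' 13 := 0), 11 := (M' 11)(R' 13 := Suc 0))"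
    have "chain ?M (R' 13) = chain M' (R' 13)" by (rule chain_cong) auto
    then have c: "chain ?M (Suc (R' 13)) = chain M (R 13) @ map (\<lambda>i. (i, 0, Suc 0)) (d @ [i])"
      by (simp add: chain_Suc I(6))
    let ?R = "R'(16 := M 8 i, 13 := Suc (R' 13), 14 := Suc (R' 14))"
    have "?I ?R ?M (Suc (Suc (Suc (Suc (Suc (Suc (Suc (Suc (Suc t')))))))))"
      using I h c by (intro exI[of _ "d @ [i]"] exI[of _ rest']) (auto simp: r)
    then show "wp b ws (Ins (Op Sub 16 16 3) ;; Ins (Store 9 13 16) ;; Ins (Store 10 13 2) ;;
        Ins (Store 11 13 3) ;; Ins (Op Add 13 13 3) ;; Ins (Op Add 14 14 3) ;; Ins (Load 16 8 16)) ?I R' M' (t' + 2)"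
      by (simp add: word_ops e h len I(4,5) i Suc_leI I(7))
  next
    fix R' M' t' assume I: "?I R' M' t'" and "\<not> R' 2 < R' 16"
    then show "Q R' M' (t' + 2)"
      using assms(1) by (auto simp: env_def linked_pos intro!: Q)
  qed (use assms in auto)
qed

lemma chain_wp:
  assumes "env R" "weights_in M" "\<forall>l. linked (M 8) (M 7 l) (members (M 6) l n)"
    and Q: "\<And>R' M' t' h. env R' \<Longrightarrow> R' 6 = n \<Longrightarrow> wf_chain n (chain M' n) \<Longrightarrow>
      distinct (map fst (chain M' n)) \<Longrightarrow> set (map fst (chain M' n)) = {..<n} \<Longrightarrow>
      (\<forall>X. extra X 0 (chain M' n) = 0 \<longleftrightarrow> kraft ws X \<le> 2 ^ (n + h)) \<Longrightarrow>
      2 ^ (n + h) < kraft ws UNIV \<Longrightarrow>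
      agree_off {9, 10, 11} M' M \<Longrightarrow> t' \<le> t + 300 * n \<Longrightarrow> Q R' M' t'"
  shows "wp b ws chain_code Q R M t"
proof -
  let ?mem = "\<lambda>l. members (dep ws) l n"
  let ?ids = "\<lambda>R M. map fst (chain M (R 13))"
  have mem: "members (M 6) l n = ?mem l" for l
    using assms(2) by (intro members_cong) (simp add: weights_in_def)
  have n: "0 < n" "ws \<noteq> []" using two_le by auto
  let ?J = "\<lambda>R' M' t'. env R' \<and> R' 14 \<le> R' 13 \<and> R' 13 \<le> n \<and> wf_chain n (chain M' (R' 13)) \<and>
    agree_off {9, 10, 11} M' M \<and> distinct (?ids R' M')"
  let ?I = "\<lambda>R' M' t'. ?J R' M' t' \<and> R' 15 \<le> n \<and>
    set (?ids R' M') = {i. i < n \<and> R' 15 \<le> dep ws i} \<and>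
    (\<forall>X. level_count ws (R' 15) X = R' 14 + extra X 0 (chain M' (R' 13))) \<and>
    t' + 100 * R' 15 \<le> t + 3 + 100 * n + 10 * R' 13"
  let ?K = "\<lambda>R' M' t'. ?J R' M' t' \<and> set (?ids R' M') = {..<n} \<and> 0 < R' 14 \<and>
    (\<exists>h. (\<forall>X. cdiv (kraft ws X) (2 ^ (n + h)) = R' 14 + extra X 0 (chain M' (R' 13))) \<and>
      2 ^ (n + h) < kraft ws UNIV) \<and> t' + 100 * R' 14 \<le> t + 5 + 210 * n"
  let ?tail = "While 3 14 halve_code ;; Ins (Move 6 13)"
  let ?body = "Ins (Op Sub 15 15 3) ;; Ins (Load 16 7 15) ;; fill_code ;; halve_code"
  have full: "R' 13 = n" if "distinct (?ids R' M')" "set (?ids R' M') = {..<n}" for R' :: regfile and M'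
    using distinct_card[OF that(1)] that(2) by simp
  have tail: "wp b ws ?tail Q R' M' t'" if "?K R' M' t'" for R' M' t'
    unfolding wp_Seq
  proof (rule wp_While[where I = ?K and T = "t + 5 + 210 * n"])
    show "?K R' M' t'" by (rule that)
  next
    fix R' M' t' assume K: "?K R' M' t'" and "R' 3 < R' 14"
    then have x: "2 \<le> R' 14" by (simp add: env_def)
    from K obtain h where h: "\<forall>X. cdiv (kraft ws X) (2 ^ (n + h)) = R' 14 + extra X 0 (chain M' (R' 13))"
      by blast
    show "wp b ws halve_code ?K R' M' (t' + 2)"
    proof (rule halve_wp)
      fix R'' M'' t''
      assume H: "agree_off {14, 20, 21, 22, 23, 24, 25, 26, 27, 28, 29, 30, 31, 32} R'' R'"
        "R'' 14 = cdiv (R' 14) 2" "wf_chain n (chain M'' (R' 13))"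
        "map fst (chain M'' (R' 13)) = map fst (chain M' (R' 13))"
        "\<forall>X. cdiv (R' 14) 2 + extra X 0 (chain M'' (R' 13)) = cdiv (R' 14 + extra X 0 (chain M' (R' 13))) 2"
        "agree_off {10, 11} M'' M'" "t'' \<le> t' + 2 + 60"
      have r: "R'' 13 = R' 13" "env R''" using H(1) K by (auto simp: env_def)
      have c: "cdiv (kraft ws X) (2 ^ (n + Suc h)) = R'' 14 + extra X 0 (chain M'' (R'' 13))" for X
      proof -
        have "cdiv (kraft ws X) (2 ^ (n + Suc h)) = cdiv (cdiv (kraft ws X) (2 ^ (n + h)) + 0) 2"
          by (subst cdiv_cdiv_add) (auto simp: mult.commute)
        then show ?thesis using H(5) h by (simp add: r H(2))
      qed
      have "\<not> cdiv (kraft ws {}) (2 ^ (n + h)) \<le> 1"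
        using h x by (simp add: extra_empty)
      then have "2 ^ (n + Suc h) < kraft ws UNIV"
        by (simp add: cdiv_le_iff kraft_UNIV)
      moreover have "0 < cdiv (R' 14) 2" "cdiv (R' 14) 2 + 1 \<le> R' 14"
        unfolding cdiv_2 using x by linarith+
      ultimately show "?K R'' M'' t''"
        using K H c r by (auto intro!: exI[of _ "Suc h"])
    qed (use K in auto)
  next
    fix R' M' t' assume K: "?K R' M' t'" and "\<not> R' 3 < R' 14"
    then have x: "R' 14 = 1" by (auto simp: env_def)
    from K obtain h where h: "\<forall>X. cdiv (kraft ws X) (2 ^ (n + h)) = R' 14 + extra X 0 (chain M' (R' 13))"
      "2 ^ (n + h) < kraft ws UNIV" by blast
    have f: "R' 13 = n" using K full by blast
    have "extra X 0 (chain M' n) = 0 \<longleftrightarrow> kraft ws X \<le> 2 ^ (n + h)" for X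
      using h(1)[rule_format, of X] cdiv_le_iff[of "2 ^ (n + h)" "kraft ws X" 1] x f by auto
    with K h f two_le show "wp b ws (Ins (Move 6 13)) Q R' M' (t' + 2)"
      by (auto intro!: Q[of _ _ h] simp: env_def)
  qed auto
  have "wp b ws (While 2 15 ?body) (wp b ws ?tail Q) (R(13 := 0, 14 := 0, 15 := n)) M (t + 3)"
  proof (rule wp_While[where I = ?I and T = "t + 3 + 110 * n"])
    show "?I (R(13 := 0, 14 := 0, 15 := n)) M (t + 3)"
    proof -
      have "\<not> n \<le> dep ws i" if "i < n" for i using dep_le[OF that] that by linarith
      then show ?thesis using assms(1) level_count_top[OF n(2)] by (auto simp: env_def)
    qed
  next
    fix R' M' t' assume I: "?I R' M' t'" and "R' 2 < R' 15"
    then obtain l where l: "R' 15 = Suc l" by (cases "R' 15") (auto simp: env_def)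
    then have ln: "l < n" using I by simp
    let ?cs = "chain M' (R' 13)"
    have M': "M' 7 = M 7" "M' 8 = M 8" using I by auto
    have li: "linked (M' 8) (M' 7 l) (?mem l)" using assms(3) by (simp add: M' flip: mem)
    have dist: "distinct (?ids R' M' @ ?mem l)"
      using I by (auto simp: distinct_members set_members l)
    have sub: "set (?ids R' M' @ ?mem l) = {i. i < n \<and> l \<le> dep ws i}"
      using I by (auto simp: set_members l)
    have len: "R' 13 + length (?mem l) \<le> n"
      using length_le_if_distinct[OF dist, of n] sub by auto
    let ?R = "R'(15 := l, 16 := M' 7 l)"
    have "wp b ws (fill_code ;; halve_code) ?I ?R M' (t' + 4)"
      unfolding wp_Seq
    proof (rule fill_wp)
      fix R'' M'' t''
      assume F: "agree_off {13, 14, 16} R'' ?R" "R'' 13 = ?R 13 + length (?mem l)"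
        "R'' 14 = ?R 14 + length (?mem l)"
        "chain M'' (R'' 13) = chain M' (?R 13) @ map (\<lambda>i. (i, 0, Suc 0)) (?mem l)"
        "agree_off {9, 10, 11} M'' M'" "t'' \<le> t' + 4 + 2 + 9 * length (?mem l)"
      have env: "env R''" using F(1) I by (auto simp: env_def)
      have F15: "R'' 15 = l" using F(1) by simp
      have wf: "wf_chain n (chain M'' (R'' 13))"
        unfolding F(4) using I n by (auto simp: wf_chain_def)
      have ids: "map fst (chain M'' (R'' 13)) = ?ids R' M' @ ?mem l"
        unfolding F(4) by (simp add: comp_def)
      show "wp b ws halve_code ?I R'' M'' t''"
      proof (rule halve_wp)
        fix R3 M3 t3
        assume H: "agree_off {14, 20, 21, 22, 23, 24, 25, 26, 27, 28, 29, 30, 31, 32} R3 R''"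
          "R3 14 = cdiv (R'' 14) 2" "wf_chain n (chain M3 (R'' 13))"
          "map fst (chain M3 (R'' 13)) = map fst (chain M'' (R'' 13))"
          "\<forall>X. cdiv (R'' 14) 2 + extra X 0 (chain M3 (R'' 13)) = cdiv (R'' 14 + extra X 0 (chain M'' (R'' 13))) 2"
          "agree_off {10, 11} M3 M''" "t3 \<le> t'' + 60"
        have r: "R3 13 = R'' 13" "R3 15 = l" "env R3" using H(1) env F15 by (auto simp: env_def)
        have "level_count ws l X = R3 14 + extra X 0 (chain M3 (R3 13))" for X
        proof -
          have "level_count ws l X = cdiv (R' 14 + extra X 0 ?cs + (\<Sum>i\<leftarrow>?mem l. 1 + of_bool (i \<in> X))) 2"
            using I by (simp add: level_count_step[OF ln] l)
          also have "R' 14 + extra X 0 ?cs + (\<Sum>i\<leftarrow>?mem l. 1 + of_bool (i \<in> X)) =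
            R'' 14 + extra X 0 (chain M'' (R'' 13))"
            unfolding F(4) extra_append_members F(3) sum_list_Suc by simp
          finally show ?thesis using H(5) by (simp add: r H(2))
        qed
        moreover have "R3 14 \<le> R3 13" "R3 13 \<le> n"
          using F(2,3) I len by (auto simp: r H(2) cdiv_2)
        moreover have "t3 + 100 * R3 15 \<le> t + 3 + 100 * n + 10 * R3 13"
          using F(2,6) H(7) I by (simp add: r l)
        ultimately show "?I R3 M3 t3"
          using r H(3,4,6) F(5) I dist sub ids ln by auto
      qed (use env F I len wf in auto)
    qed (use I M' li len in \<open>auto simp: env_def set_members\<close>)
    then show "wp b ws ?body ?I R' M' (t' + 2)"
      using l I ln by (auto simp: env_def word_ops elim!: wp_cong_state)
  next
    fix R' M' t' assume I: "?I R' M' t'" and "\<not> R' 2 < R' 15"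
    then have l: "R' 15 = 0" by (auto simp: env_def)
    have sub: "set (?ids R' M') = {..<n}" using I by (auto simp: l)
    have f: "R' 13 = n" using full I sub by blast
    have c: "cdiv (kraft ws X) (2 ^ (n + 0)) = R' 14 + extra X 0 (chain M' (R' 13))" for X
      using I l by (simp add: level_count_0[symmetric])
    have "(2::nat) ^ n = 2 * 2 ^ (n - 1)" using n by (cases n) auto
    then have u: "2 ^ (n + 0) < kraft ws UNIV"
      using kraft_empty_gt[OF two_le] by (simp add: kraft_UNIV)
    have "0 < R' 14"
    proof (rule ccontr)
      assume "\<not> ?thesis"
      then have "cdiv (kraft ws {}) (2 ^ n) \<le> 0" using c[of "{}"] by (simp add: extra_empty)
      then have "kraft ws {} \<le> 0 * 2 ^ n" by (subst (asm) cdiv_le_iff) auto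
      then show False using u by (simp add: kraft_UNIV)
    qed
    then have "?K R' M' (t' + 2)" using I sub c u f by (auto intro!: exI[of _ 0])
    then show "wp b ws ?tail Q R' M' (t' + 2)" by (rule tail)
  qed auto
  from wp_cong_state[OF this] show ?thesis
    using assms(1) by (auto simp: chain_code_def word_consts env_def)
qed

end

section \<open>Approximate median\<close>

definition sorted_on :: "('a \<Rightarrow> real) \<Rightarrow> (nat \<Rightarrow> 'a) \<Rightarrow> nat \<Rightarrow> nat \<Rightarrow> bool" where
  "sorted_on v f a c \<longleftrightarrow> (\<forall>x y. a \<le> x \<and> x < y \<and> y < c \<longrightarrow> v (f x) \<le> v (f y))"

definition blocks :: "('a \<Rightarrow> real) \<Rightarrow> nat \<Rightarrow> (nat \<Rightarrow> 'a) \<Rightarrow> nat \<Rightarrow> bool" where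
  "blocks v w f N \<longleftrightarrow> (\<forall>x y. x < y \<and> y < N \<and> x div w = y div w \<longrightarrow> v (f x) \<le> v (f y))"

lemma blocks_1: "blocks v (Suc 0) f N"
  by (simp add: blocks_def)

lemma blocks_min: "blocks v w f N \<Longrightarrow> blocks v (min w N) f N"
  by (auto simp: blocks_def min_def)

lemma blocks_single: "blocks v w f N \<Longrightarrow> N \<le> w \<Longrightarrow> sorted_on v f 0 N"
  by (auto simp: blocks_def sorted_on_def)

lemma blocks_sorted_on:
  assumes "blocks v w f N" "c \<le> N" "c \<le> q * w + w" "q * w \<le> a" "0 < w"
  shows "sorted_on v f a c"
proof -
  have "x div w = q" if "a \<le> x" "x < c" for x
    by (rule div_nat_eqI) (use that assms in \<open>auto simp: algebra_simps\<close>)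
  then show ?thesis using assms(1,2) unfolding blocks_def sorted_on_def
    by (auto dest: order.strict_trans2)
qed

lemma blocks_extend:
  assumes "blocks v w f (q * w)" "sorted_on v f (q * w) c" "c \<le> q * w + w" "0 < w"
  shows "blocks v w f c"
  unfolding blocks_def
proof (intro allI impI)
  fix x y assume xy: "x < y \<and> y < c \<and> x div w = y div w"
  show "v (f x) \<le> v (f y)"
  proof (cases "y < q * w")
    case True
    then show ?thesis using assms(1) xy by (simp add: blocks_def)
  next
    case False
    then have "y div w = q" using xy assms by (intro div_nat_eqI) (auto simp: algebra_simps)
    then have "q * w \<le> x" using xy div_times_less_eq_dividend[of x w] by simp
    then show ?thesis using assms(2) xy by (simp add: sorted_on_def)
  qed
qed

lemma blocks_thin: "blocks v (2 * w) f N \<Longrightarrow> blocks v w (\<lambda>k. f (2 * k)) ((N + 1) div 2)"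
  unfolding blocks_def
proof (intro allI impI)
  fix x y
  assume b: "\<forall>x y. x < y \<and> y < N \<and> x div (2 * w) = y div (2 * w) \<longrightarrow> v (f x) \<le> v (f y)"
    and xy: "x < y \<and> y < (N + 1) div 2 \<and> x div w = y div w"
  have "2 * x < 2 * y" "2 * y < N" using xy by linarith+
  moreover have "2 * x div (2 * w) = 2 * y div (2 * w)" using xy by simp
  ultimately show "v (f (2 * x)) \<le> v (f (2 * y))" using b by blast
qed

definition merging :: "('a \<Rightarrow> real) \<Rightarrow> (nat \<Rightarrow> 'a) \<Rightarrow> nat \<Rightarrow> nat \<Rightarrow> nat \<Rightarrow> nat \<Rightarrow> nat \<Rightarrow> (nat \<Rightarrow> 'a) \<Rightarrow> nat \<Rightarrow> bool" where
  "merging v f lo mid hi i j g k \<longleftrightarrow>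
     lo \<le> i \<and> i \<le> mid \<and> mid \<le> j \<and> j \<le> hi \<and> k + mid = i + j \<and>
     mset (map g [lo..<k]) = mset (map f [lo..<i]) + mset (map f [mid..<j]) \<and>
     sorted_on v g lo k \<and>
     (\<forall>x y. lo \<le> x \<and> x < k \<and> (i \<le> y \<and> y < mid \<or> j \<le> y \<and> y < hi) \<longrightarrow> v (g x) \<le> v (f y))"

lemma merging_init: "lo \<le> mid \<Longrightarrow> mid \<le> hi \<Longrightarrow> merging v f lo mid hi lo mid g lo"
  by (simp add: merging_def sorted_on_def)

lemma merging_bounds: "merging v f lo mid hi i j g k \<Longrightarrow> lo \<le> k \<and> k \<le> hi"
  by (auto simp: merging_def)

lemma merging_left:
  assumes "merging v f lo mid hi i j g k" "sorted_on v f lo mid" "sorted_on v f mid hi"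
    and "i < mid" "j < hi \<Longrightarrow> v (f i) \<le> v (f j)"
  shows "merging v f lo mid hi (Suc i) j (g(k := f i)) (Suc k)"
proof -
  have b: "lo \<le> k" "lo \<le> i" using merging_bounds[OF assms(1)] assms(1) by (auto simp: merging_def)
  have "v (f i) \<le> v (f y)" if "i \<le> y \<and> y < mid \<or> j \<le> y \<and> y < hi" for y
  proof (cases "i \<le> y \<and> y < mid")
    case True
    then show ?thesis using assms(2) b by (cases "i = y") (auto simp: sorted_on_def)
  next
    case False
    with that have y: "j \<le> y" "y < hi" by auto
    then have "v (f j) \<le> v (f y)"
      using assms(1,3) by (cases "j = y") (auto simp: sorted_on_def merging_def)
    then show ?thesis using assms(5) y by force
  qed
  moreover have "mset (map (g(k := f i)) [lo..<Suc k]) = mset (map f [lo..<Suc i]) + mset (map f [mid..<j])"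
    using assms(1) b by (simp add: merging_def)
  moreover have "sorted_on v (g(k := f i)) lo (Suc k)"
    using assms(1,4) by (auto simp: merging_def sorted_on_def less_Suc_eq)
  ultimately show ?thesis
    using assms(1,4) unfolding merging_def by (auto simp: less_Suc_eq)
qed

lemma merging_right:
  assumes "merging v f lo mid hi i j g k" "sorted_on v f lo mid" "sorted_on v f mid hi"
    and "j < hi" "i < mid \<Longrightarrow> v (f j) \<le> v (f i)"
  shows "merging v f lo mid hi i (Suc j) (g(k := f j)) (Suc k)"
proof -
  have b: "lo \<le> k" "lo \<le> i" "mid \<le> j" using merging_bounds[OF assms(1)] assms(1) by (auto simp: merging_def)
  have "v (f j) \<le> v (f y)" if "i \<le> y \<and> y < mid \<or> j \<le> y \<and> y < hi" for y
  proof (cases "j \<le> y \<and> y < hi")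
    case True
    then show ?thesis using assms(3) b by (cases "j = y") (auto simp: sorted_on_def)
  next
    case False
    with that have y: "i \<le> y" "y < mid" by auto
    then have "v (f i) \<le> v (f y)"
      using assms(1,2) by (cases "i = y") (auto simp: sorted_on_def merging_def)
    then show ?thesis using assms(5) y by force
  qed
  moreover have "mset (map (g(k := f j)) [lo..<Suc k]) = mset (map f [lo..<i]) + mset (map f [mid..<Suc j])"
    using assms(1) b by (simp add: merging_def)
  moreover have "sorted_on v (g(k := f j)) lo (Suc k)"
    using assms(1,4) by (auto simp: merging_def sorted_on_def less_Suc_eq)
  ultimately show ?thesis
    using assms(1,4) unfolding merging_def by (auto simp: less_Suc_eq)
qed

lemma merging_end:
  assumes "merging v f lo mid hi i j g hi" "lo \<le> mid" "mid \<le> hi"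
  shows "sorted_on v g lo hi" "mset (map g [lo..<hi]) = mset (map f [lo..<hi])"
proof -
  have "i = mid" "j = hi" using assms(1) by (auto simp: merging_def)
  then have "mset (map g [lo..<hi]) = mset (map f [lo..<mid]) + mset (map f [mid..<hi])"
    using assms(1) by (simp add: merging_def)
  also have "[lo..<hi] = [lo..<mid] @ [mid..<hi]"
    using upt_add_eq_append[of lo mid "hi - mid"] assms(2,3) by simp
  then have "mset (map f [lo..<mid]) + mset (map f [mid..<hi]) = mset (map f [lo..<hi])" by simp
  finally show "mset (map g [lo..<hi]) = mset (map f [lo..<hi])" .
  show "sorted_on v g lo hi" using assms(1) by (simp add: merging_def)
qed

lemma cnt_mset: "cnt P f N = size (filter_mset P (mset (map f [0..<N])))"
proof -
  have "cnt P f N = length (filter (\<lambda>k. P (f k)) [0..<N])"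
    unfolding cnt_def by (subst length_filter_conv_card) (simp cong: conj_cong)
  then show ?thesis by (simp only: mset_filter[symmetric] size_mset filter_map length_map o_def)
qed

definition down :: "(nat \<Rightarrow> real) \<Rightarrow> (nat \<Rightarrow> bool) \<Rightarrow> bool" where
  "down v P \<longleftrightarrow> (\<forall>x y. v x \<le> v y \<and> P y \<longrightarrow> P x)"

text \<open>
  The state of the sampling after \<open>log\<^sub>2 F\<close> rounds of merging and thinning: every remaining
  item represents \<open>F\<close> original ones, and ranks are accurate up to \<open>E\<close>.
\<close>

definition sampled :: "(nat \<Rightarrow> real) \<Rightarrow> (nat \<Rightarrow> nat) \<Rightarrow> nat \<Rightarrow> nat \<Rightarrow> nat \<Rightarrow> (nat \<Rightarrow> nat) \<Rightarrow> nat \<Rightarrow> nat \<Rightarrow> bool" where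
  "sampled v f s F E g N w \<longleftrightarrow>
     (\<forall>P. down v P \<longrightarrow> cnt P f s \<le> F * cnt P g N \<and> F * cnt P g N \<le> cnt P f s + E) \<and>
     s \<le> F * N \<and> F * N < s + F \<and> (w = F * F \<or> N \<le> w) \<and> 1 \<le> F \<and>
     real E \<le> real s / 6 * (1 - 1 / (real F * real F)) + 2 * (real F - 1) \<and>
     (F = 1 \<or> F * F * F < 8 * s + 4 * (F * F)) \<and> (\<forall>k<N. \<exists>l<s. g k = f l)"

lemma sampled_init: "sampled v f s 1 0 f s 1"
  by (auto simp: sampled_def)

lemma sampled_step:
  assumes "sampled v f s F E g N w" "w < N" "w' = min (4 * w) N" "blocks v (2 * w') g' N"
    and "mset (map g' [0..<N]) = mset (map g [0..<N])"
  shows "sampled v f s (2 * F) (E + F * cdiv N (2 * w')) (\<lambda>k. g' (2 * k)) ((N + 1) div 2) w'"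
proof -
  define N' where "N' = (N + 1) div 2"
  define q where "q = cdiv N (2 * w')"
  have w: "w = F * F" and F: "1 \<le> F" and FN: "s \<le> F * N" "F * N < s + F"
    using assms by (auto simp: sampled_def)
  have w': "0 < w'" using assms(2,3) F w by auto
  have "cnt P f s \<le> 2 * F * cnt P (\<lambda>k. g' (2 * k)) N' \<and>
    2 * F * cnt P (\<lambda>k. g' (2 * k)) N' \<le> cnt P f s + (E + F * q)" if P: "down v P" for P
  proof -
    have c: "cnt P g' N = cnt P g N" unfolding cnt_mset assms(5) ..
    have cl: "P (g' i)" if "i < j" "j < N" "i div (2 * w') = j div (2 * w')" "P (g' j)" for i j
    proof -
      have "v (g' i) \<le> v (g' j)" using assms(4) that(1-3) unfolding blocks_def by blast
      then show ?thesis using P that(4) unfolding down_def by blast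
    qed
    have "cnt P g N \<le> 2 * cnt P (\<lambda>k. g' (2 * k)) N'" "2 * cnt P (\<lambda>k. g' (2 * k)) N' \<le> cnt P g N + q"
      using cnt_thin[of N w' P g', OF cl w'] by (simp_all add: N'_def q_def c)
    then have "F * cnt P g N \<le> F * (2 * cnt P (\<lambda>k. g' (2 * k)) N')"
      "F * (2 * cnt P (\<lambda>k. g' (2 * k)) N') \<le> F * (cnt P g N + q)" by (simp_all only: mult_le_mono2)
    moreover have "cnt P f s \<le> F * cnt P g N" "F * cnt P g N \<le> cnt P f s + E"
      using assms(1) P by (auto simp: sampled_def)
    moreover have "2 * F * cnt P (\<lambda>k. g' (2 * k)) N' = F * (2 * cnt P (\<lambda>k. g' (2 * k)) N')"
      "F * (cnt P g N + q) = F * cnt P g N + F * q" by (simp_all only: mult.assoc mult.left_commute distrib_left)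
    ultimately show ?thesis by linarith
  qed
  moreover have "s \<le> 2 * F * N'" "2 * F * N' < s + 2 * F"
  proof -
    have "N \<le> 2 * N'" "2 * N' \<le> N + 1" unfolding N'_def by linarith+
    then have "F * N \<le> F * (2 * N')" "F * (2 * N') \<le> F * (N + 1)" by (simp_all only: mult_le_mono2)
    moreover have "F * (2 * N') = 2 * F * N'" "F * (N + 1) = F * N + F" by simp_all
    ultimately show "s \<le> 2 * F * N'" "2 * F * N' < s + 2 * F" using FN F by linarith+
  qed
  moreover have "w' = 2 * F * (2 * F) \<or> N' \<le> w'"
    unfolding assms(3) w N'_def using assms(2) by (auto simp: min_def)
  moreover have "real (E + F * q) \<le> real s / 6 * (1 - 1 / (real (2 * F) * real (2 * F))) + 2 * (real (2 * F) - 1)"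
  proof -
    have "q \<le> N div (8 * w) + 1"
    proof -
      have "N \<le> (N div (8 * w) + 1) * (2 * w')"
      proof (cases "4 * w \<le> N")
        case True
        then have "2 * w' = 8 * w" by (simp add: assms(3))
        moreover have "N < (N div (8 * w) + 1) * (8 * w)"
          using dividend_less_div_times[of "8 * w" N] w F by simp
        ultimately show ?thesis by simp
      next
        case False
        then show ?thesis by (simp add: assms(3))
      qed
      then show ?thesis unfolding q_def using w' by (simp add: cdiv_le_iff)
    qed
    then have "real q \<le> real (N div (8 * w)) + 1" by linarith
    also have "real (N div (8 * w)) \<le> real N / real (8 * w)" by (rule of_nat_div_le_of_nat)
    finally have "real F * real q \<le> real F * (real N / real (8 * w) + 1)" by (simp add: mult_left_mono)
    also have "\<dots> = (real F * real N) / (8 * (real F * real F)) + real F"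
      using F by (simp add: w field_simps)
    also have "\<dots> \<le> (real s + real F) / (8 * (real F * real F)) + real F"
    proof -
      have "real (F * N) \<le> real (s + F)" using FN by linarith
      then show ?thesis by (intro add_right_mono divide_right_mono) auto
    qed
    also have "\<dots> = real s / 6 * (3 / 4 / (real F * real F)) + 1 / (8 * real F) + real F"
      using F by (simp add: field_simps)
    also have "1 / (8 * real F) \<le> 1" using F by simp
    finally have f1: "real F * real q \<le> real s / 6 * (3 / 4 / (real F * real F)) + 1 + real F" by simp
    have f2: "real E \<le> real s / 6 * (1 - 1 / (real F * real F)) + 2 * (real F - 1)"
      using assms(1) by (simp add: sampled_def)
    have f3: "real s / 6 * (1 - 1 / (real (2 * F) * real (2 * F))) =
      real s / 6 * (1 - 1 / (real F * real F)) + real s / 6 * (3 / 4 / (real F * real F))"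
      using F by (simp add: field_simps)
    have f4: "real (E + F * q) = real E + real F * real q"
      "2 * (real (2 * F) - 1) = 4 * real F - 2" "1 \<le> real F" using F by simp_all
    have arith: "y \<le> u' + g'" if "x' \<le> a + 1 + z" "e \<le> c + 2 * (z - 1)" "u' = c + a"
        "y = e + x'" "g' = 4 * z - 2" "1 \<le> z"
      for x' a z e c u' y g' :: real
      using that(1,2,6) unfolding that(3-5) by argo
    show ?thesis by (rule arith[OF f1 f2 f3 f4])
  qed
  moreover have "2 * F * (2 * F) * (2 * F) < 8 * s + 4 * (2 * F * (2 * F))"
  proof -
    have "F * (F * F) \<le> F * N" by (rule mult_le_mono2) (use assms(2) w in simp)
    then have "F * (F * F) < s + F" using FN by linarith
    moreover have "F \<le> F * F" using F by simp
    moreover have "2 * F * (2 * F) * (2 * F) = 8 * (F * (F * F))"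
      "4 * (2 * F * (2 * F)) = 16 * (F * F)" by simp_all
    ultimately show ?thesis by linarith
  qed
  moreover have "\<exists>l<s. g' (2 * k) = f l" if "k < N'" for k
  proof -
    have "2 * k < N" using that unfolding N'_def by linarith
    then have "g' (2 * k) \<in># mset (map g' [0..<N])" by auto
    then have "g' (2 * k) \<in># mset (map g [0..<N])" by (simp only: assms(5))
    then obtain j where "j < N" "g' (2 * k) = g j" by auto
    then show ?thesis using assms(1) by (auto simp: sampled_def)
  qed
  ultimately show ?thesis using F unfolding sampled_def N'_def[symmetric] q_def[symmetric] by auto
qed

lemma cnt_less: "k < N \<Longrightarrow> \<not> P (f k) \<Longrightarrow> cnt P f N < N"
  unfolding cnt_def using psubset_card_mono[of "{..<N}" "{k. k < N \<and> P (f k)}"] by auto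

lemma cnt_compl: "cnt P f N + cnt (\<lambda>x. \<not> P x) f N = N"
proof -
  have "(\<Sum>k<N. of_bool (P (f k)) + of_bool (\<not> P (f k))) = (\<Sum>k<N. 1 :: nat)"
    by (rule sum.cong) auto
  then show ?thesis unfolding cnt_eq_sum sum.distrib by simp
qed

lemma sampled_pivot:
  assumes "sampled v f s F E g N w" "sorted_on v g 0 N" "1 \<le> s"
  defines "p \<equiv> g (N div 2)"
  shows "80 * cnt (\<lambda>x. v x < v p) f s \<le> 79 * s" "80 * cnt (\<lambda>x. v p < v x) f s \<le> 79 * s"
    "\<exists>l<s. p = f l"
proof -
  have FN: "s \<le> F * N" "F * N < s + F" and F: "1 \<le> F"
    and E: "real E \<le> real s / 6 * (1 - 1 / (real F * real F)) + 2 * (real F - 1)"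
    and F3: "F = 1 \<or> F * F * F < 8 * s + 4 * (F * F)"
    using assms(1) by (auto simp: sampled_def)
  have N: "1 \<le> N" using FN assms(3) by (cases N) auto
  then have h: "N div 2 < N" by simp
  then show p: "\<exists>l<s. p = f l" using assms(1) by (auto simp: sampled_def p_def)
  let ?L = "\<lambda>x. v x < v p" and ?G = "\<lambda>x. v p < v x" and ?LE = "\<lambda>x. v x \<le> v p"
  have "80 * cnt ?L f s \<le> 79 * s \<and> 80 * cnt ?G f s \<le> 79 * s"
  proof (cases "s \<le> 80")
    case True
    from p obtain l where l: "l < s" "p = f l" by blast
    then have "cnt ?L f s < s" "cnt ?G f s < s" by (auto intro: cnt_less)
    moreover have "80 * a \<le> 79 * s" if "a < s" for a
    proof -
      have "80 * (a + 1) \<le> 80 * s" using that by simp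
      then show ?thesis using True by simp
    qed
    ultimately show ?thesis by blast
  next
    case False
    have mono: "v (g x) \<le> v (g y)" if "x \<le> y" "y < N" for x y
    proof (cases "x = y")
      case False
      then have "0 \<le> x \<and> x < y \<and> y < N" using that by simp
      then show ?thesis using assms(2) unfolding sorted_on_def by blast
    qed simp
    have "k < N div 2" if "k < N" "v (g k) < v p" for k
      using mono[of "N div 2" k] that by (cases "N div 2 \<le> k") (auto simp: p_def)
    then have "{k. k < N \<and> v (g k) < v p} \<subseteq> {..<N div 2}" by blast
    then have c1: "cnt ?L g N \<le> N div 2"
      unfolding cnt_def using card_mono[of "{..<N div 2}"] by fastforce
    have "k < N \<and> v (g k) \<le> v p" if "k \<le> N div 2" for k
      using mono[OF that h] that h unfolding p_def by linarith
    then have "{..N div 2} \<subseteq> {k. k < N \<and> v (g k) \<le> v p}" by blast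
    then have c2: "N div 2 + 1 \<le> cnt ?LE g N"
      unfolding cnt_def using card_mono[of "{k. k < N \<and> v (g k) \<le> v p}" "{..N div 2}"] by auto
    have "down v ?L" "down v ?LE" by (auto simp: down_def)
    then have r: "cnt ?L f s \<le> F * cnt ?L g N" "F * cnt ?LE g N \<le> cnt ?LE f s + E"
      using assms(1) by (auto simp: sampled_def)
    have "2 * cnt ?L f s \<le> F * N"
    proof -
      have "2 * cnt ?L g N \<le> N" using c1 by linarith
      then have "F * (2 * cnt ?L g N) \<le> F * N" by (rule mult_le_mono2)
      then have "2 * (F * cnt ?L g N) \<le> F * N" by (simp only: mult.left_commute)
      then show ?thesis using r(1) by linarith
    qed
    then have L: "2 * cnt ?L f s \<le> s + F" using FN by linarith
    have "F * N \<le> 2 * (cnt ?LE f s + E)"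
    proof -
      have "N \<le> 2 * cnt ?LE g N" using c2 by linarith
      then have "F * N \<le> F * (2 * cnt ?LE g N)" by (rule mult_le_mono2)
      then have "F * N \<le> 2 * (F * cnt ?LE g N)" by (simp only: mult.left_commute)
      then show ?thesis by (rule order.trans[OF _ mult_le_mono2[OF r(2)]])
    qed
    then have "s \<le> 2 * (cnt ?LE f s + E)" by (rule order.trans[OF FN(1)])
    moreover have "cnt ?LE f s + cnt ?G f s = s"
      using cnt_compl[of ?LE f s] by (simp add: not_le)
    moreover have "2 * real c \<le> real s + 2 * real E" if "s \<le> 2 * (a + E)" "a + c = s" for a c
    proof -
      have "2 * c \<le> s + 2 * E" using that by simp
      then show ?thesis by linarith
    qed
    ultimately have G: "2 * real (cnt ?G f s) \<le> real s + 2 * real E" by blast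
    have "real s / 6 * (1 - 1 / (real F * real F)) \<le> real s / 6 * 1"
      by (intro mult_left_mono) auto
    from order.trans[OF E add_right_mono[OF this]]
    have E': "real E \<le> real s / 6 + 2 * real F - 2" by simp
    have s: "F \<le> 12 \<or> 12 * F \<le> s"
    proof (rule disjCI)
      assume "\<not> 12 * F \<le> s"
      show "F \<le> 12"
      proof (rule ccontr)
        assume F12: "\<not> F \<le> 12"
        then have "12 * (F * F) \<le> F * (F * F)" by (intro mult_le_mono1) simp
        moreover have "F * (F * F) < 8 * s + 4 * (F * F)" using F3 F12 by (auto simp: mult.assoc)
        moreover have "y < s" if "12 * y \<le> x" "x < 8 * s + 4 * y" for x y using that by linarith
        ultimately have "F * F < s" by blast
        moreover have "12 * F \<le> F * F" using F12 by (intro mult_le_mono1) simp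
        ultimately show False using \<open>\<not> 12 * F \<le> s\<close> by linarith
      qed
    qed
    have "80 * a \<le> 79 * s" if "2 * a \<le> s + F" for a
      using that s False by linarith
    with L have "80 * cnt ?L f s \<le> 79 * s" by blast
    moreover have "80 * a \<le> 79 * s" if a: "2 * real a \<le> real s + 2 * real E" for a
    proof -
      have "real F \<le> 12 \<or> 12 * real F \<le> real s" using s by linarith
      moreover have "81 \<le> real s" using False by linarith
      ultimately have "80 * real a \<le> 79 * real s" using a E' by linarith
      then show ?thesis by linarith
    qed
    with G have "80 * cnt ?G f s \<le> 79 * s" by blast
    ultimately show ?thesis by blast
  qed
  then show "80 * cnt ?L f s \<le> 79 * s" "80 * cnt ?G f s \<le> 79 * s" by auto
qed

definition take_left :: "nat \<Rightarrow> nat \<Rightarrow> com" where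
  "take_left src dst = Ins (Load 41 src 38) ;; Ins (Store dst 40 41) ;; Ins (Op Add 38 38 3)"

definition take_right :: "nat \<Rightarrow> nat \<Rightarrow> com" where
  "take_right src dst = Ins (Load 41 src 39) ;; Ins (Store dst 40 41) ;; Ins (Op Add 39 39 3)"

definition merge_step :: "nat \<Rightarrow> nat \<Rightarrow> com" where
  "merge_step src dst =
     Cond (Lt 38 36)
       (Cond (Lt 39 37)
         (Ins (Load 41 src 38) ;; Ins (Load 42 src 39) ;; Ins (Load 43 4 41) ;; Ins (Load 44 5 41) ;;
          Ins (Load 45 4 42) ;; Ins (Load 46 5 42) ;;
          Cond (WLe 43 44 45 46) (take_left src dst) (take_right src dst))
         (take_left src dst))
       (take_right src dst) ;;
     Ins (Op Add 40 40 3)"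

definition bounds_code :: com where
  "bounds_code =
     Ins (Op Sub 41 33 35) ;; Cond (Lt 34 41) (Ins (Op Add 36 35 34)) (Ins (Move 36 33)) ;;
     Ins (Op Sub 41 33 36) ;; Cond (Lt 34 41) (Ins (Op Add 37 36 34)) (Ins (Move 37 33)) ;;
     Ins (Move 38 35) ;; Ins (Move 39 36) ;; Ins (Move 40 35)"

definition merge_pass :: "nat \<Rightarrow> nat \<Rightarrow> com" where
  "merge_pass src dst =
     Ins (Move 35 2) ;;
     While 35 33
       (bounds_code ;; While 40 37 (merge_step src dst) ;; Ins (Move 35 37))"

definition double_width :: com where
  "double_width =
     Ins (Op Sub 41 33 34) ;; Cond (Lt 34 41) (Ins (Op Add 34 34 34)) (Ins (Move 34 33))"

definition copy_code :: com where
  "copy_code =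
     Ins (Move 33 6) ;; Ins (Move 35 2) ;;
     While 35 33 (Ins (Load 41 9 35) ;; Ins (Store 12 35 41) ;; Ins (Op Add 35 35 3))"

definition thin_code :: com where
  "thin_code =
     Ins (Op Div 36 33 4) ;; Ins (Op Sub 37 33 36) ;; Ins (Move 35 2) ;;
     While 35 37
       (Ins (Op Add 38 35 35) ;; Ins (Load 41 13 38) ;; Ins (Store 12 35 41) ;; Ins (Op Add 35 35 3)) ;;
     Ins (Move 33 37)"

definition pivot_code :: com where
  "pivot_code =
     copy_code ;;
     Ins (Move 34 3) ;;
     While 34 33
       (merge_pass 12 13 ;; double_width ;; merge_pass 13 12 ;; double_width ;; merge_pass 12 13 ;;
        thin_code) ;;
     Ins (Op Div 36 33 4) ;; Ins (Load 8 12 36)"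

context ram
begin

abbreviation "v \<equiv> val ws"

lemma merge_loop_wp:
  assumes "env R" "weights_in M" "src \<notin> {4, 5}" "dst \<notin> {4, 5, 6}" "src \<noteq> dst"
    and m: "merging v (M src) lo (R 36) (R 37) (R 38) (R 39) (M dst) (R 40)" and "R 37 \<le> n"
    and s: "sorted_on v (M src) lo (R 36)" "sorted_on v (M src) (R 36) (R 37)"
    and ids: "\<And>x. x < R 37 \<Longrightarrow> M src x < n"
    and Q: "\<And>R' M' t' i j. agree_off {38, 39, 40, 41, 42, 43, 44, 45, 46} R' R \<Longrightarrow>
      (\<forall>m. m \<noteq> dst \<longrightarrow> M' m = M m) \<Longrightarrow> (\<forall>x<lo. M' dst x = M dst x) \<Longrightarrow>
      merging v (M src) lo (R 36) (R 37) i j (M' dst) (R 37) \<Longrightarrow>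
      t' + 20 * R 40 \<le> t + 2 + 20 * R 37 \<Longrightarrow> Q R' M' t'"
  shows "wp b ws (While 40 37 (merge_step src dst)) Q R M t"
proof -
  let ?f = "M src" and ?mid = "R 36" and ?hi = "R 37"
  let ?I = "\<lambda>R' M' t'. agree_off {38, 39, 40, 41, 42, 43, 44, 45, 46} R' R \<and>
    (\<forall>m. m \<noteq> dst \<longrightarrow> M' m = M m) \<and> (\<forall>x<lo. M' dst x = M dst x) \<and>
    merging v ?f lo ?mid ?hi (R' 38) (R' 39) (M' dst) (R' 40) \<and> t' + 20 * R 40 \<le> t + 20 * R' 40"
  show ?thesis
  proof (rule wp_While[where I = ?I and T = "t + 20 * ?hi"])
    show "?I R M t" using m by simp
  next
    fix R' M' t' assume "?I R' M' t'"
    then show "t' \<le> t + 20 * ?hi" using merging_bounds[of v ?f lo ?mid ?hi] by fastforce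
  next
    fix R' M' t' assume I: "?I R' M' t'" and lt: "R' 40 < R' 37"
    define i j k g where ijkg: "i = R' 38" "j = R' 39" "k = R' 40" "g = M' dst"
    have R: "R' 36 = ?mid" "R' 37 = ?hi" "R' 3 = 1" using I assms(1) by (auto simp: env_def)
    have mg: "merging v ?f lo ?mid ?hi i j g k" using I by (simp add: ijkg)
    then have b: "i \<le> ?mid" "?mid \<le> j" "j \<le> ?hi" "k < ?hi" "lo \<le> k" "k + ?mid = i + j"
      using lt R merging_bounds[OF mg] by (auto simp: merging_def ijkg)
    have M: "M' src = ?f" "M' 4 = M 4" "M' 5 = M 5" using I assms(3-5) by auto
    have W: "M 4 x < n" "ws ! M 4 x + real (M 5 x) = v x" if "x < n" for x
      using assms(2) that by (auto simp: weights_in_def)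
    have id: "i < ?mid \<Longrightarrow> ?f i < n" "j < ?hi \<Longrightarrow> ?f j < n" using ids b by auto
    have fin: "j < ?hi" if "\<not> i < ?mid" using that b by linarith
    have L: "merging v ?f lo ?mid ?hi (Suc i) j (g(k := ?f i)) (Suc k)"
      if "i < ?mid" "j < ?hi \<Longrightarrow> v (?f i) \<le> v (?f j)"
      using merging_left[OF mg s that] by simp
    have Rr: "merging v ?f lo ?mid ?hi i (Suc j) (g(k := ?f j)) (Suc k)"
      if "j < ?hi" "i < ?mid \<Longrightarrow> v (?f j) \<le> v (?f i)"
      using merging_right[OF mg s that] by simp
    have fr: "agree_off {38, 39, 40, 41, 42, 43, 44, 45, 46} R' R"
      "\<forall>m. m \<noteq> dst \<longrightarrow> M' m = M m" "\<forall>x<lo. g x = M dst x" "t' + 20 * R 40 \<le> t + 20 * k"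
      using I by (auto simp: ijkg)
    have words: "Suc i \<le> n" if "i < ?mid" using that b assms(7) by linarith
    have words': "Suc j \<le> n" if "j < ?hi" using that assms(7) by linarith
    have wordk: "Suc k \<le> n" using b assms(7) by linarith
    consider "i < ?mid" "j < ?hi" "v (?f i) \<le> v (?f j)" | "i < ?mid" "j < ?hi" "\<not> v (?f i) \<le> v (?f j)"
      | "i < ?mid" "\<not> j < ?hi" | "\<not> i < ?mid" by blast
    then show "wp b ws (merge_step src dst) ?I R' M' (t' + 2)"
    proof cases
      case 1
      then show ?thesis unfolding merge_step_def take_left_def take_right_def
        using fr L words wordk b assms(3-5)
        by (simp add: wp_Cond R M W id ijkg[symmetric] word_ops)
    next
      case 2
      then show ?thesis unfolding merge_step_def take_left_def take_right_def
        using fr Rr words' wordk b assms(3-5)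
        by (simp add: wp_Cond R M W id ijkg[symmetric] word_ops)
    next
      case 3
      then show ?thesis unfolding merge_step_def take_left_def take_right_def
        using fr L words wordk b assms(3-5)
        by (simp add: wp_Cond R M W id ijkg[symmetric] word_ops)
    next
      case 4
      then show ?thesis unfolding merge_step_def take_left_def take_right_def
        using fr Rr words' wordk b assms(3-5) fin
        by (simp add: wp_Cond R M W id ijkg[symmetric] word_ops)
    qed
  next
    fix R' M' t' assume I: "?I R' M' t'" and "\<not> R' 40 < R' 37"
    then have "R' 40 = ?hi" using merging_bounds[of v ?f lo ?mid ?hi "R' 38" "R' 39" "M' dst" "R' 40"] by auto
    then show "Q R' M' (t' + 2)" using I by (intro Q[of _ _ "R' 38" "R' 39"]) auto
  qed
qed

lemma bounds_wp:
  assumes "env R" "R 35 < R 33" "R 34 \<le> n" "R 33 \<le> n"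
    and Q: "\<And>R' t'. agree_off {36, 37, 38, 39, 40, 41} R' R \<Longrightarrow>
      R' 36 = min (R 35 + R 34) (R 33) \<Longrightarrow> R' 37 = min (R' 36 + R 34) (R 33) \<Longrightarrow>
      R' 38 = R 35 \<Longrightarrow> R' 39 = R' 36 \<Longrightarrow> R' 40 = R 35 \<Longrightarrow> t' \<le> t + 12 \<Longrightarrow> Q R' M t'"
  shows "wp b ws bounds_code Q R M t"
proof -
  have le: "R 35 \<le> R 33" "R 33 - R 35 \<le> n" using assms by auto
  show ?thesis
  proof (cases "R 34 < R 33 - R 35")
    case True
    then have m: "R 35 + R 34 \<le> n" "R 35 + R 34 \<le> R 33" using assms by auto
    show ?thesis
    proof (cases "R 34 < R 33 - (R 35 + R 34)")
      case True2: True
      then have "R 35 + R 34 + R 34 \<le> n" using assms by auto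
      then show ?thesis unfolding bounds_code_def wp_Seq wp_instrs wp_Cond_Lt
        using True True2 m le assms(4) by (auto simp: word_ops intro!: Q split: if_splits)
    next
      case False
      then show ?thesis unfolding bounds_code_def wp_Seq wp_instrs wp_Cond_Lt
        using True m le assms(4) by (auto simp: word_ops intro!: Q split: if_splits)
    qed
  next
    case False
    then show ?thesis unfolding bounds_code_def wp_Seq wp_instrs wp_Cond_Lt
      using le assms(2,4) by (auto simp: word_ops intro!: Q split: if_splits)
  qed
qed

lemma merge_pass_wp:
  assumes "env R" "weights_in M" "src \<notin> {4, 5}" "dst \<notin> {4, 5, 6}" "src \<noteq> dst"
    and w: "0 < R 34" "R 34 \<le> n" and N: "R 33 \<le> n"
    and bl: "blocks v (R 34) (M src) (R 33)" and ids: "\<And>x. x < R 33 \<Longrightarrow> M src x < n"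
    and Q: "\<And>R' M' t'. (\<forall>r<35. R' r = R r) \<Longrightarrow> (\<forall>m. m \<noteq> dst \<longrightarrow> M' m = M m) \<Longrightarrow>
      blocks v (2 * R 34) (M' dst) (R 33) \<Longrightarrow>
      mset (map (M' dst) [0..<R 33]) = mset (map (M src) [0..<R 33]) \<Longrightarrow>
      t' \<le> t + 3 + 50 * R 33 \<Longrightarrow> Q R' M' t'"
  shows "wp b ws (merge_pass src dst) Q R M t"
proof -
  let ?f = "M src" and ?w = "R 34" and ?N = "R 33"
  let ?I = "\<lambda>R' M' t'. (\<forall>r<35. R' r = R r) \<and> (\<forall>m. m \<noteq> dst \<longrightarrow> M' m = M m) \<and> R' 35 \<le> ?N \<and>
    (R' 35 = ?N \<or> (\<exists>q. R' 35 = q * (2 * ?w))) \<and> blocks v (2 * ?w) (M' dst) (R' 35) \<and>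
    mset (map (M' dst) [0..<R' 35]) = mset (map ?f [0..<R' 35]) \<and> t' \<le> t + 1 + 50 * R' 35"
  let ?body = "bounds_code ;; While 40 37 (merge_step src dst) ;; Ins (Move 35 37)"
  have "wp b ws (While 35 33 ?body) Q (R(35 := 0)) M (t + 1)"
  proof (rule wp_While[where I = ?I and T = "t + 1 + 50 * ?N"])
    show "?I (R(35 := 0)) M (t + 1)" by (auto simp: blocks_def)
  next
    fix R' M' t' assume I: "?I R' M' t'" and lt0: "R' 35 < R' 33"
    define lo where "lo = R' 35"
    have lt: "lo < ?N" using I lt0 by (simp add: lo_def)
    then obtain q where q: "lo = q * (2 * ?w)" using I by (auto simp: lo_def)
    define mid where "mid = min (lo + ?w) ?N"
    define hi where "hi = min (mid + ?w) ?N"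
    have RR: "R' 33 = ?N" "R' 34 = ?w" "env R'" "R' 35 = lo" using I assms(1) by (auto simp: env_def lo_def)
    have b: "lo \<le> mid" "mid \<le> hi" "hi \<le> ?N" "lo < hi" "hi \<le> lo + 2 * ?w"
      using lt w by (auto simp: mid_def hi_def)
    have lo1: "(2 * q) * ?w = lo" by (simp add: q)
    have s1: "sorted_on v ?f lo mid"
      by (rule blocks_sorted_on[OF bl, of _ "2 * q"]) (use b w lo1 in \<open>auto simp: mid_def\<close>)
    have s2: "sorted_on v ?f mid hi"
    proof (cases "lo + ?w \<le> ?N")
      case True
      then have "mid = lo + ?w" by (simp add: mid_def)
      moreover have "(2 * q + 1) * ?w = lo + ?w" using lo1 by (simp add: distrib_right)
      ultimately show ?thesis
        by (intro blocks_sorted_on[OF bl, of _ "2 * q + 1"]) (use b w in \<open>auto simp: hi_def\<close>)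
    next
      case False
      then have "mid = hi" using b by (simp add: mid_def hi_def)
      then show ?thesis by (simp add: sorted_on_def)
    qed
    have M: "M' src = ?f" "weights_in M'" using I assms(2,3,4,5) by (auto simp: weights_in_def)
    have go: "wp b ws (While 40 37 (merge_step src dst) ;; Ins (Move 35 37)) ?I R2 M' t2"
      if R2: "agree_off {36, 37, 38, 39, 40, 41} R2 R'" "R2 36 = mid" "R2 37 = hi" "R2 38 = lo"
        "R2 39 = mid" "R2 40 = lo" and t2: "t2 \<le> t' + 20" for R2 t2
      unfolding wp_Seq
    proof (rule merge_loop_wp[where lo = lo])
      show "env R2" using R2(1) RR by (simp add: env_def)
      show "merging v (M' src) lo (R2 36) (R2 37) (R2 38) (R2 39) (M' dst) (R2 40)"
        using b by (simp add: R2 merging_init)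
      show "sorted_on v (M' src) lo (R2 36)" "sorted_on v (M' src) (R2 36) (R2 37)"
        using s1 s2 by (simp_all add: M R2)
      show "R2 37 \<le> n" using b N by (simp add: R2)
      show "M' src x < n" if "x < R2 37" for x using that b ids by (simp add: M R2)
    next
      fix R3 M3 t3 i j
      assume A: "agree_off {38, 39, 40, 41, 42, 43, 44, 45, 46} R3 R2"
        "\<forall>m. m \<noteq> dst \<longrightarrow> M3 m = M' m" "\<forall>x<lo. M3 dst x = M' dst x"
        "merging v (M' src) lo (R2 36) (R2 37) i j (M3 dst) (R2 37)"
        "t3 + 20 * R2 40 \<le> t2 + 2 + 20 * R2 37"
      have me: "sorted_on v (M3 dst) lo hi" "mset (map (M3 dst) [lo..<hi]) = mset (map ?f [lo..<hi])"
        using merging_end[of v ?f lo mid hi] A(4) b by (simp_all add: M R2)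
      have "blocks v (2 * ?w) (M3 dst) lo" using I A(3) unfolding blocks_def lo_def by simp
      then have bl3: "blocks v (2 * ?w) (M3 dst) hi"
        using blocks_extend[of v "2 * ?w" "M3 dst" q hi] me(1) b w q by simp
      have up: "[0..<hi] = [0..<lo] @ [lo..<hi]" using upt_add_eq_append[of 0 lo "hi - lo"] b by simp
      have "map (M3 dst) [0..<lo] = map (M' dst) [0..<lo]" using A(3) by simp
      moreover have "mset (map (M' dst) [0..<lo]) = mset (map ?f [0..<lo])" using I unfolding lo_def by blast
      ultimately have "mset (map (M3 dst) [0..<lo]) = mset (map ?f [0..<lo])" by (simp only:)
      then have ms: "mset (map (M3 dst) [0..<hi]) = mset (map ?f [0..<hi])"
        unfolding up map_append mset_append using me(2) by simp
      have hq: "hi = ?N \<or> (\<exists>q. hi = q * (2 * ?w))"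
      proof (cases "hi = ?N")
        case False
        then have "hi = (q + 1) * (2 * ?w)" using q by (auto simp: hi_def mid_def min_def split: if_splits)
        then show ?thesis by blast
      qed simp
      have "t3 + 1 \<le> t + 1 + 50 * hi"
      proof -
        have "t3 + 20 * lo \<le> t' + 22 + 20 * hi" using A(5) t2 by (simp add: R2)
        moreover have "t' \<le> t + 1 + 50 * lo" using I by (simp add: lo_def)
        ultimately show ?thesis using b by linarith
      qed
      then show "wp b ws (Ins (Move 35 37)) ?I R3 M3 t3"
        using A(1,2) R2 I bl3 ms hq b by simp
    qed (use M assms in auto)
    show "wp b ws ?body ?I R' M' (t' + 2)"
      unfolding wp_Seq[of b ws bounds_code]
    proof (rule bounds_wp)
      fix R2 t2
      assume "agree_off {36, 37, 38, 39, 40, 41} R2 R'" "R2 36 = min (R' 35 + R' 34) (R' 33)"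
        "R2 37 = min (R2 36 + R' 34) (R' 33)" "R2 38 = R' 35" "R2 39 = R2 36" "R2 40 = R' 35" "t2 \<le> t' + 2 + 12"
      then show "wp b ws (While 40 37 (merge_step src dst) ;; Ins (Move 35 37)) ?I R2 M' t2"
        by (intro go) (auto simp: RR mid_def hi_def)
    qed (use RR lt w N in auto)
  next
    fix R' M' t' assume I: "?I R' M' t'" and "\<not> R' 35 < R' 33"
    then have "R' 35 = ?N" by auto
    with I show "Q R' M' (t' + 2)" by (intro Q) auto
  qed auto
  then show ?thesis using assms(1) by (simp add: merge_pass_def env_def)
qed

lemma double_width_wp:
  assumes "env R" "R 34 \<le> R 33" "R 33 \<le> n"
    and Q: "\<And>R' t'. agree_off {34, 41} R' R \<Longrightarrow> R' 34 = min (2 * R 34) (R 33) \<Longrightarrow>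
      t' \<le> t + 6 \<Longrightarrow> Q R' M t'"
  shows "wp b ws double_width Q R M t"
proof (cases "R 34 < R 33 - R 34")
  case True
  then have "R 34 + R 34 \<le> n" using assms by linarith
  with True show ?thesis unfolding double_width_def wp_Seq wp_instrs wp_Cond_Lt
    using assms(2,3) by (auto simp: word_ops intro!: Q split: if_splits)
next
  case False
  then show ?thesis unfolding double_width_def wp_Seq wp_instrs wp_Cond_Lt
    using assms(2,3) by (auto simp: word_ops intro!: Q split: if_splits)
qed

lemma copy_wp:
  assumes "env R" "R 6 \<le> n"
    and Q: "\<And>R' M' t'. agree_off {33, 35, 41} R' R \<Longrightarrow> R' 33 = R 6 \<Longrightarrow>
      (\<forall>k<R 6. M' 12 k = M 9 k) \<Longrightarrow> (\<forall>m. m \<noteq> 12 \<longrightarrow> M' m = M m) \<Longrightarrow> t' \<le> t + 4 + 6 * R 6 \<Longrightarrow> Q R' M' t'"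
  shows "wp b ws copy_code Q R M t"
proof -
  let ?I = "\<lambda>R' M' t'. agree_off {33, 35, 41} R' R \<and> R' 33 = R 6 \<and> R' 35 \<le> R 6 \<and>
      (\<forall>k<R' 35. M' 12 k = M 9 k) \<and> (\<forall>m. m \<noteq> 12 \<longrightarrow> M' m = M m) \<and> t' \<le> t + 2 + 6 * R' 35"
  let ?body = "Ins (Load 41 9 35) ;; Ins (Store 12 35 41) ;; Ins (Op Add 35 35 3)"
  have "wp b ws (While 35 33 ?body) Q (R(33 := R 6, 35 := 0)) M (t + 2)"
  proof (rule wp_While[where I = ?I and T = "t + 2 + 6 * R 6"])
    fix R' M' t' assume I: "?I R' M' t'" and lt: "R' 35 < R' 33"
    then have "R' 3 = 1" "R' 35 + 1 \<le> n" using assms by (auto simp: env_def)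
    then show "wp b ws ?body ?I R' M' (t' + 2)"
      using I lt by (auto simp: word_ops less_Suc_eq)
  next
    fix R' M' t' assume I: "?I R' M' t'" and "\<not> R' 35 < R' 33"
    then show "Q R' M' (t' + 2)" by (intro Q) auto
  qed auto
  then show ?thesis using assms(1) by (simp add: copy_code_def env_def)
qed

lemma thin_wp:
  assumes "env R" "R 33 \<le> n"
    and Q: "\<And>R' M' t'. agree_off {33, 35, 36, 37, 38, 41} R' R \<Longrightarrow> R' 33 = (R 33 + 1) div 2 \<Longrightarrow>
      (\<forall>k<(R 33 + 1) div 2. M' 12 k = M 13 (2 * k)) \<Longrightarrow> (\<forall>m. m \<noteq> 12 \<longrightarrow> M' m = M m) \<Longrightarrow>
      t' \<le> t + 10 + 7 * R 33 \<Longrightarrow> Q R' M' t'"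
  shows "wp b ws thin_code Q R M t"
proof -
  define H where "H = (R 33 + 1) div 2"
  have H: "R 33 - R 33 div 2 = H" "H \<le> R 33" unfolding H_def by linarith+
  let ?I = "\<lambda>R' M' t'. agree_off {33, 35, 36, 37, 38, 41} R' R \<and> R' 37 = H \<and> R' 35 \<le> H \<and>
      (\<forall>k<R' 35. M' 12 k = M 13 (2 * k)) \<and> (\<forall>m. m \<noteq> 12 \<longrightarrow> M' m = M m) \<and> t' \<le> t + 3 + 7 * R' 35"
  let ?body = "Ins (Op Add 38 35 35) ;; Ins (Load 41 13 38) ;; Ins (Store 12 35 41) ;; Ins (Op Add 35 35 3)"
  have "wp b ws (While 35 37 ?body) (wp b ws (Ins (Move 33 37)) Q) (R(36 := R 33 div 2, 37 := H, 35 := 0)) M (t + 3)"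
  proof (rule wp_While[where I = ?I and T = "t + 3 + 7 * H"])
    fix R' M' t' assume I: "?I R' M' t'" and lt: "R' 35 < R' 37"
    then have "R' 35 + R' 35 < R 33" unfolding H_def by linarith
    then have "R' 3 = 1" "R' 35 + 1 \<le> n" "R' 35 + R' 35 \<le> n"
      using I assms lt H(2) by (auto simp: env_def)
    then show "wp b ws ?body ?I R' M' (t' + 2)"
      using I lt by (auto simp: word_ops less_Suc_eq mult_2)
  next
    fix R' M' t' assume I: "?I R' M' t'" and "\<not> R' 35 < R' 37"
    then show "wp b ws (Ins (Move 33 37)) Q R' M' (t' + 2)"
      using H(2) unfolding wp_instrs by (intro Q) (auto simp: H_def)
  qed auto
  from wp_cong_state[OF this] show ?thesis using assms H(1)
    by (simp add: thin_code_def env_def word_ops)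
qed

lemma sampled_cong: "(\<And>k. k < N \<Longrightarrow> g k = g' k) \<Longrightarrow> sampled u f s F E g N w \<Longrightarrow> sampled u f s F E g' N w"
proof -
  assume e: "\<And>k. k < N \<Longrightarrow> g k = g' k"
  then have "cnt P g N = cnt P g' N" for P unfolding cnt_eq_sum by (intro sum.cong) auto
  then show "sampled u f s F E g N w \<Longrightarrow> sampled u f s F E g' N w"
    unfolding sampled_def using e by simp
qed

lemma blocks_cong: "(\<And>k. k < N \<Longrightarrow> g k = g' k) \<Longrightarrow> blocks u w g N \<Longrightarrow> blocks u w g' N"
  unfolding blocks_def by simp

lemma bounded_if_mset_eq:
  assumes "mset (map g' [0..<N]) = mset (map g [0..<N])" "\<And>x. x < N \<Longrightarrow> g x < n" "x < N"
  shows "g' x < n"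
proof -
  have "g' x \<in> set (map g' [0..<N])" using assms(3) by simp
  also have "set (map g' [0..<N]) = set (map g [0..<N])" using assms(1) by (metis set_mset_mset)
  finally show ?thesis using assms(2) by auto
qed

definition sampling :: "regfile \<Rightarrow> memory \<Rightarrow> regfile \<Rightarrow> memory \<Rightarrow> bool" where
  "sampling R M R' M' \<longleftrightarrow> (\<forall>r<33. R' r = R r) \<and> agree_off {12, 13} M' M \<and>
     (\<exists>F E. sampled v (M 9) (R 6) F E (M' 12) (R' 33) (R' 34)) \<and>
     blocks v (R' 34) (M' 12) (R' 33) \<and> R' 33 \<le> R 6 \<and> 0 < R' 34 \<and> R' 34 \<le> n"

abbreviation "pivot_round \<equiv> merge_pass 12 13 ;; double_width ;; merge_pass 13 12 ;; double_width ;;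
  merge_pass 12 13 ;; thin_code"

lemma pivot_round_wp:
  assumes "env R" "weights_in M" "R 6 \<le> n" and ids: "\<And>k. k < R 6 \<Longrightarrow> M 9 k < n"
    and s: "sampling R M R0 M0" and lt: "R0 34 < R0 33"
    and Q: "\<And>R' M' t'. sampling R M R' M' \<Longrightarrow> R' 33 = (R0 33 + 1) div 2 \<Longrightarrow>
      t' \<le> t + 200 * R0 33 \<Longrightarrow> Q R' M' t'"
  shows "wp b ws pivot_round Q R0 M0 t"
proof -
  define N w where "N = R0 33" and "w = R0 34"
  define w1 where "w1 = min (2 * w) N"
  define w2 where "w2 = min (2 * w1) N"
  from s obtain F E where sa: "sampled v (M 9) (R 6) F E (M0 12) N w"
    and s0: "\<forall>r<33. R0 r = R r" "agree_off {12, 13} M0 M" "blocks v w (M0 12) N"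
      "N \<le> R 6" "0 < w" "w \<le> n"
    unfolding sampling_def N_def w_def by blast
  have wN: "w < N" "N \<le> n" "2 \<le> N" using lt s0 assms(3) by (auto simp: N_def w_def)
  have w12: "0 < w1" "w1 \<le> N" "0 < w2" "w2 \<le> N" using wN s0(5) by (auto simp: w1_def w2_def)
  have envI: "env R'" if "\<forall>r<33. R' r = R r" for R' using that assms(1) by (simp add: env_def)
  have wtsI: "weights_in M'" if "agree_off {12, 13} M' M" for M'
    using that assms(2) by (simp add: weights_in_def)
  have id0: "M0 12 x < n" if "x < N" for x
    using sa that ids unfolding sampled_def by metis
  show ?thesis
    unfolding wp_Seq
  proof (rule merge_pass_wp)
    fix R1 M1 t1
    assume A1: "\<forall>r<35. R1 r = R0 r" "\<forall>m. m \<noteq> 13 \<longrightarrow> M1 m = M0 m" "blocks v (2 * R0 34) (M1 13) (R0 33)"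
      "mset (map (M1 13) [0..<R0 33]) = mset (map (M0 12) [0..<R0 33])" "t1 \<le> t + 3 + 50 * R0 33"
    have b1: "blocks v w1 (M1 13) N" using blocks_min[OF A1(3)] by (simp add: w1_def w_def N_def)
    have id1: "M1 13 x < n" if "x < N" for x
      using bounded_if_mset_eq[OF A1(4) _ that[unfolded N_def]] id0 by (simp add: N_def)
    show "wp b ws double_width (wp b ws (merge_pass 13 12) (wp b ws double_width
      (wp b ws (merge_pass 12 13) (wp b ws thin_code Q)))) R1 M1 t1"
    proof (rule double_width_wp)
      fix R2 t2
      assume A2: "agree_off {34, 41} R2 R1" "R2 34 = min (2 * R1 34) (R1 33)" "t2 \<le> t1 + 6"
      have R2: "R2 33 = N" "R2 34 = w1" "\<forall>r<33. R2 r = R r"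
        using A1(1) A2(1,2) s0(1) by (auto simp: N_def w_def w1_def)
      show "wp b ws (merge_pass 13 12) (wp b ws double_width
        (wp b ws (merge_pass 12 13) (wp b ws thin_code Q))) R2 M1 t2"
      proof (rule merge_pass_wp)
        fix R3 M3 t3
        assume A3: "\<forall>r<35. R3 r = R2 r" "\<forall>m. m \<noteq> 12 \<longrightarrow> M3 m = M1 m" "blocks v (2 * R2 34) (M3 12) (R2 33)"
          "mset (map (M3 12) [0..<R2 33]) = mset (map (M1 13) [0..<R2 33])" "t3 \<le> t2 + 3 + 50 * R2 33"
        have b3: "blocks v w2 (M3 12) N" using blocks_min[OF A3(3)] by (simp add: R2 w2_def)
        have id3: "M3 12 x < n" if "x < N" for x
          using bounded_if_mset_eq[OF A3(4)[unfolded R2] id1 that] .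
        show "wp b ws double_width (wp b ws (merge_pass 12 13) (wp b ws thin_code Q)) R3 M3 t3"
        proof (rule double_width_wp)
          fix R4 t4
          assume A4: "agree_off {34, 41} R4 R3" "R4 34 = min (2 * R3 34) (R3 33)" "t4 \<le> t3 + 6"
          have R4: "R4 33 = N" "R4 34 = w2" "\<forall>r<33. R4 r = R r"
            using A3(1) A4(1,2) R2 by (auto simp: w2_def)
          show "wp b ws (merge_pass 12 13) (wp b ws thin_code Q) R4 M3 t4"
          proof (rule merge_pass_wp)
            fix R5 M5 t5
            assume A5: "\<forall>r<35. R5 r = R4 r" "\<forall>m. m \<noteq> 13 \<longrightarrow> M5 m = M3 m" "blocks v (2 * R4 34) (M5 13) (R4 33)"
              "mset (map (M5 13) [0..<R4 33]) = mset (map (M3 12) [0..<R4 33])" "t5 \<le> t4 + 3 + 50 * R4 33"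
            have R5: "R5 33 = N" "R5 34 = w2" "\<forall>r<33. R5 r = R r" using A5(1) R4 by auto
            show "wp b ws thin_code Q R5 M5 t5"
            proof (rule thin_wp)
              fix R6 M6 t6
              assume A6: "agree_off {33, 35, 36, 37, 38, 41} R6 R5" "R6 33 = (R5 33 + 1) div 2"
                "\<forall>k<(R5 33 + 1) div 2. M6 12 k = M5 13 (2 * k)" "\<forall>m. m \<noteq> 12 \<longrightarrow> M6 m = M5 m"
                "t6 \<le> t5 + 10 + 7 * R5 33"
              have R6: "R6 33 = (N + 1) div 2" "R6 34 = w2" "\<forall>r<33. R6 r = R r"
                using A6(1,2) R5 by auto
              have bl: "blocks v (2 * w2) (M5 13) N" using A5(3) by (simp add: R4)
              have ms: "mset (map (M5 13) [0..<N]) = mset (map (M0 12) [0..<N])"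
                using A5(4) A3(4) A1(4) unfolding R4 R2 N_def[symmetric] by simp
              have "w2 = min (4 * w) N" by (auto simp: w2_def w1_def)
              from sampled_step[OF sa wN(1) this bl ms]
              have "\<exists>F E. sampled v (M 9) (R 6) F E (\<lambda>k. M5 13 (2 * k)) ((N + 1) div 2) w2" by blast
              then have sa6: "\<exists>F E. sampled v (M 9) (R 6) F E (M6 12) (R6 33) (R6 34)"
                unfolding R6 using A6(3) R5(1) by (metis sampled_cong)
              have bl6: "blocks v (R6 34) (M6 12) (R6 33)"
                unfolding R6 using blocks_cong[OF _ blocks_thin[OF bl]] A6(3) R5(1) by simp
              have "agree_off {12, 13} M6 M"
                using A6(4) A5(2) A3(2) A1(2) s0(2) by simp
              moreover have "(N + 1) div 2 \<le> R 6" using s0(4) wN by linarith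
              ultimately have sm: "sampling R M R6 M6"
                unfolding sampling_def using sa6 bl6 R6 w12 wN by auto
              have "t6 \<le> t + 200 * R0 33"
                using A1(5) A2(3) A3(5) A4(3) A5(5) A6(5) wN(3)
                unfolding R2 R4 R5 N_def[symmetric] by linarith
              with sm show "Q R6 M6 t6" using R6(1) by (intro Q) (auto simp: N_def)
            qed (use R5 envI wN in auto)
          next
            show "\<And>x. x < R4 33 \<Longrightarrow> M3 12 x < n" using id3 by (simp add: R4)
            show "weights_in M3" using A3(2) A1(2) s0(2) by (intro wtsI) simp
          qed (use R4 envI b3 w12 wN in auto)
        qed (use A3(1) R2 envI w12 wN in auto)
      next
        show "\<And>x. x < R2 33 \<Longrightarrow> M1 13 x < n" using id1 by (simp add: R2)
        show "weights_in M1" using A1(2) s0(2) by (intro wtsI) simp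
      qed (use R2 envI b1 w12 wN in auto)
    qed (use A1(1) s0(1) envI wN in \<open>auto simp: N_def w_def\<close>)
  next
    show "\<And>x. x < R0 33 \<Longrightarrow> M0 12 x < n" using id0 by (simp add: N_def)
    show "weights_in M0" using s0(2) by (intro wtsI) simp
    show "env R0" using s0(1) by (rule envI)
  qed (use s0 wN in \<open>auto simp: N_def w_def\<close>)
qed

lemma pivot_wp:
  assumes "env R" "weights_in M" "R 6 \<le> n" "1 \<le> R 6" and ids: "\<And>k. k < R 6 \<Longrightarrow> M 9 k < n"
    and Q: "\<And>R' M' t'. (\<forall>r<33. r \<noteq> 8 \<longrightarrow> R' r = R r) \<Longrightarrow> agree_off {12, 13} M' M \<Longrightarrow>
      80 * cnt (\<lambda>x. v x < v (R' 8)) (M 9) (R 6) \<le> 79 * R 6 \<Longrightarrow>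
      80 * cnt (\<lambda>x. v (R' 8) < v x) (M 9) (R 6) \<le> 79 * R 6 \<Longrightarrow>
      (\<exists>l<R 6. R' 8 = M 9 l) \<Longrightarrow> t' \<le> t + 2000 * R 6 \<Longrightarrow> Q R' M' t'"
  shows "wp b ws pivot_code Q R M t"
proof -
  let ?s = "R 6"
  let ?I = "\<lambda>R' M' t'. sampling R M R' M' \<and> t' + 1000 * R' 33 \<le> t + 5 + 6 * ?s + 1000 * ?s"
  let ?post = "wp b ws (Ins (Op Div 36 33 4) ;; Ins (Load 8 12 36)) Q"
  have loop: "wp b ws (While 34 33 pivot_round) ?post R' M' t'" if I: "?I R' M' t'" for R' M' t'
  proof (rule wp_While[where I = ?I and T = "t + 5 + 6 * ?s + 1000 * ?s"])
    show "?I R' M' t'" by (rule I)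
  next
    fix R' M' t' assume I: "?I R' M' t'" and lt: "R' 34 < R' 33"
    then have "2 \<le> R' 33" by (auto simp: sampling_def)
    then have "1000 * ((R' 33 + 1) div 2) \<le> 750 * R' 33" by linarith
    then show "wp b ws pivot_round ?I R' M' (t' + 2)"
      using I lt assms \<open>2 \<le> R' 33\<close> by (intro pivot_round_wp) auto
  next
    fix R' M' t' assume I: "?I R' M' t'" and ge: "\<not> R' 34 < R' 33"
    then obtain F E where sa: "sampled v (M 9) ?s F E (M' 12) (R' 33) (R' 34)"
      and bl: "blocks v (R' 34) (M' 12) (R' 33)" by (auto simp: sampling_def)
    note p = sampled_pivot[OF sa blocks_single[OF bl] assms(4)]
    have "R' 4 = 2" using I assms(1) by (simp add: sampling_def env_def)
    then show "?post R' M' (t' + 2)"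
      using p ge I assms(4) by (auto simp: sampling_def intro!: Q)
  qed auto
  show ?thesis
    unfolding pivot_code_def wp_Seq
  proof (rule copy_wp)
    fix R' M' t'
    assume A: "agree_off {33, 35, 41} R' R" "R' 33 = ?s" "\<forall>k<?s. M' 12 k = M 9 k"
      "\<forall>m. m \<noteq> 12 \<longrightarrow> M' m = M m" "t' \<le> t + 4 + 6 * ?s"
    have "sampled v (M 9) ?s 1 0 (M' 12) ?s 1" using sampled_cong[OF _ sampled_init] A(3) by metis
    then have "?I (R'(34 := 1)) M' (t' + 1)"
      using A two_le by (auto simp: sampling_def blocks_1)
    then have "wp b ws (While 34 33 pivot_round) (wp b ws (Ins (Op Div 36 33 4)) (wp b ws (Ins (Load 8 12 36)) Q))
      (R'(34 := 1)) M' (t' + 1)"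
      using loop unfolding wp_Seq by blast
    from wp_cong_state[OF this]
    show "wp b ws (Ins (Move 34 3)) (wp b ws (While 34 33 pivot_round) (wp b ws (Ins (Op Div 36 33 4)) (wp b ws (Ins (Load 8 12 36)) Q))) R' M' t'"
      using A(1) assms(1) by (simp add: env_def)
  qed (use assms in auto)
qed

end

section \<open>Search for the threshold\<close>

lemma extra_cong: "X \<inter> fst ` set cs = Y \<inter> fst ` set cs \<Longrightarrow> extra X x cs = extra Y x cs"
proof (induction cs arbitrary: x)
  case (Cons e cs)
  obtain i a g where e: "e = (i, a, g)" by (cases e)
  have "i \<in> X \<longleftrightarrow> i \<in> Y" "X \<inter> fst ` set cs = Y \<inter> fst ` set cs" using Cons.prems by (auto simp: e)
  with Cons.IH show ?case by (simp add: e)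
qed simp

lemma kraft_cong: "X \<inter> {..<length ws} = Y \<inter> {..<length ws} \<Longrightarrow> kraft ws X = kraft ws Y"
  unfolding kraft_def by (rule sum.cong) (auto simp: of_bool_def)

lemma reduce_eq:
  assumes "reduce n U K 0 [] cs = (c, cs')" "wf_chain n cs" "length cs \<le> n" "0 < n" "U \<inter> K = {}"
    and "extra U 0 cs = 0" "X \<subseteq> K"
  shows "extra X 0 cs' = extra (X \<union> U) 0 cs"
proof -
  have *: "extra (Y \<union> U) 0 cs = extra Y 0 cs' + c" if "Y \<subseteq> K" for Y
    using reduce_extra[OF assms(1,2), of Y] assms(3-5) that by simp
  from *[of "{}"] assms(6) have "c = 0" by simp
  with *[OF assms(7)] show ?thesis by simp
qed

text \<open>
  \<open>C\<close> holds the items known to lie above the threshold, \<open>fst ` set cs\<close> the undecided ones, and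
  \<open>p\<close> is the largest item known to lie below, if there is one.
\<close>

definition search_inv :: "real list \<Rightarrow> nat \<Rightarrow> nat set \<Rightarrow> chain \<Rightarrow> nat \<Rightarrow> bool" where
  "search_inv ws B C cs p \<longleftrightarrow>
     (let n = length ws; A = fst ` set cs in
       wf_chain n cs \<and> distinct (map fst cs) \<and> A \<subseteq> {..<n} \<and> C \<subseteq> {..<n} \<and> C \<inter> A = {} \<and>
       (\<forall>X\<subseteq>A. extra X 0 cs = 0 \<longleftrightarrow> kraft ws (X \<union> C) \<le> B) \<and>
       (\<forall>c\<in>C. \<forall>x\<in>{..<n} - C. val ws x < val ws c) \<and>
       (\<forall>a\<in>A. \<forall>x\<in>{..<n} - C - A. val ws x < val ws a) \<and>
       ({..<n} - C - A \<noteq> {} \<longrightarrow>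
          p \<in> {..<n} - C - A \<and> B < kraft ws {i. val ws p \<le> val ws i} \<and>
          (\<forall>x\<in>{..<n} - C - A. val ws x \<le> val ws p)))"

lemma search_inv_init:
  assumes "wf_chain (length ws) cs" "distinct (map fst cs)" "fst ` set cs = {..<length ws}"
    and "\<forall>X. extra X 0 cs = 0 \<longleftrightarrow> kraft ws X \<le> B"
  shows "search_inv ws B {} cs p"
  using assms by (auto simp: search_inv_def Let_def)

lemma search_inv_end:
  assumes "search_inv ws B C [] p" "B < kraft ws UNIV"
  shows "p < length ws" "kraft ws {i. val ws p < val ws i} \<le> B" "B < kraft ws {i. val ws p \<le> val ws i}"
proof -
  let ?n = "length ws"
  have C: "kraft ws C \<le> B" "C \<subseteq> {..<?n}" using assms(1) by (auto simp: search_inv_def Let_def)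
  have "{..<?n} - C \<noteq> {}"
  proof
    assume "{..<?n} - C = {}"
    then have "kraft ws C = kraft ws UNIV" using C(2) by (intro kraft_cong) auto
    then show False using C(1) assms(2) by simp
  qed
  then have p: "p \<in> {..<?n} - C" "B < kraft ws {i. val ws p \<le> val ws i}"
    "\<forall>x\<in>{..<?n} - C. val ws x \<le> val ws p" "\<forall>c\<in>C. \<forall>x\<in>{..<?n} - C. val ws x < val ws c"
    using assms(1) by (auto simp: search_inv_def Let_def)
  have "C = {i. val ws p < val ws i} \<inter> {..<?n}"
  proof (intro set_eqI iffI)
    fix i assume "i \<in> {i. val ws p < val ws i} \<inter> {..<?n}"
    then show "i \<in> C" using p(3) by force
  qed (use p C in auto)
  then have "kraft ws C = kraft ws {i. val ws p < val ws i}" by (intro kraft_cong) auto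
  with C p show "p < length ws" "kraft ws {i. val ws p < val ws i} \<le> B" "B < kraft ws {i. val ws p \<le> val ws i}"
    by auto
qed

lemma search_inv_step:
  assumes inv: "search_inv ws B C cs p" and q: "q \<in> fst ` set cs"
  defines "U \<equiv> {i. val ws q \<le> val ws i}"
  shows "extra U 0 cs = 0 \<Longrightarrow> reduce (length ws) U {i. val ws i < val ws q} 0 [] cs = (c, cs') \<Longrightarrow>
      search_inv ws B (C \<union> U \<inter> fst ` set cs) cs' p \<and>
      map fst cs' = filter (\<lambda>i. val ws i < val ws q) (map fst cs)"
    and "extra U 0 cs \<noteq> 0 \<Longrightarrow> reduce (length ws) {} {i. val ws q < val ws i} 0 [] cs = (c, cs') \<Longrightarrow>
      search_inv ws B C cs' q \<and> map fst cs' = filter (\<lambda>i. val ws q < val ws i) (map fst cs)"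
proof -
  let ?n = "length ws" and ?v = "val ws"
  define A where "A = fst ` set cs"
  have I: "wf_chain ?n cs" "distinct (map fst cs)" "A \<subseteq> {..<?n}" "C \<subseteq> {..<?n}" "C \<inter> A = {}"
    "\<forall>X\<subseteq>A. extra X 0 cs = 0 \<longleftrightarrow> kraft ws (X \<union> C) \<le> B"
    "\<forall>c\<in>C. \<forall>x\<in>{..<?n} - C. ?v x < ?v c"
    "\<forall>a\<in>A. \<forall>x\<in>{..<?n} - C - A. ?v x < ?v a"
    "{..<?n} - C - A \<noteq> {} \<Longrightarrow>
      p \<in> {..<?n} - C - A \<and> B < kraft ws {i. ?v p \<le> ?v i} \<and> (\<forall>x\<in>{..<?n} - C - A. ?v x \<le> ?v p)"
    using inv by (auto simp: search_inv_def Let_def A_def)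
  have qA: "q \<in> A" "q < ?n" using q I(3) by (auto simp: A_def)
  have n: "0 < ?n" using qA by linarith
  have len: "length cs \<le> ?n"
    using length_le_if_distinct[OF I(2), of ?n] I(3) by (simp add: A_def)
  have UA: "extra X 0 cs = extra (X \<inter> A) 0 cs" for X
    by (rule extra_cong) (auto simp: A_def)
  {
    assume e: "extra U 0 cs = 0" and r: "reduce ?n U {i. ?v i < ?v q} 0 [] cs = (c, cs')"
    note rp = reduce_props[OF r I(1) _ n, simplified]
    have A': "fst ` set cs' = A - U"
    proof -
      have "fst ` set cs' = set (map fst cs')" by simp
      also have "\<dots> = A - U" unfolding rp(2) by (auto simp: A_def U_def)
      finally show ?thesis .
    qed
    have "extra X 0 cs' = 0 \<longleftrightarrow> kraft ws (X \<union> (C \<union> U \<inter> A)) \<le> B" if X: "X \<subseteq> A - U" for X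
    proof -
      have "extra X 0 cs' = extra (X \<union> U) 0 cs"
        using X by (intro reduce_eq[OF r I(1) len n]) (auto simp: U_def e[unfolded U_def])
      also have "\<dots> = extra ((X \<union> U) \<inter> A) 0 cs" by (rule UA)
      also have "(X \<union> U) \<inter> A = X \<union> U \<inter> A" using X by blast
      finally have "extra X 0 cs' = 0 \<longleftrightarrow> kraft ws (X \<union> U \<inter> A \<union> C) \<le> B"
        using I(6)[rule_format, of "X \<union> U \<inter> A"] X by (simp add: subset_iff)
      then show ?thesis by (simp add: Un_ac)
    qed
    moreover have "distinct (map fst cs')" unfolding rp(2) using I(2) by simp
    moreover have "{..<?n} - (C \<union> U \<inter> A) - (A - U) = {..<?n} - C - A" by auto
    moreover have "\<forall>c\<in>C \<union> U \<inter> A. \<forall>x\<in>{..<?n} - (C \<union> U \<inter> A). ?v x < ?v c"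
    proof (intro ballI)
      fix c x assume c: "c \<in> C \<union> U \<inter> A" and x: "x \<in> {..<?n} - (C \<union> U \<inter> A)"
      show "?v x < ?v c"
      proof (cases "c \<in> C")
        case True
        then show ?thesis using I(7) x by auto
      next
        case False
        then have "c \<in> A" "?v q \<le> ?v c" using c by (auto simp: U_def)
        moreover have "?v x < ?v q" if "x \<in> A" using that x by (auto simp: U_def)
        ultimately show ?thesis using I(8) x by (cases "x \<in> A") auto
      qed
    qed
    ultimately show "search_inv ws B (C \<union> U \<inter> fst ` set cs) cs' p \<and>
      map fst cs' = filter (\<lambda>i. val ws i < val ws q) (map fst cs)"
      unfolding search_inv_def Let_def A' A_def[symmetric]
      using rp I(3-5,8,9) by auto
  next
    assume e: "extra U 0 cs \<noteq> 0" and r: "reduce ?n {} {i. ?v q < ?v i} 0 [] cs = (c, cs')"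
    note rp = reduce_props[OF r I(1) _ n, simplified]
    let ?K = "{i. ?v q < ?v i}"
    have A': "fst ` set cs' = A \<inter> ?K"
    proof -
      have "fst ` set cs' = set (map fst cs')" by simp
      also have "\<dots> = A \<inter> ?K" unfolding rp(2) by (auto simp: A_def)
      finally show ?thesis .
    qed
    have f1: "extra X 0 cs' = 0 \<longleftrightarrow> kraft ws (X \<union> C) \<le> B" if X: "X \<subseteq> A \<inter> ?K" for X
    proof -
      have "extra X 0 cs' = extra (X \<union> {}) 0 cs"
        using X by (intro reduce_eq[OF r I(1) len n]) (auto simp: extra_empty)
      then show ?thesis using I(6) X by simp
    qed
    have f2: "distinct (map fst cs')" unfolding rp(2) using I(2) by simp
    have R: "{..<?n} - C - A \<inter> ?K = ({..<?n} - C - A) \<union> (A - ?K)" using I(3,5) by auto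
    have f3: "B < kraft ws U"
    proof -
      have "U \<inter> {..<?n} = U \<inter> A \<union> C"
      proof (intro set_eqI iffI)
        fix i assume i: "i \<in> U \<inter> {..<?n}"
        show "i \<in> U \<inter> A \<union> C"
        proof (rule ccontr)
          assume "i \<notin> U \<inter> A \<union> C"
          then have "?v i < ?v q" using i I(8) qA by auto
          then show False using i by (simp add: U_def)
        qed
      next
        fix i assume "i \<in> U \<inter> A \<union> C"
        moreover have "i \<in> U" if "i \<in> C"
        proof -
          have "q \<in> {..<?n} - C" using I(5) qA by auto
          then have "?v q < ?v i" using I(7) that by blast
          then show ?thesis by (simp add: U_def)
        qed
        ultimately show "i \<in> U \<inter> {..<?n}" using I(3,4) by auto
      qed
      then have "kraft ws U = kraft ws (U \<inter> A \<union> C)" using I(3,4) by (intro kraft_cong) auto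
      moreover have "extra (U \<inter> A) 0 cs \<noteq> 0" using e UA[of U] by simp
      ultimately show ?thesis using I(6) by (simp add: not_le)
    qed
    have f4: "\<forall>x\<in>{..<?n} - C - A \<inter> ?K. ?v x \<le> ?v q"
    proof
      fix x assume "x \<in> {..<?n} - C - A \<inter> ?K"
      then show "?v x \<le> ?v q" using I(8) qA by (cases "x \<in> A") (auto intro: less_imp_le)
    qed
    have f5: "\<forall>a\<in>A \<inter> ?K. \<forall>x\<in>{..<?n} - C - A \<inter> ?K. ?v x < ?v a"
    proof (intro ballI)
      fix a x assume "a \<in> A \<inter> ?K" "x \<in> {..<?n} - C - A \<inter> ?K"
      then show "?v x < ?v a" using I(8) by (cases "x \<in> A") auto
    qed
    have f6: "q \<in> {..<?n} - C - A \<inter> ?K" using qA I(5) by auto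
    have f7: "A \<inter> ?K \<subseteq> {..<?n}" "C \<inter> (A \<inter> ?K) = {}" using I(3,5) by auto
    show "search_inv ws B C cs' q \<and> map fst cs' = filter (\<lambda>i. val ws q < val ws i) (map fst cs)"
      unfolding search_inv_def Let_def A'
      by (intro conjI impI allI)
        (fact rp f2 f7 I(4) f5 I(7) | rule f1, assumption | rule f6 f3[unfolded U_def] f4 | simp add: rp)+
  }
qed

definition count_code :: com where
  "count_code =
     Ins (Load 16 9 15) ;; Ins (Load 17 4 16) ;; Ins (Load 18 5 16) ;;
     Cond (WLe 47 48 17 18) (Ins (Op Add 14 14 3)) Skip ;;
     Ins (Load 20 10 15) ;; Ins (Load 21 11 15)"

definition advance_code :: com where
  "advance_code =
     Cond (Lt 20 14)
       (Ins (Op Sub 14 14 20) ;; Ins (Op Sub 14 14 3) ;; Ins (Op Div 14 14 21) ;; Ins (Op Add 14 14 3))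
       (Ins (Move 14 2)) ;;
     Ins (Op Add 15 15 3)"

definition select_code :: com where
  "select_code =
     Ins (Load 16 9 15) ;; Ins (Load 17 4 16) ;; Ins (Load 18 5 16) ;;
     Ins (Load 20 10 15) ;; Ins (Load 21 11 15) ;;
     Cond (Lt 2 14)
       (Cond (WLe 17 18 47 48) (Ins (Move 19 2)) (Ins (Move 19 3)))
       (Cond (WLe 47 48 17 18) (Ins (Op Add 22 22 3) ;; Ins (Move 19 2)) (Ins (Move 19 3)))"

definition keep_code :: com where
  "keep_code =
     Cond (Lt 2 19)
       (Ins (Store 9 13 16) ;; Ins (Store 10 13 20) ;; Ins (Store 11 13 21) ;; Ins (Op Add 13 13 3))
       compose_code ;;
     Ins (Op Add 15 15 3)"

definition round_code :: com where
  "round_code =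
     pivot_code ;; Ins (Load 47 4 8) ;; Ins (Load 48 5 8) ;; Ins (Move 14 2) ;; Ins (Move 15 2) ;;
     While 15 6 (count_code ;; advance_code) ;;
     Ins (Move 22 2) ;; Ins (Move 13 2) ;; Ins (Move 15 2) ;;
     While 15 6 (select_code ;; shift_code ;; keep_code) ;;
     Cond (Lt 2 14) (Ins (Move 7 8)) Skip ;;
     Ins (Move 6 13)"

definition search_code :: com where
  "search_code = While 2 6 round_code"

lemma drop_chain: "k < s \<Longrightarrow> drop k (chain M s) = (M 9 k, M 10 k, M 11 k) # drop (Suc k) (chain M s)"
  using Cons_nth_drop_Suc[of k "chain M s"] by (simp add: chain_def)

lemma wf_chain_nth: "wf_chain n (chain M s) \<Longrightarrow> k < s \<Longrightarrow> M 10 k \<le> n \<and> 0 < M 11 k \<and> M 11 k \<le> n"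
  unfolding wf_chain_def chain_def by auto

context ram
begin

lemma count_wp:
  assumes "env R" "weights_in M" "M 9 (R 15) < n" "p < n" "R 47 = M 4 p" "R 48 = M 5 p" "Suc (R 14) \<le> n"
    and Q: "\<And>R' t'. agree_off {14, 16, 17, 18, 20, 21} R' R \<Longrightarrow>
      R' 14 = R 14 + of_bool (v p \<le> v (M 9 (R 15))) \<Longrightarrow> R' 20 = M 10 (R 15) \<Longrightarrow> R' 21 = M 11 (R 15) \<Longrightarrow>
      t' \<le> t + 10 \<Longrightarrow> Q R' M t'"
  shows "wp b ws count_code Q R M t"
proof -
  have W: "M 4 x < n" "ws ! M 4 x + real (M 5 x) = v x" if "x < n" for x
    using assms(2) that by (auto simp: weights_in_def)
  show ?thesis
    unfolding count_code_def using W[OF assms(3)] W[OF assms(4)] assms(1,5-7)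
    by (auto simp: wp_Cond env_def word_ops intro!: Q split: if_splits)
qed

lemma select_wp:
  assumes "env R" "weights_in M" "M 9 (R 15) < n" "p < n" "R 47 = M 4 p" "R 48 = M 5 p" "Suc (R 22) \<le> n"
  defines "U \<equiv> if R 14 = 0 then {i. v p \<le> v i} else {}"
    and "K \<equiv> if R 14 = 0 then {i. v i < v p} else {i. v p < v i}"
  assumes Q: "\<And>R' t'. agree_off {16, 17, 18, 19, 20, 21, 22} R' R \<Longrightarrow> R' 16 = M 9 (R 15) \<Longrightarrow>
      R' 19 = of_bool (M 9 (R 15) \<in> K) \<Longrightarrow> R' 22 = R 22 + of_bool (M 9 (R 15) \<in> U) \<Longrightarrow>
      R' 20 = M 10 (R 15) \<Longrightarrow> R' 21 = M 11 (R 15) \<Longrightarrow> t' \<le> t + 14 \<Longrightarrow> Q R' M t'"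
  shows "wp b ws select_code Q R M t"
proof -
  have W: "M 4 x < n" "ws ! M 4 x + real (M 5 x) = v x" if "x < n" for x
    using assms(2) that by (auto simp: weights_in_def)
  show ?thesis
  proof (cases "R 14 = 0")
    case True
    then show ?thesis
      unfolding select_code_def using W[OF assms(3)] W[OF assms(4)] assms(1,5-7)
      by (auto simp: wp_Cond env_def word_ops U_def K_def not_le intro!: Q split: if_splits)
  next
    case False
    then show ?thesis
      unfolding select_code_def using W[OF assms(3)] W[OF assms(4)] assms(1,5-7)
      by (auto simp: wp_Cond env_def word_ops U_def K_def not_le intro!: Q split: if_splits)
  qed
qed

lemma test_loop_wp:
  assumes "env R" "weights_in M" "R 6 \<le> n" "wf_chain n (chain M (R 6))" and ids: "\<And>k. k < R 6 \<Longrightarrow> M 9 k < n"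
    and p: "p < n" "R 47 = M 4 p" "R 48 = M 5 p" and "R 14 = 0" "R 15 = 0"
    and Q: "\<And>R' t'. agree_off {14, 15, 16, 17, 18, 20, 21} R' R \<Longrightarrow>
      R' 14 = extra {i. v p \<le> v i} 0 (chain M (R 6)) \<Longrightarrow> R' 14 \<le> n \<Longrightarrow> t' \<le> t + 2 + 25 * R 6 \<Longrightarrow> Q R' M t'"
  shows "wp b ws (While 15 6 (count_code ;; advance_code)) Q R M t"
proof -
  let ?U = "{i. v p \<le> v i}" and ?cs = "chain M (R 6)"
  let ?I = "\<lambda>R' M' t'. M' = M \<and> agree_off {14, 15, 16, 17, 18, 20, 21} R' R \<and> R' 15 \<le> R 6 \<and>
    R' 14 \<le> R' 15 \<and> extra ?U 0 ?cs = extra ?U (R' 14) (drop (R' 15) ?cs) \<and> t' \<le> t + 25 * R' 15"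
  show ?thesis
  proof (rule wp_While[where I = ?I and T = "t + 25 * R 6"])
    show "?I R M t" using assms by simp
  next
    fix R' M' t' assume I: "?I R' M' t'" and lt: "R' 15 < R' 6"
    define k i a g where kd: "k = R' 15" "i = M 9 k" "a = M 10 k" "g = M 11 k"
    have k: "k < R 6" "R' 6 = R 6" using I lt by (auto simp: kd)
    have e: "R' 2 = 0" "R' 3 = 1" "R' 47 = M 4 p" "R' 48 = M 5 p" using I assms(1) p by (auto simp: env_def)
    have i: "i < n" using ids k by (simp add: kd)
    have W: "M 4 x < n" "ws ! M 4 x + real (M 5 x) = v x" if "x < n" for x
      using assms(2) that by (auto simp: weights_in_def)
    have g: "0 < g" "a \<le> n" "g \<le> n" using wf_chain_nth[OF assms(4) k(1)] by (auto simp: kd)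
    define y where "y = R' 14 + of_bool (v p \<le> v i)"
    have y: "y \<le> Suc k" "Suc k \<le> n" using I k assms(3) by (auto simp: y_def kd)
    have ey: "extra ?U 0 ?cs = extra ?U (merged a g y) (drop (Suc k) ?cs)"
      using I drop_chain[OF k(1), of M] by (simp add: y_def kd)
    have mle: "merged a g y \<le> Suc k" using merged_le[OF g(1), of a y] y by linarith
    have m1: "merged a g y = (y - Suc a) div g + 1" if "a < y"
      using cdiv_pos_eq[OF g(1), of "y - a"] that by (simp add: merged_def)
    have m2: "merged a g y = 0" if "\<not> a < y" using that by (simp add: merged_def)
    have m3: "Suc ((y - Suc a) div g) \<le> n" if "a < y" using m1[OF that] mle y by linarith
    have fin: "wp b ws advance_code ?I R2 M t2"
      if R2: "agree_off {14, 15, 16, 17, 18, 20, 21} R2 R" "R2 14 = y" "R2 15 = k" "R2 20 = a" "R2 21 = g"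
        and t2: "t2 \<le> t + 25 * k + 12" for R2 t2
    proof -
      have "R2 2 = 0" "R2 3 = 1" using R2(1) assms(1) by (auto simp: env_def)
      then show ?thesis unfolding advance_code_def
        using R2 t2 y k g ey mle m1 m2 m3 by (cases "a < y") (auto simp: word_ops)
    qed
    have M': "M' = M" and R14: "R' 14 \<le> n" "Suc (R' 14) \<le> n" using I k assms(3) by (auto simp: kd)
    show "wp b ws (count_code ;; advance_code) ?I R' M' (t' + 2)"
      unfolding wp_Seq
    proof (rule count_wp[where p = p])
      fix R2 t2
      assume C: "agree_off {14, 16, 17, 18, 20, 21} R2 R'"
        "R2 14 = R' 14 + of_bool (v p \<le> v (M' 9 (R' 15)))" "R2 20 = M' 10 (R' 15)" "R2 21 = M' 11 (R' 15)"
        "t2 \<le> t' + 2 + 10"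
      show "wp b ws advance_code ?I R2 M' t2"
        unfolding M' by (rule fin) (use C I in \<open>auto simp: kd y_def M'\<close>)
    qed (use I assms(1,2) p i R14 in \<open>auto simp: M' kd env_def\<close>)
  next
    fix R' M' t' assume I: "?I R' M' t'" and "\<not> R' 15 < R' 6"
    then have "R' 15 = R 6" by auto
    then show "Q R' M' (t' + 2)" using I assms(3) by (auto intro!: Q)
  qed auto
qed

lemma keep_wp:
  assumes "env R" "R 20 \<le> n" "R 21 \<le> n" "Suc (R 13) \<le> n" "Suc (R 15) \<le> n" "wf_chain n (chain M (R 13))"
    and "R 19 = of_bool c"
    and Q: "\<And>R' M' t'. agree_off {13, 15, 25, 26, 27, 28, 29, 30, 31, 32} R' R \<Longrightarrow>
      R' 15 = Suc (R 15) \<Longrightarrow> R' 13 \<le> Suc (R 13) \<Longrightarrow>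
      chain M' (R' 13) = (if c then chain M (R 13) @ [(R 16, R 20, R 21)]
        else comp_last n (chain M (R 13)) (R 20) (R 21)) \<Longrightarrow>
      (\<forall>m k. m \<notin> {9, 10, 11} \<or> R 13 < k \<longrightarrow> M' m k = M m k) \<Longrightarrow> t' \<le> t + 50 \<Longrightarrow> Q R' M' t'"
  shows "wp b ws keep_code Q R M t"
proof (cases c)
  case True
  let ?M = "M(9 := (M 9)(R 13 := R 16), 10 := (M 10)(R 13 := R 20), 11 := (M 11)(R 13 := R 21))"
  have "chain ?M (R 13) = chain M (R 13)" by (rule chain_cong) auto
  then have "chain ?M (Suc (R 13)) = chain M (R 13) @ [(R 16, R 20, R 21)]" by (simp add: chain_Suc)
  then show ?thesis
    unfolding keep_code_def using assms(1,4,5,7) True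
    by (auto simp: env_def word_ops intro!: Q split: if_splits)
next
  case False
  have k: "wp b ws (Ins (Op Add 15 15 3)) Q R' M' t'"
    if A: "agree_off {25, 26, 27, 28, 29, 30, 31, 32} R' R"
      "chain M' (R 13) = comp_last n (chain M (R 13)) (R 20) (R 21)"
      "\<forall>m k. m \<notin> {10, 11} \<or> R 13 \<le> k \<longrightarrow> M' m k = M m k" "t' \<le> t + 2 + 40" for R' M' t'
    using A False assms(1,5) by (auto simp: env_def word_ops intro!: Q)
  have "wp b ws compose_code (wp b ws (Ins (Op Add 15 15 3)) Q) R M (t + 2)"
    by (rule compose_wp) (use assms k in auto)
  then show ?thesis
    unfolding keep_code_def using False assms(1,7) by (simp add: env_def)
qed

lemma reduce_loop_wp:
  assumes "env R" "weights_in M" "R 6 \<le> n" "wf_chain n (chain M (R 6))" and ids: "\<And>k. k < R 6 \<Longrightarrow> M 9 k < n"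
    and p: "p < n" "R 47 = M 4 p" "R 48 = M 5 p" and z: "R 13 = 0" "R 15 = 0" "R 22 = 0"
  defines "U \<equiv> if R 14 = 0 then {i. v p \<le> v i} else {}"
    and "K \<equiv> if R 14 = 0 then {i. v i < v p} else {i. v p < v i}"
  assumes Q: "\<And>R' M' t'. agree_off {13, 15, 16, 17, 18, 19, 20, 21, 22, 23, 24, 25, 26, 27, 28, 29, 30, 31, 32} R' R \<Longrightarrow>
      agree_off {9, 10, 11} M' M \<Longrightarrow>
      reduce n U K 0 [] (chain M (R 6)) = (R' 22, chain M' (R' 13)) \<Longrightarrow> t' \<le> t + 2 + 90 * R 6 \<Longrightarrow> Q R' M' t'"
  shows "wp b ws (While 15 6 (select_code ;; shift_code ;; keep_code)) Q R M t"
proof -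
  let ?s = "R 6" and ?cs = "chain M (R 6)"
  let ?fr = "\<lambda>R'. agree_off {13, 15, 16, 17, 18, 19, 20, 21, 22, 23, 24, 25, 26, 27, 28, 29, 30, 31, 32} R' R"
  let ?I = "\<lambda>R' M' t'. ?fr R' \<and> R' 15 \<le> ?s \<and> R' 13 \<le> R' 15 \<and> R' 22 \<le> R' 15 \<and>
    wf_chain n (chain M' (R' 13)) \<and> (\<forall>m k. m \<notin> {9, 10, 11} \<or> R' 15 \<le> k \<longrightarrow> M' m k = M m k) \<and>
    reduce n U K 0 [] ?cs = reduce n U K (R' 22) (chain M' (R' 13)) (drop (R' 15) ?cs) \<and>
    t' \<le> t + 90 * R' 15"
  have n: "0 < n" using two_le by linarith
  show ?thesis
  proof (rule wp_While[where I = ?I and T = "t + 90 * ?s"])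
    show "?I R M t" using z by simp
  next
    fix R' M' t' assume I: "?I R' M' t'" and lt: "R' 15 < R' 6"
    define k where "k = R' 15"
    define i a g where iag: "i = M 9 k" "a = M 10 k" "g = M 11 k"
    have k: "k < ?s" "k < n" "R' 6 = ?s" using I lt assms(3) by (auto simp: k_def)
    have e: "env R'" "R' 47 = M 4 p" "R' 48 = M 5 p" "R' 14 = R 14" using I assms(1) p by (auto simp: env_def)
    have Mk: "M' 9 k = i" "M' 10 k = a" "M' 11 k = g" using I by (auto simp: iag k_def)
    have i: "i < n" using ids k by (simp add: iag)
    have w: "weights_in M'" using I assms(2) by (simp add: weights_in_def)
    have M45: "M' 4 = M 4" "M' 5 = M 5" using I by (auto intro!: ext)
    have g: "0 < g" "a \<le> n" "g \<le> n" using wf_chain_nth[OF assms(4) k(1)] by (auto simp: iag)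
    define c where "c = R' 22 + of_bool (i \<in> U)"
    have c: "c \<le> Suc k" "c \<le> n" using I k by (auto simp: c_def k_def)
    define a' c' where ac: "a' = fst (shift a g c)" "c' = snd (shift a g c)"
    have acb: "a' \<le> n" "c' \<le> c" using shift_bounds[OF g, of c] by (auto simp: ac)
    define out where "out = (if i \<in> K then chain M' (R' 13) @ [(i, a', g)] else comp_last n (chain M' (R' 13)) a' g)"
    have red: "reduce n U K 0 [] ?cs = reduce n U K c' out (drop (Suc k) ?cs)"
      using I drop_chain[OF k(1), of M]
      by (simp add: k_def[symmetric] iag[symmetric] out_def ac c_def split: prod.split)
    have wfo: "wf_chain n out" using I g acb comp_last_props(1)[of n "chain M' (R' 13)" g a'] n
      by (simp add: out_def)
    show "wp b ws (select_code ;; shift_code ;; keep_code) ?I R' M' (t' + 2)"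
      unfolding wp_Seq
    proof (rule select_wp[where p = p])
      fix R2 t2
      assume A2: "agree_off {16, 17, 18, 19, 20, 21, 22} R2 R'" "R2 16 = M' 9 (R' 15)"
        "R2 19 = of_bool (M' 9 (R' 15) \<in> (if R' 14 = 0 then {i. v i < v p} else {i. v p < v i}))"
        "R2 22 = R' 22 + of_bool (M' 9 (R' 15) \<in> (if R' 14 = 0 then {i. v p \<le> v i} else {}))"
        "R2 20 = M' 10 (R' 15)" "R2 21 = M' 11 (R' 15)" "t2 \<le> t' + 2 + 14"
      have B: "R2 16 = i" "R2 19 = of_bool (i \<in> K)" "R2 22 = c" "R2 20 = a" "R2 21 = g" "R2 13 = R' 13" "R2 15 = k"
        using A2 Mk by (simp_all add: k_def[symmetric] e(4) U_def K_def c_def)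
      have e2: "env R2" using A2(1) e(1) by (simp add: env_def)
      show "wp b ws shift_code (wp b ws keep_code ?I) R2 M' t2"
      proof (rule shift_wp)
        fix R3 t3
        assume A3: "agree_off {20, 22, 23, 24} R3 R2" "R3 20 = fst (shift (R2 20) (R2 21) (R2 22))"
          "R3 22 = snd (shift (R2 20) (R2 21) (R2 22))" "t3 \<le> t2 + 10"
        have C: "R3 20 = a'" "R3 22 = c'" "R3 21 = g" "R3 16 = i" "R3 13 = R' 13" "R3 15 = k" "R3 19 = of_bool (i \<in> K)"
          using A3 B by (simp_all add: ac)
        have e3: "env R3" using A3(1) e2 by (simp add: env_def)
        show "wp b ws keep_code ?I R3 M' t3"
        proof (rule keep_wp[where c = "i \<in> K"])
          fix R4 M4 t4
          assume A4: "agree_off {13, 15, 25, 26, 27, 28, 29, 30, 31, 32} R4 R3"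
            "R4 15 = Suc (R3 15)" "R4 13 \<le> Suc (R3 13)"
            "chain M4 (R4 13) = (if i \<in> K then chain M' (R3 13) @ [(R3 16, R3 20, R3 21)]
              else comp_last n (chain M' (R3 13)) (R3 20) (R3 21))"
            "\<forall>m k. m \<notin> {9, 10, 11} \<or> R3 13 < k \<longrightarrow> M4 m k = M' m k" "t4 \<le> t3 + 50"
          have D: "chain M4 (R4 13) = out" "R4 15 = Suc k" "R4 22 = c'" "R4 13 \<le> Suc (R' 13)"
            using A4 C by (simp_all add: out_def)
          have "?fr R4" using A4(1) A3(1) A2(1) I by simp
          moreover have "\<forall>m j. m \<notin> {9, 10, 11} \<or> Suc k \<le> j \<longrightarrow> M4 m j = M m j"
            using A4(5) I by (auto simp: C k_def)
          moreover have "t4 \<le> t + 90 * Suc k" using A4(6) A3(4) A2(7) I by (simp add: k_def)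
          ultimately show "?I R4 M4 t4"
            using D red wfo I k c acb by (simp add: k_def)
        qed (use e3 C acb g I k in \<open>auto simp: k_def\<close>)
      qed (use e2 B g c in auto)
    qed (use e w i p Mk M45 I k in \<open>auto simp: k_def\<close>)
  next
    fix R' M' t' assume I: "?I R' M' t'" and "\<not> R' 15 < R' 6"
    then have "R' 15 = ?s" by auto
    then show "Q R' M' (t' + 2)" using I by (intro Q) (auto intro!: ext)
  qed auto
qed

lemma map_fst_chain: "map fst (chain M s) = map (M 9) [0..<s]"
  by (simp add: chain_def)

lemma round_wp:
  assumes "env R" "weights_in M" and inv: "search_inv ws B C (chain M (R 6)) (R 7)" and pos: "0 < R 6"
    and Q: "\<And>R' M' t' C'. env R' \<Longrightarrow> agree_off {9, 10, 11, 12, 13} M' M \<Longrightarrow>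
      search_inv ws B C' (chain M' (R' 6)) (R' 7) \<Longrightarrow> 80 * R' 6 \<le> 79 * R 6 \<Longrightarrow>
      t' \<le> t + 2200 * R 6 \<Longrightarrow> Q R' M' t'"
  shows "wp b ws round_code Q R M t"
proof -
  let ?s = "R 6" and ?cs = "chain M (R 6)"
  have A: "fst ` set ?cs = M 9 ` {..<?s}" by (auto simp: chain_def image_image)
  have sub: "M 9 ` {..<?s} \<subseteq> {..<n}" and wf: "wf_chain n ?cs" and dist: "distinct (map fst ?cs)"
    using inv by (auto simp: search_inv_def Let_def A)
  have ids: "M 9 k < n" if "k < ?s" for k using sub that by auto
  have sn: "?s \<le> n" using length_le_if_distinct[OF dist, of n] sub by (simp add: A)
  have len: "length (filter P (map fst ?cs)) = cnt P (M 9) ?s" for P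
    unfolding map_fst_chain cnt_mset by (simp only: mset_filter[symmetric] size_mset)
  show ?thesis
    unfolding round_code_def wp_Seq[of b ws pivot_code]
  proof (rule pivot_wp)
    fix R1 M1 t1
    assume A1: "\<forall>r<33. r \<noteq> 8 \<longrightarrow> R1 r = R r" "agree_off {12, 13} M1 M"
      "80 * cnt (\<lambda>x. v x < v (R1 8)) (M 9) ?s \<le> 79 * ?s" "80 * cnt (\<lambda>x. v (R1 8) < v x) (M 9) ?s \<le> 79 * ?s"
      "\<exists>l<?s. R1 8 = M 9 l" "t1 \<le> t + 2000 * ?s"
    define p where "p = R1 8"
    have p: "p \<in> fst ` set ?cs" "p < n" using A1(5) ids by (auto simp: A p_def)
    have cs1: "chain M1 j = chain M j" for j by (rule chain_cong) (use A1(2) in auto)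
    have w1: "weights_in M1" using A1(2) assms(2) by (simp add: weights_in_def)
    have e1: "env R1" using A1(1) assms(1) by (simp add: env_def)
    let ?U = "{i. v p \<le> v i}"
    let ?tail = "Cond (Lt 2 14) (Ins (Move 7 8)) Skip ;; Ins (Move 6 13)"
    let ?loop2 = "While 15 6 (select_code ;; shift_code ;; keep_code) ;; ?tail"
    have red: "wp b ws ?loop2 Q R3 M1 t3"
      if R3: "agree_off {13, 14, 15, 16, 17, 18, 20, 21, 22, 47, 48} R3 R1" "R3 47 = M1 4 p" "R3 48 = M1 5 p"
        "R3 13 = 0" "R3 15 = 0" "R3 22 = 0" "R3 14 = extra ?U 0 ?cs" "t3 \<le> t1 + 20 + 25 * ?s" for R3 t3
      unfolding wp_Seq
    proof (rule reduce_loop_wp[where p = p])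
      have r6: "R3 6 = ?s" "R3 7 = R 7" "R3 8 = p" using R3(1) A1(1) by (auto simp: p_def)
      show "env R3" using R3(1) e1 by (simp add: env_def)
      show "R3 6 \<le> n" "wf_chain n (chain M1 (R3 6))" using sn wf by (auto simp: r6 cs1)
      show "M1 9 k < n" if "k < R3 6" for k using ids that A1(2) by (simp add: r6)
      fix R4 M4 t4
      assume A4: "agree_off {13, 15, 16, 17, 18, 19, 20, 21, 22, 23, 24, 25, 26, 27, 28, 29, 30, 31, 32} R4 R3"
        "agree_off {9, 10, 11} M4 M1"
        "reduce n (if R3 14 = 0 then {i. v p \<le> v i} else {}) (if R3 14 = 0 then {i. v i < v p} else {i. v p < v i}) 0 []
           (chain M1 (R3 6)) = (R4 22, chain M4 (R4 13))" "t4 \<le> t3 + 2 + 90 * R3 6"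
      have r4: "R4 14 = R3 14" "R4 8 = p" "R4 7 = R 7" "env R4" "R4 2 = 0"
        using A4(1) r6 \<open>env R3\<close> by (auto simp: env_def)
      have fr: "agree_off {9, 10, 11, 12, 13} M4 M" using A4(2) A1(2) by simp
      have tm: "t4 \<le> t + 2170 * ?s" using A4(4) R3(8) A1(6) pos by (simp add: r6)
      show "wp b ws (Cond (Lt 2 14) (Ins (Move 7 8)) Skip) (wp b ws (Ins (Move 6 13)) Q) R4 M4 t4"
      proof (cases "R3 14 = 0")
        case True
        then have "search_inv ws B (C \<union> ?U \<inter> fst ` set ?cs) (chain M4 (R4 13)) (R 7) \<and>
            map fst (chain M4 (R4 13)) = filter (\<lambda>i. v i < v p) (map fst ?cs)"
          using search_inv_step(1)[OF inv p(1)] A4(3) R3(7) by (simp add: r6 cs1)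
        moreover from this have "R4 13 = cnt (\<lambda>i. v i < v p) (M 9) ?s"
          by (metis len length_chain length_map)
        ultimately show ?thesis
          using True r4 fr tm A1(3) pos by (auto simp: env_def p_def[symmetric] intro!: Q)
      next
        case False
        then have "search_inv ws B C (chain M4 (R4 13)) p \<and>
            map fst (chain M4 (R4 13)) = filter (\<lambda>i. v p < v i) (map fst ?cs)"
          using search_inv_step(2)[OF inv p(1)] A4(3) R3(7) by (simp add: r6 cs1)
        moreover from this have "R4 13 = cnt (\<lambda>i. v p < v i) (M 9) ?s"
          by (metis len length_chain length_map)
        ultimately show ?thesis
          using False r4 fr tm A1(4) pos by (auto simp: env_def p_def[symmetric] intro!: Q)
      qed
    qed (use R3 w1 p in auto)
    have test: "wp b ws (While 15 6 (count_code ;; advance_code)) (wp b ws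
        (Ins (Move 22 2) ;; Ins (Move 13 2) ;; Ins (Move 15 2) ;; ?loop2) Q)
      (R1(47 := M1 4 p, 48 := M1 5 p, 14 := 0, 15 := 0)) M1 (t1 + 4)"
    proof (rule test_loop_wp[where p = p])
      fix R2 t2
      assume A2: "agree_off {14, 15, 16, 17, 18, 20, 21} R2 (R1(47 := M1 4 p, 48 := M1 5 p, 14 := 0, 15 := 0))"
        "R2 14 = extra {i. v p \<le> v i} 0 (chain M1 ((R1(47 := M1 4 p, 48 := M1 5 p, 14 := 0, 15 := 0)) 6))"
        "t2 \<le> t1 + 4 + 2 + 25 * (R1(47 := M1 4 p, 48 := M1 5 p, 14 := 0, 15 := 0)) 6"
      have "R1 6 = ?s" using A1(1) by simp
      then have "wp b ws ?loop2 Q (R2(22 := 0, 13 := 0, 15 := 0)) M1 (t2 + 3)"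
        using A2 by (intro red) (auto simp: cs1)
      from wp_cong_state[OF this]
      show "wp b ws (Ins (Move 22 2) ;; Ins (Move 13 2) ;; Ins (Move 15 2) ;; ?loop2) Q R2 M1 t2"
        using A2(1) e1 by (simp add: env_def del: wp_Seq add: wp_Seq[of _ _ "Ins _"])
    qed (use A1 w1 e1 p sn wf ids in \<open>auto simp: cs1 env_def\<close>)
    from wp_cong_state[OF test]
    show "wp b ws (Ins (Load 47 4 8) ;; Ins (Load 48 5 8) ;; Ins (Move 14 2) ;; Ins (Move 15 2) ;;
       While 15 6 (count_code ;; advance_code) ;; Ins (Move 22 2) ;; Ins (Move 13 2) ;; Ins (Move 15 2) ;; ?loop2) Q R1 M1 t1"
      using e1 by (simp add: env_def p_def del: wp_Seq add: wp_Seq[of _ _ "Ins _"] wp_Seq[of _ _ "While _ _ _"])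
  qed (use assms sn pos ids in auto)
qed

lemma search_wp:
  assumes "env R" "weights_in M" and inv: "search_inv ws B C (chain M (R 6)) (R 7)" and B: "B < kraft ws UNIV"
    and Q: "\<And>R' M' t'. env R' \<Longrightarrow> agree_off {9, 10, 11, 12, 13} M' M \<Longrightarrow>
      R' 7 < n \<Longrightarrow> kraft ws {i. v (R' 7) < v i} \<le> B \<Longrightarrow> B < kraft ws {i. v (R' 7) \<le> v i} \<Longrightarrow>
      t' \<le> t + 2 + 200000 * R 6 \<Longrightarrow> Q R' M' t'"
  shows "wp b ws search_code Q R M t"
  unfolding search_code_def
proof -
  let ?I = "\<lambda>R' M' t'. env R' \<and> agree_off {9, 10, 11, 12, 13} M' M \<and>
    (\<exists>C. search_inv ws B C (chain M' (R' 6)) (R' 7)) \<and> t' + 200000 * R' 6 \<le> t + 200000 * R 6"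
  show "wp b ws (While 2 6 round_code) Q R M t"
  proof (rule wp_While[where I = ?I and T = "t + 200000 * R 6"])
    show "?I R M t" using assms by blast
  next
    fix R' M' t' assume I: "?I R' M' t'" and lt: "R' 2 < R' 6"
    then obtain C where C: "search_inv ws B C (chain M' (R' 6)) (R' 7)" by blast
    have e: "env R'" "weights_in M'" "0 < R' 6" using I lt assms(2) by (auto simp: weights_in_def env_def)
    show "wp b ws round_code ?I R' M' (t' + 2)"
    proof (rule round_wp[OF e(1,2) C e(3)])
      fix R2 M2 t2 C2
      assume "env R2" "agree_off {9, 10, 11, 12, 13} M2 M'" "search_inv ws B C2 (chain M2 (R2 6)) (R2 7)"
        "80 * R2 6 \<le> 79 * R' 6" "t2 \<le> t' + 2 + 2200 * R' 6"
      moreover from this have "t2 + 200000 * R2 6 \<le> t + 200000 * R 6" using I e(3) by linarith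
      ultimately show "?I R2 M2 t2" using I by auto
    qed
  next
    fix R' M' t' assume I: "?I R' M' t'" and "\<not> R' 2 < R' 6"
    then have "R' 6 = 0" by (auto simp: env_def)
    with I obtain C where "search_inv ws B C [] (R' 7)" by auto
    note search_inv_end[OF this B]
    with I show "Q R' M' (t' + 2)" by (intro Q) auto
  qed auto
qed

end

section \<open>Building the tree\<close>

text \<open>Leaf \<open>i\<close> may have depth \<open>rank ws p i + h\<close> in a tree of weight \<open>val ws p + 1 + h\<close>.\<close>

definition rank :: "real list \<Rightarrow> nat \<Rightarrow> nat \<Rightarrow> nat" where
  "rank ws p i = dep ws i + of_bool (val ws i \<le> val ws p)"

lemma rank_le: "i < length ws \<Longrightarrow> rank ws p i \<le> length ws"
  using dep_le[of i ws] unfolding rank_def by (cases "val ws i \<le> val ws p") auto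

lemma weight_le:
  assumes "i < length ws" "p < length ws"
  shows "ws ! i \<le> val ws p + 1 - real (rank ws p i)"
proof -
  have "ws ! i \<le> val ws i - real (dep ws i)" using val_minus_dep[OF assms(1)] by simp
  moreover have "val ws i \<le> top_weight ws" "top_weight ws - 1 < val ws p"
    using val_le[OF assms(1)] val_gt[OF assms(2)] by auto
  ultimately show ?thesis unfolding rank_def by (cases "val ws i \<le> val ws p") auto
qed

definition node_count :: "real list \<Rightarrow> nat \<Rightarrow> nat \<Rightarrow> nat" where
  "node_count ws p l = cdiv (\<Sum>i | i < length ws \<and> l \<le> rank ws p i. 2 ^ (length ws - rank ws p i))
     (2 ^ (length ws - l))"

lemma cdiv_add_mult: "0 < g \<Longrightarrow> cdiv (a + c * g) g = cdiv a g + c"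
proof -
  assume g: "0 < g"
  have "a + c * g + (g - 1) = a + (g - 1) + c * g" by linarith
  then show ?thesis unfolding cdiv_def using div_mult_self1[of g "a + (g - 1)" c] g by simp
qed

lemma rank_split:
  "{i. i < n \<and> l \<le> rank ws p i} = {i. i < n \<and> Suc l \<le> rank ws p i} \<union> set (members (rank ws p) l n)"
  "{i. i < n \<and> Suc l \<le> rank ws p i} \<inter> set (members (rank ws p) l n) = {}"
  by (auto simp: set_members)

lemma sum_rank_split:
  "(\<Sum>i | i < length ws \<and> l \<le> rank ws p i. 2 ^ (length ws - rank ws p i)) =
   (\<Sum>i | i < length ws \<and> Suc l \<le> rank ws p i. 2 ^ (length ws - rank ws p i)) +
     length (members (rank ws p) l (length ws)) * (2 ^ (length ws - l) :: nat)"
proof -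
  let ?n = "length ws"
  let ?f = "\<lambda>i. 2 ^ (?n - rank ws p i) :: nat"
  have "sum ?f (set (members (rank ws p) l ?n)) = (\<Sum>i\<in>set (members (rank ws p) l ?n). 2 ^ (?n - l))"
    by (rule sum.cong) (auto simp: set_members)
  also have "\<dots> = length (members (rank ws p) l ?n) * 2 ^ (?n - l)"
    by (simp add: distinct_card distinct_members)
  finally show ?thesis
    by (subst rank_split(1), subst sum.union_disjoint) (auto simp: rank_split(2))
qed

lemma node_count_top: "node_count ws p (length ws) = length (members (rank ws p) (length ws) (length ws))"
proof -
  have "\<not> Suc (length ws) \<le> rank ws p i" if "i < length ws" for i using rank_le[OF that, of p] by simp
  then have "{i. i < length ws \<and> Suc (length ws) \<le> rank ws p i} = {}" by blast
  then show ?thesis unfolding node_count_def sum_rank_split[where l = "length ws"] by simp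
qed

lemma node_count_step:
  assumes "l < length ws"
  shows "node_count ws p l = cdiv (node_count ws p (Suc l)) 2 + length (members (rank ws p) l (length ws))"
proof -
  have e: "(2::nat) ^ (length ws - l) = 2 ^ (length ws - Suc l) * 2"
    using assms by (simp add: Suc_diff_Suc flip: power_Suc2)
  have "cdiv S (2 ^ (length ws - l)) = cdiv (cdiv S (2 ^ (length ws - Suc l))) 2" for S
    using cdiv_cdiv_add[of "2 ^ (length ws - Suc l)" 2 S 0] by (simp add: e)
  then show ?thesis
    unfolding node_count_def sum_rank_split[where l = l] by (subst cdiv_add_mult) auto
qed

lemma node_count_0: "node_count ws p 0 = cdiv (kraft ws {i. val ws p < val ws i}) (2 ^ length ws)"
proof -
  have "(\<Sum>i<length ws. 2 ^ (length ws - rank ws p i)) = kraft ws {i. val ws p < val ws i}"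
    unfolding kraft_def
  proof (rule sum.cong)
    fix i assume "i \<in> {..<length ws}"
    then have d: "dep ws i \<le> length ws - 1" "0 < length ws" using dep_le[of i ws] by auto
    show "(2::nat) ^ (length ws - rank ws p i) =
      (1 + of_bool (i \<in> {i. val ws p < val ws i})) * 2 ^ (length ws - 1 - dep ws i)"
    proof (cases "val ws p < val ws i")
      case True
      have "length ws - dep ws i = Suc (length ws - 1 - dep ws i)" using d by linarith
      with True show ?thesis by (simp add: rank_def)
    qed (simp add: rank_def)
  qed simp
  then show ?thesis by (simp add: node_count_def lessThan_def)
qed

fun pair_up :: "nat btree list \<Rightarrow> nat btree list" where
  "pair_up (t # u # ts) = Binary t u # pair_up ts"
| "pair_up ts = ts"

lemma length_pair_up: "length (pair_up ts) = length ts - length ts div 2"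
  by (induction ts rule: pair_up.induct) auto

lemma leaves_pair_up: "sum_list (map leaves (pair_up ts)) = sum_list (map leaves ts)"
  by (induction ts rule: pair_up.induct) (auto simp: ac_simps)

lemma nth_pair_up: "2 * k + 1 < length ts \<Longrightarrow> pair_up ts ! k = Binary (ts ! (2 * k)) (ts ! (2 * k + 1))"
proof (induction ts arbitrary: k rule: pair_up.induct)
  case (1 t u ts)
  then show ?case by (cases k) auto
qed auto

lemma nth_pair_up_odd: "odd (length ts) \<Longrightarrow> pair_up ts ! (length ts div 2) = ts ! (2 * (length ts div 2))"
  by (induction ts rule: pair_up.induct) (auto simp: nth_Cons')

definition weight :: "real list \<Rightarrow> nat btree \<Rightarrow> real" where
  "weight ws t = root_weight (map_btree ((!) ws) t)"

lemma weight_simps [simp]: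
  "weight ws (Leaf i) = ws ! i"
  "weight ws (Binary t u) = max (weight ws t) (weight ws u) + 1"
  by (simp_all add: weight_def)

lemma weight_pair_up: "\<forall>t\<in>set ts. weight ws t \<le> z \<Longrightarrow> \<forall>t\<in>set (pair_up ts). weight ws t \<le> z + 1"
  by (induction ts rule: pair_up.induct) auto

lemma leaves_map_btree: "leaves (map_btree f t) = image_mset f (leaves t)"
  by (induction t) auto

inductive built :: "memory \<Rightarrow> nat \<Rightarrow> nat \<Rightarrow> nat \<Rightarrow> nat btree \<Rightarrow> bool" for m c where
  "built m c 1 i (Leaf i)"
| "u < c \<Longrightarrow> built m c (m 0 u) (m 1 u) l \<Longrightarrow> built m c (m 2 u) (m 3 u) r \<Longrightarrow> built m c 2 u (Binary l r)"

lemma built_tree_at: "built m c k i t \<Longrightarrow> tree_at m k i t"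
  by (induction rule: built.induct) (auto intro: tree_at.intros simp del: One_nat_def)

lemma built_mono:
  assumes "built m c k i t" "c \<le> c'" "\<And>a. a < c \<Longrightarrow> m' 0 a = m 0 a \<and> m' 1 a = m 1 a \<and> m' 2 a = m 2 a \<and> m' 3 a = m 3 a"
  shows "built m' c' k i t"
  using assms(1)
proof (induction rule: built.induct)
  case (2 u l r)
  then show ?case using assms(2,3) by (intro built.intros(2)) auto
qed (rule built.intros)

definition forest :: "memory \<Rightarrow> nat \<Rightarrow> nat \<Rightarrow> nat btree list \<Rightarrow> bool" where
  "forest M c x ts \<longleftrightarrow> length ts = x \<and> (\<forall>k<x. built M c (M 17 k) (M 18 k) (ts ! k))"

definition rank_code :: com where
  "rank_code =
     Ins (Load 47 4 7) ;; Ins (Load 48 5 7) ;; Ins (Move 15 2) ;;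
     While 15 0
       (Ins (Load 17 4 15) ;; Ins (Load 18 5 15) ;; Ins (Load 19 6 15) ;;
        Cond (WLe 17 18 47 48) (Ins (Op Add 19 19 3)) Skip ;;
        Ins (Store 14 15 19) ;; Ins (Op Add 15 15 3))"

definition add_code :: com where
  "add_code =
     Ins (Load 36 15 35) ;;
     While 2 36
       (Ins (Op Sub 36 36 3) ;; Ins (Store 17 33 3) ;; Ins (Store 18 33 36) ;; Ins (Op Add 33 33 3) ;;
        Ins (Load 36 16 36))"

definition pair_code :: com where
  "pair_code =
     Ins (Op Add 39 38 38) ;; Ins (Load 40 17 39) ;; Ins (Store 0 34 40) ;; Ins (Load 40 18 39) ;;
     Ins (Store 1 34 40) ;; Ins (Op Add 39 39 3) ;; Ins (Load 40 17 39) ;; Ins (Store 2 34 40) ;;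
     Ins (Load 40 18 39) ;; Ins (Store 3 34 40) ;; Ins (Store 17 38 4) ;; Ins (Store 18 38 34) ;;
     Ins (Op Add 34 34 3) ;; Ins (Op Add 38 38 3)"

definition pairs_code :: com where
  "pairs_code =
     Ins (Op Div 37 33 4) ;; Ins (Move 38 2) ;;
     While 38 37 pair_code ;;
     Ins (Op Add 39 37 37) ;;
     Cond (Lt 39 33)
       (Ins (Load 40 17 39) ;; Ins (Store 17 37 40) ;; Ins (Load 40 18 39) ;; Ins (Store 18 37 40))
       Skip ;;
     Ins (Op Sub 33 33 37)"

definition build_code :: com where
  "build_code =
     Ins (Move 33 2) ;; Ins (Move 34 2) ;; Ins (Move 35 0) ;; add_code ;;
     While 2 35 (pairs_code ;; Ins (Op Sub 35 35 3) ;; add_code) ;;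
     While 3 33 pairs_code ;;
     Ins (Load 0 17 2) ;; Ins (Load 1 18 2)"

lemma cong3: "P a b c \<Longrightarrow> a = a' \<Longrightarrow> b = b' \<Longrightarrow> c = c' \<Longrightarrow> P a' b' c'"
  by simp

context ram
begin

lemma rank_wp:
  assumes "env R" "weights_in M" "R 7 = p" "p < n"
    and Q: "\<And>R' M' t'. env R' \<Longrightarrow> (\<forall>m. m \<noteq> 14 \<longrightarrow> M' m = M m) \<Longrightarrow> (\<forall>i<n. M' 14 i = rank ws p i) \<Longrightarrow>
      t' \<le> t + 5 + 12 * n \<Longrightarrow> Q R' M' t'"
  shows "wp b ws rank_code Q R M t"
proof -
  let ?I = "\<lambda>R' M' t'. env R' \<and> R' 47 = M 4 p \<and> R' 48 = M 5 p \<and> R' 15 \<le> n \<and>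
    (\<forall>m. m \<noteq> 14 \<longrightarrow> M' m = M m) \<and> (\<forall>i<R' 15. M' 14 i = rank ws p i) \<and> t' \<le> t + 3 + 12 * R' 15"
  let ?body = "Ins (Load 17 4 15) ;; Ins (Load 18 5 15) ;; Ins (Load 19 6 15) ;;
        Cond (WLe 17 18 47 48) (Ins (Op Add 19 19 3)) Skip ;;
        Ins (Store 14 15 19) ;; Ins (Op Add 15 15 3)"
  have W: "M 4 x < n" "ws ! M 4 x + real (M 5 x) = v x" "M 6 x = dep ws x" if "x < n" for x
    using assms(2) that by (auto simp: weights_in_def)
  have "wp b ws (While 15 0 ?body) Q (R(47 := M 4 p, 48 := M 5 p, 15 := 0)) M (t + 3)"
  proof (rule wp_While[where I = ?I and T = "t + 3 + 12 * n"])
    show "?I (R(47 := M 4 p, 48 := M 5 p, 15 := 0)) M (t + 3)" using assms by (simp add: env_def)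
  next
    fix R' M' t' assume I: "?I R' M' t'" and "R' 15 < R' 0"
    then have i: "R' 15 < n" by (simp add: env_def)
    have "Suc (dep ws (R' 15)) \<le> n" using dep_le[OF i] i by linarith
    then show "wp b ws ?body ?I R' M' (t' + 2)"
      using I i W[OF i] W[OF assms(4)]
      by (auto simp: env_def wp_Cond word_ops less_Suc_eq rank_def)
  next
    fix R' M' t' assume I: "?I R' M' t'" and "\<not> R' 15 < R' 0"
    then show "Q R' M' (t' + 2)" by (intro Q) (auto simp: env_def)
  qed auto
  from wp_cong_state[OF this] show ?thesis
    using assms(1,3) by (simp add: rank_code_def env_def)
qed

lemma add_wp:
  assumes "env R" "linked (M 16) (M 15 (R 35)) ms" "set ms \<subseteq> {..<n}" "forest M c (R 33) ts"
    and "R 33 + length ms \<le> n"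
    and Q: "\<And>R' M' t'. agree_off {33, 36} R' R \<Longrightarrow> R' 33 = R 33 + length ms \<Longrightarrow>
      forest M' c (R' 33) (ts @ map Leaf ms) \<Longrightarrow> agree_off {17, 18} M' M \<Longrightarrow>
      t' \<le> t + 3 + 7 * length ms \<Longrightarrow> Q R' M' t'"
  shows "wp b ws add_code Q R M t"
proof -
  let ?I = "\<lambda>R' M' t'. \<exists>done rest. ms = done @ rest \<and> linked (M 16) (R' 36) rest \<and>
    agree_off {33, 36} R' R \<and> R' 33 = R 33 + length done \<and>
    forest M' c (R' 33) (ts @ map Leaf done) \<and>
    agree_off {17, 18} M' M \<and> t' \<le> t + 1 + 7 * length done"
  let ?body = "Ins (Op Sub 36 36 3) ;; Ins (Store 17 33 3) ;; Ins (Store 18 33 36) ;; Ins (Op Add 33 33 3) ;;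
        Ins (Load 36 16 36)"
  have "wp b ws (While 2 36 ?body) Q (R(36 := M 15 (R 35))) M (t + 1)"
  proof (rule wp_While[where I = ?I and T = "t + 1 + 7 * length ms"])
    show "?I (R(36 := M 15 (R 35))) M (t + 1)"
      using assms by (intro exI[of _ "[]"] exI[of _ ms]) auto
  next
    fix R' M' t' assume "?I R' M' t'" and pos: "R' 2 < R' 36"
    then obtain d rest where I: "ms = d @ rest" "linked (M 16) (R' 36) rest"
      "agree_off {33, 36} R' R" "R' 33 = R 33 + length d"
      "forest M' c (R' 33) (ts @ map Leaf d)"
      "agree_off {17, 18} M' M" "t' \<le> t + 1 + 7 * length d" by blast
    obtain i rest' where r: "rest = i # rest'"
      using I(2) pos by (cases rest) auto
    have i: "i < n" using assms(3) by (simp add: I(1) r)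
    have h: "R' 36 = Suc i" "linked (M 16) (M 16 i) rest'" using I(2) r by auto
    have e: "R' 2 = 0" "R' 3 = 1" using assms(1) I(3) by (auto simp: env_def)
    have len: "R 33 + length d < n" using assms(5) by (auto simp: I(1) r)
    let ?x = "R' 33"
    let ?M = "M'(17 := (M' 17)(?x := 1), 18 := (M' 18)(?x := i))"
    have lts: "length (ts @ map Leaf d) = ?x" using I(5) by (simp add: forest_def)
    have snoc: "ts @ map Leaf (d @ [i]) = (ts @ map Leaf d) @ [Leaf i]" by simp
    have f: "forest ?M c (Suc ?x) (ts @ map Leaf (d @ [i]))"
      unfolding forest_def
    proof (intro conjI allI impI)
      show "length (ts @ map Leaf (d @ [i])) = Suc ?x" using lts by simp
      fix k assume k: "k < Suc ?x"
      show "built ?M c (?M 17 k) (?M 18 k) ((ts @ map Leaf (d @ [i])) ! k)"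
      proof (cases "k = ?x")
        case True
        have "(ts @ map Leaf (d @ [i])) ! k = Leaf i"
          by (simp only: snoc True lts[symmetric] nth_append_length)
        then show ?thesis using True built.intros(1)[of ?M c i] by simp
      next
        case False
        then have "k < ?x" using k by simp
        then have "built M' c (M' 17 k) (M' 18 k) ((ts @ map Leaf d) ! k)"
          using I(5) by (simp add: forest_def)
        from built_mono[OF this order.refl, of ?M]
        have "built ?M c (M' 17 k) (M' 18 k) ((ts @ map Leaf d) ! k)" by simp
        moreover have "(ts @ map Leaf (d @ [i])) ! k = (ts @ map Leaf d) ! k"
          unfolding snoc using \<open>k < ?x\<close> lts by (subst nth_append) simp
        ultimately show ?thesis using False by simp
      qed
    qed
    let ?R = "R'(36 := M 16 i, 33 := Suc ?x)"
    have "?I ?R ?M (Suc (Suc (Suc (Suc (Suc (Suc (Suc t')))))))"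
      using I h f by (intro exI[of _ "d @ [i]"] exI[of _ rest']) (auto simp: r)
    moreover have "R'(36 := i, 33 := Suc ?x, 36 := M 16 i) = ?R" by auto
    ultimately show "wp b ws ?body ?I R' M' (t' + 2)"
      using I(6) by (simp add: word_ops e h len I(4) i Suc_leI)
  next
    fix R' M' t' assume I: "?I R' M' t'" and "\<not> R' 2 < R' 36"
    then show "Q R' M' (t' + 2)"
      using assms(1) by (auto simp: env_def linked_pos intro!: Q)
  qed (use assms in auto)
  from wp_cong_state[OF this] show ?thesis by (simp add: add_code_def)
qed

lemma pairs_wp:
  assumes "env R" "forest M (R 34) (R 33) ts" "R 34 + R 33 \<le> n"
    and Q: "\<And>R' M' t'. agree_off {33, 34, 37, 38, 39, 40} R' R \<Longrightarrow> R' 33 = R 33 - R 33 div 2 \<Longrightarrow>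
      R' 34 = R 34 + R 33 div 2 \<Longrightarrow> forest M' (R' 34) (R' 33) (pair_up ts) \<Longrightarrow>
      agree_off {0, 1, 2, 3, 17, 18} M' M \<Longrightarrow> t' \<le> t + 20 + 20 * (R 33 div 2) \<Longrightarrow> Q R' M' t'"
  shows "wp b ws pairs_code Q R M t"
proof -
  define x c H where "x = R 33" and "c = R 34" and "H = R 33 div 2"
  have H: "2 * H \<le> x" "x \<le> 2 * H + 1" "c + H \<le> n" "x \<le> n" using assms(3) unfolding x_def c_def H_def by linarith+
  have ts: "length ts = x" "built M c (M 17 k) (M 18 k) (ts ! k)" if "k < x" for k
    using assms(2) that by (auto simp: forest_def x_def c_def)
  have lts: "length ts = x" using assms(2) by (simp add: forest_def x_def)
  have lp: "length (pair_up ts) = x - H" by (simp add: length_pair_up lts H_def x_def)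
  let ?I = "\<lambda>R' M' t'. agree_off {33, 34, 37, 38, 39, 40} R' R \<and> R' 33 = x \<and> R' 37 = H \<and> R' 38 \<le> H \<and>
    R' 34 = c + R' 38 \<and> (\<forall>j<R' 38. built M' (R' 34) (M' 17 j) (M' 18 j) (pair_up ts ! j)) \<and>
    (\<forall>j\<ge>R' 38. M' 17 j = M 17 j \<and> M' 18 j = M 18 j) \<and> (\<forall>m a. m < 4 \<and> a < c \<longrightarrow> M' m a = M m a) \<and>
    agree_off {0, 1, 2, 3, 17, 18} M' M \<and> t' \<le> t + 2 + 20 * R' 38"
  let ?odd = "Cond (Lt 39 33)
       (Ins (Load 40 17 39) ;; Ins (Store 17 37 40) ;; Ins (Load 40 18 39) ;; Ins (Store 18 37 40))
       Skip ;; Ins (Op Sub 33 33 37)"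
  have "wp b ws (While 38 37 pair_code) (wp b ws (Ins (Op Add 39 37 37) ;; ?odd) Q) (R(37 := H, 38 := 0)) M (t + 2)"
  proof (rule wp_While[where I = ?I and T = "t + 2 + 20 * H"])
    show "?I (R(37 := H, 38 := 0)) M (t + 2)" by (auto simp: x_def c_def)
  next
    fix R' M' t' assume I: "?I R' M' t'" and lt: "R' 38 < R' 37"
    define k where "k = R' 38"
    have k: "k < H" "R' 34 = c + k" "R' 38 = k" using I lt by (auto simp: k_def)
    have e: "R' 3 = 1" "R' 4 = 2" using I assms(1) by (auto simp: env_def)
    have w: "k + k + 1 < x" "k + k \<le> n" "k + k + 1 \<le> n" "Suc (c + k) \<le> n" "Suc k \<le> n" using k H by linarith+
    have add: "eval_binop b Add (k + k) (Suc 0) = Suc (k + k)"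
      using word_Add[OF wlt[OF w(3)]] by simp
    have ld: "M' 17 j = M 17 j" "M' 18 j = M 18 j" if "k \<le> j" for j using I that by (auto simp: k_def)
    let ?M = "M'(0 := (M' 0)(c + k := M 17 (k + k)), 1 := (M' 1)(c + k := M 18 (k + k)),
      2 := (M' 2)(c + k := M 17 (Suc (k + k))), 3 := (M' 3)(c + k := M 18 (Suc (k + k))),
      17 := (M' 17)(k := 2), 18 := (M' 18)(k := c + k))"
    have old: "?M m a = M m a" if "m < 4" "a < c" for m a
    proof -
      have "M' m a = M m a" using I that by blast
      moreover have "a \<noteq> c + k" "m \<noteq> 17" "m \<noteq> 18" using that by auto
      ultimately show ?thesis by auto
    qed
    have "built ?M (Suc (c + k)) (M 17 j) (M 18 j) (ts ! j)" if "j < x" for j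
      by (rule built_mono[OF ts(2)[OF that]]) (simp, intro conjI old, simp_all)
    then have new: "built ?M (Suc (c + k)) 2 (c + k) (Binary (ts ! (2 * k)) (ts ! (2 * k + 1)))"
      using w(1) by (intro built.intros(2)) (auto simp: mult_2)
    have b: "built ?M (Suc (c + k)) (?M 17 j) (?M 18 j) (pair_up ts ! j)" if j: "j < Suc k" for j
    proof (cases "j = k")
      case True
      then show ?thesis using new nth_pair_up[of k ts] w(1) lts by (simp add: mult_2)
    next
      case False
      then have "built M' (c + k) (M' 17 j) (M' 18 j) (pair_up ts ! j)" using I j k by auto
      then have "built ?M (Suc (c + k)) (M' 17 j) (M' 18 j) (pair_up ts ! j)"
        by (rule built_mono) auto
      then show ?thesis using False by simp
    qed
    let ?R = "R'(39 := Suc (k + k), 40 := M 18 (Suc (k + k)), 34 := Suc (c + k), 38 := Suc k)"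
    have fin: "?I ?R ?M t2" if "t2 \<le> t + 2 + 20 * Suc k" for t2
      using I b k old that ld by auto
    have run: "wp b ws pair_code P R' M' (t' + 2)" if "P ?R ?M (t' + 16)" for P
      unfolding pair_code_def
      apply (simp add: add word_ops e k w ld del: fun_upd_apply)
      apply (simp add: add word_ops e k w ld)
      apply (rule cong3[of P, OF that])
        apply (simp_all add: fun_eq_iff)
      done
    show "wp b ws pair_code ?I R' M' (t' + 2)" by (rule run, rule fin) (use I in \<open>simp add: k_def\<close>)
  next
    fix R' M' t' assume I: "?I R' M' t'" and "\<not> R' 38 < R' 37"
    then have k: "R' 38 = H" by auto
    have e: "R' 3 = 1" "R' 4 = 2" using I assms(1) by (auto simp: env_def)
    show "wp b ws (Ins (Op Add 39 37 37) ;; ?odd) Q R' M' (t' + 2)"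
    proof (cases "H + H < x")
      case True
      then have x: "x = 2 * H + 1" using H by linarith
      let ?M = "M'(17 := (M' 17)(H := M 17 (H + H)), 18 := (M' 18)(H := M 18 (H + H)))"
      have "built ?M (c + H) (?M 17 j) (?M 18 j) (pair_up ts ! j)" if "j < x - H" for j
      proof (cases "j = H")
        case True
        have "odd (length ts)" "length ts div 2 = H" using x lts by auto
        then have "pair_up ts ! H = ts ! (H + H)" using nth_pair_up_odd[of ts] by (simp add: mult_2)
        moreover have "built ?M (c + H) (M 17 (H + H)) (M 18 (H + H)) (ts ! (H + H))"
          by (rule built_mono[OF ts(2)]) (use x I in auto)
        ultimately show ?thesis using True by simp
      next
        case False
        then have "j < H" using that x by simp
        then have "built M' (c + H) (M' 17 j) (M' 18 j) (pair_up ts ! j)" using I k by auto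
        then have "built ?M (c + H) (M' 17 j) (M' 18 j) (pair_up ts ! j)" by (rule built_mono) auto
        then show ?thesis using False by simp
      qed
      then have f: "forest ?M (c + H) (x - H) (pair_up ts)" using lp by (simp add: forest_def)
      have "M' 17 (H + H) = M 17 (H + H)" "M' 18 (H + H) = M 18 (H + H)" using I k by auto
      note ld = this
      let ?R = "R'(39 := H + H, 40 := M 18 (H + H), 33 := x - H)"
      have q: "Q ?R ?M (t' + 9)"
      proof (rule Q)
        show "agree_off {33, 34, 37, 38, 39, 40} ?R R" using I by simp
        show "?R 33 = R 33 - R 33 div 2" by (simp add: x_def H_def)
        show "?R 34 = R 34 + R 33 div 2" using I k by (simp add: c_def H_def)
        show "forest ?M (?R 34) (?R 33) (pair_up ts)" using f I k by simp
        show "agree_off {0, 1, 2, 3, 17, 18} ?M M" using I by simp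
        show "t' + 9 \<le> t + 20 + 20 * (R 33 div 2)" using I k by (simp add: H_def)
      qed
      have r: "R' 33 = x" "R' 37 = H" using I by auto
      have "H \<le> x" "H + H \<le> n" using H by linarith+
      then show ?thesis
        apply (simp add: word_ops r True H ld)
        apply (rule cong3[of Q, OF q])
          apply (simp_all add: fun_eq_iff)
        done
    next
      case False
      then have x: "x = 2 * H" using H by linarith
      have "forest M' (c + H) (x - H) (pair_up ts)" using lp I k x by (auto simp: forest_def)
      note f = this
      let ?R = "R'(39 := H + H, 33 := x - H)"
      have q: "Q ?R M' (t' + 6)"
      proof (rule Q)
        show "agree_off {33, 34, 37, 38, 39, 40} ?R R" using I by simp
        show "?R 33 = R 33 - R 33 div 2" by (simp add: x_def H_def)
        show "?R 34 = R 34 + R 33 div 2" using I k by (simp add: c_def H_def)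
        show "forest M' (?R 34) (?R 33) (pair_up ts)" using f I k by simp
        show "agree_off {0, 1, 2, 3, 17, 18} M' M" using I by blast
        show "t' + 6 \<le> t + 20 + 20 * (R 33 div 2)" using I k by (simp add: H_def)
      qed
      have r: "R' 33 = x" "R' 37 = H" using I by auto
      have "H \<le> x" "H + H \<le> n" using H by linarith+
      then show ?thesis
        apply (simp add: word_ops r False H)
        apply (rule cong3[of Q, OF q])
          apply (simp_all add: fun_eq_iff)
        done
    qed
  qed auto
  from wp_cong_state[OF this] show ?thesis
    using assms(1) by (simp add: pairs_code_def env_def H_def)
qed

end

section \<open>The complete program\<close>

definition main_code :: com where
  "main_code =
     find_top ;; split_weights ;; bucket 6 7 8 ;; chain_code ;; search_code ;; rank_code ;;
     bucket 14 15 16 ;; build_code"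

definition minimax_code :: com where
  "minimax_code = Ins (Const 3 1) ;; Cond (Lt 3 0) main_code (Ins (Const 0 1))"

context ram
begin

definition level :: "memory \<Rightarrow> nat \<Rightarrow> nat \<Rightarrow> nat set \<Rightarrow> real \<Rightarrow> bool" where
  "level M c x A z \<longleftrightarrow> (\<exists>ts. forest M c x ts \<and> sum_list (map leaves ts) = mset_set A \<and>
     (\<forall>t\<in>set ts. weight ws t \<le> z) \<and> c + x = card A)"

lemma pairs_level_wp:
  assumes "env R" "level M (R 34) (R 33) A z" "A \<subseteq> {..<n}"
    and Q: "\<And>R' M' t'. agree_off {33, 34, 37, 38, 39, 40} R' R \<Longrightarrow> R' 33 = cdiv (R 33) 2 \<Longrightarrow>
      R' 34 = R 34 + R 33 div 2 \<Longrightarrow> level M' (R' 34) (R' 33) A (z + 1) \<Longrightarrow>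
      agree_off {0, 1, 2, 3, 17, 18} M' M \<Longrightarrow> t' \<le> t + 20 + 20 * (R 33 div 2) \<Longrightarrow> Q R' M' t'"
  shows "wp b ws pairs_code Q R M t"
proof -
  from assms(2) obtain ts where ts: "forest M (R 34) (R 33) ts" "sum_list (map leaves ts) = mset_set A"
    "\<forall>t\<in>set ts. weight ws t \<le> z" "R 34 + R 33 = card A" by (auto simp: level_def)
  have "card A \<le> n" using card_mono[OF _ assms(3)] by simp
  show ?thesis
  proof (rule pairs_wp[OF assms(1) ts(1)])
    show "R 34 + R 33 \<le> n" using \<open>card A \<le> n\<close> ts(4) by simp
    fix R' M' t'
    assume P: "agree_off {33, 34, 37, 38, 39, 40} R' R" "R' 33 = R 33 - R 33 div 2"
      "R' 34 = R 34 + R 33 div 2" "forest M' (R' 34) (R' 33) (pair_up ts)"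
      "agree_off {0, 1, 2, 3, 17, 18} M' M" "t' \<le> t + 20 + 20 * (R 33 div 2)"
    have "R' 34 + R' 33 = card A" using P(2,3) ts(4) by simp
    then have "level M' (R' 34) (R' 33) A (z + 1)"
      unfolding level_def using P(4) leaves_pair_up[of ts] ts(2) weight_pair_up[OF ts(3)] by auto
    then show "Q R' M' t'" using P by (intro Q) (auto simp: cdiv_2)
  qed
qed

lemma add_level_wp:
  assumes "env R" "linked (M 16) (M 15 (R 35)) (members (rank ws p) (R 35) n)" "p < n"
    and lv: "level M (R 34) (R 33) {i. i < n \<and> Suc (R 35) \<le> rank ws p i} (v p + 1 - real (R 35))"
    and Q: "\<And>R' M' t'. agree_off {33, 36} R' R \<Longrightarrow>
      R' 33 = R 33 + length (members (rank ws p) (R 35) n) \<Longrightarrow>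
      level M' (R' 34) (R' 33) {i. i < n \<and> R 35 \<le> rank ws p i} (v p + 1 - real (R 35)) \<Longrightarrow>
      agree_off {17, 18} M' M \<Longrightarrow>
      t' \<le> t + 3 + 7 * length (members (rank ws p) (R 35) n) \<Longrightarrow> Q R' M' t'"
  shows "wp b ws add_code Q R M t"
proof -
  define l ms A B where "l = R 35" and "ms = members (rank ws p) l n"
    and "A = {i. i < n \<and> Suc l \<le> rank ws p i}" and "B = {i. i < n \<and> l \<le> rank ws p i}"
  have AB: "B = A \<union> set ms" "A \<inter> set ms = {}" "finite A" "B \<subseteq> {..<n}"
    using rank_split[of n l ws p] by (auto simp: A_def B_def ms_def)
  from lv obtain ts where ts: "forest M (R 34) (R 33) ts" "sum_list (map leaves ts) = mset_set A"
    "\<forall>t\<in>set ts. weight ws t \<le> v p + 1 - real l" "R 34 + R 33 = card A"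
    unfolding level_def l_def[symmetric] A_def[symmetric] by blast
  have dist: "distinct ms" by (simp add: ms_def distinct_members)
  have cB: "card B = card A + length ms"
    unfolding AB(1) using AB(2,3) dist by (simp add: card_Un_disjoint distinct_card)
  have cn: "card B \<le> n" using card_mono[OF _ AB(4)] by simp
  show ?thesis
  proof (rule add_wp[OF assms(1) assms(2) _ ts(1)])
    show "set (members (rank ws p) (R 35) n) \<subseteq> {..<n}" by (auto simp: set_members)
    show "R 33 + length (members (rank ws p) (R 35) n) \<le> n"
      using cB cn ts(4) by (simp add: ms_def l_def)
    fix R' M' t'
    assume P: "agree_off {33, 36} R' R" "R' 33 = R 33 + length (members (rank ws p) (R 35) n)"
      "forest M' (R 34) (R' 33) (ts @ map Leaf (members (rank ws p) (R 35) n))"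
      "agree_off {17, 18} M' M" "t' \<le> t + 3 + 7 * length (members (rank ws p) (R 35) n)"
    have "sum_list (map leaves (map Leaf ms)) = mset ms" by (induction ms) auto
    then have "sum_list (map leaves (ts @ map Leaf ms)) = mset_set B"
      using ts(2) AB dist by (simp add: mset_set_Union mset_set_set)
    moreover have "weight ws t \<le> v p + 1 - real l" if "t \<in> set (ts @ map Leaf ms)" for t
      using that ts(3) weight_le[OF _ assms(3)] by (auto simp: ms_def set_members)
    moreover have "R' 34 + R' 33 = card B" using P(1,2) ts(4) cB by (simp add: ms_def l_def)
    ultimately have "level M' (R' 34) (R' 33) B (v p + 1 - real l)"
      unfolding level_def using P(1,3) by (intro exI[of _ "ts @ map Leaf ms"]) (auto simp: ms_def l_def)
    then show "Q R' M' t'" using P by (intro Q) (auto simp: B_def l_def)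
  qed
qed

lemma build_wp:
  assumes "env R" "\<forall>l. linked (M 16) (M 15 l) (members (rank ws p) l n)" "p < n"
    and B: "kraft ws {i. v p < v i} \<le> 2 ^ (n + h)"
    and Q: "\<And>R' M' t' u c. built M' c (R' 0) (R' 1) u \<Longrightarrow> leaves u = mset [0..<n] \<Longrightarrow>
      weight ws u \<le> v p + 1 + real h \<Longrightarrow> t' \<le> t + 50 + 300 * n \<Longrightarrow> Q R' M' t'"
  shows "wp b ws build_code Q R M t"
proof -
  let ?A = "\<lambda>l. {i. i < n \<and> l \<le> rank ws p i}"
  let ?fr = "\<lambda>M'. agree_off {0, 1, 2, 3, 17, 18} M' M"
  let ?I = "\<lambda>R' M' t'. env R' \<and> ?fr M' \<and> R' 35 \<le> n \<and> R' 33 = node_count ws p (R' 35) \<and>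
    level M' (R' 34) (R' 33) (?A (R' 35)) (v p + 1 - real (R' 35)) \<and>
    t' + 60 * R' 35 \<le> t + 20 + 60 * n + 40 * (R' 34 + R' 33) + 60 * R' 34"
  let ?J = "\<lambda>R' M' t'. env R' \<and> (\<exists>k\<le>h. R' 33 = cdiv (node_count ws p 0) (2 ^ k) \<and>
    level M' (R' 34) (R' 33) {..<n} (v p + 1 + real k)) \<and>
    t' \<le> t + 25 + 60 * n + 40 * (R' 34 + R' 33) + 60 * R' 34"
  let ?end = "Ins (Load 0 17 2) ;; Ins (Load 1 18 2)"
  have cardA: "card (?A l) \<le> n" for l using card_mono[of "{..<n}" "?A l"] by auto
  have A0: "?A 0 = {..<n}" by auto
  have final: "wp b ws (While 3 33 pairs_code) (wp b ws ?end Q) R' M' t'" if J: "?J R' M' t'" for R' M' t'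
  proof (rule wp_While[where I = ?J and T = "t + 25 + 160 * n"])
    show "?J R' M' t'" by (rule J)
  next
    fix R' M' t' assume J: "?J R' M' t'"
    then have c: "R' 34 + R' 33 = n" by (auto simp: level_def)
    have "t' \<le> t + 25 + 60 * n + 40 * (R' 34 + R' 33) + 60 * R' 34" using J by blast
    then show "t' \<le> t + 25 + 160 * n" unfolding c using c by linarith
  next
    fix R' M' t' assume J: "?J R' M' t'" and lt: "R' 3 < R' 33"
    then obtain k where k: "k \<le> h" "R' 33 = cdiv (node_count ws p 0) (2 ^ k)"
      "level M' (R' 34) (R' 33) {..<n} (v p + 1 + real k)" by blast
    have x: "2 \<le> R' 33" using J lt by (auto simp: env_def)
    have "k \<noteq> h"
    proof
      assume "k = h"
      have "node_count ws p 0 \<le> 2 ^ h"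
        unfolding node_count_0 using B by (simp add: cdiv_le_iff power_add mult.commute)
      then have "R' 33 \<le> 1" unfolding k(2) \<open>k = h\<close> by (simp add: cdiv_le_iff)
      then show False using x by simp
    qed
    then have kh: "Suc k \<le> h" using k(1) by simp
    show "wp b ws pairs_code ?J R' M' (t' + 2)"
    proof (rule pairs_level_wp[OF _ k(3)])
      show "env R'" using J by blast
      fix R2 M2 t2
      assume P: "agree_off {33, 34, 37, 38, 39, 40} R2 R'" "R2 33 = cdiv (R' 33) 2"
        "R2 34 = R' 34 + R' 33 div 2" "level M2 (R2 34) (R2 33) {..<n} (v p + 1 + real k + 1)"
        "agree_off {0, 1, 2, 3, 17, 18} M2 M'" "t2 \<le> t' + 2 + 20 + 20 * (R' 33 div 2)"
      have "R2 33 = cdiv (node_count ws p 0) (2 ^ Suc k)"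
        using cdiv_cdiv_add[of "2 ^ k" 2 "node_count ws p 0" 0] by (simp add: P(2) k(2) mult.commute)
      moreover have "level M2 (R2 34) (R2 33) {..<n} (v p + 1 + real (Suc k))" using P(4) by (simp add: add_ac)
      moreover have "env R2" using P(1) J by (auto simp: env_def)
      moreover have "t2 \<le> t + 25 + 60 * n + 40 * (R2 34 + R2 33) + 60 * R2 34"
      proof -
        have "R2 34 + R2 33 = R' 34 + R' 33" unfolding P(2,3) cdiv_2 by linarith
        moreover have "1 \<le> R' 33 div 2" using x by linarith
        ultimately show ?thesis using P(3,6) J by simp
      qed
      ultimately show "?J R2 M2 t2" using kh by blast
    qed auto
  next
    fix R' M' t' assume J: "?J R' M' t'" and "\<not> R' 3 < R' 33"
    then have x: "R' 33 \<le> 1" and e: "R' 2 = 0" by (auto simp: env_def)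
    from J obtain k ts where k: "k \<le> h" "forest M' (R' 34) (R' 33) ts" "sum_list (map leaves ts) = mset_set {..<n}"
      "\<forall>u\<in>set ts. weight ws u \<le> v p + 1 + real k" "R' 34 + R' 33 = n" by (auto simp: level_def)
    have "ts \<noteq> []"
    proof
      assume "ts = []"
      then have "mset_set {..<n} = {#}" using k(3) by simp
      then have "{..<n} = {}" by (simp add: mset_set_empty_iff)
      then show False using two_le unfolding lessThan_empty_iff by simp
    qed
    moreover have "length ts \<le> 1" using k(2) x by (simp add: forest_def)
    ultimately obtain u where u: "ts = [u]" by (cases ts) auto
    have "0 < R' 33" using k(2) by (simp add: forest_def u)
    then have "built M' (R' 34) (M' 17 0) (M' 18 0) ([u] ! 0)" using k(2) unfolding forest_def u by blast
    then have "built M' (R' 34) (M' 17 0) (M' 18 0) u" by simp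
    moreover have "leaves u = mset [0..<n]" using k(3) by (simp add: u lessThan_atLeast0)
    moreover have "weight ws u \<le> v p + 1 + real h" using k(1,4) by (simp add: u)
    moreover have "t' + 2 + 2 \<le> t + 50 + 300 * n"
    proof -
      have "t' \<le> t + 25 + 60 * n + 40 * (R' 34 + R' 33) + 60 * R' 34" using J by blast
      then show ?thesis unfolding k(5) using k(5) by linarith
    qed
    ultimately show "wp b ws ?end Q R' M' (t' + 2)" by (simp add: e Q)
  qed
  have loop: "wp b ws (While 2 35 (pairs_code ;; Ins (Op Sub 35 35 3) ;; add_code))
      (wp b ws (While 3 33 pairs_code) (wp b ws ?end Q)) R' M' t'" if I: "?I R' M' t'" for R' M' t'
  proof (rule wp_While[where I = ?I and T = "t + 20 + 160 * n"])
    show "?I R' M' t'" by (rule I)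
  next
    fix R' M' t' assume I: "?I R' M' t'"
    then have c: "R' 34 + R' 33 \<le> n" using cardA[of "R' 35"] by (auto simp: level_def)
    have "t' + 60 * R' 35 \<le> t + 20 + 60 * n + 40 * (R' 34 + R' 33) + 60 * R' 34" using I by blast
    moreover have "40 * (R' 34 + R' 33) \<le> 40 * n" using c by (rule mult_le_mono2)
    ultimately show "t' \<le> t + 20 + 160 * n" using c by linarith
  next
    fix R' M' t' assume I: "?I R' M' t'" and lt: "R' 2 < R' 35"
    then obtain l where l: "R' 35 = Suc l" by (cases "R' 35") (auto simp: env_def)
    then have ln: "l < n" using I by simp
    show "wp b ws (pairs_code ;; Ins (Op Sub 35 35 3) ;; add_code) ?I R' M' (t' + 2)"
      unfolding wp_Seq[of b ws pairs_code]
    proof (rule pairs_level_wp[where A = "?A (Suc l)" and z = "v p + 1 - real (Suc l)"])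
      show "env R'" "level M' (R' 34) (R' 33) (?A (Suc l)) (v p + 1 - real (Suc l))" using I by (auto simp: l)
      fix R2 M2 t2
      assume P: "agree_off {33, 34, 37, 38, 39, 40} R2 R'" "R2 33 = cdiv (R' 33) 2"
        "R2 34 = R' 34 + R' 33 div 2" "level M2 (R2 34) (R2 33) (?A (Suc l)) (v p + 1 - real (Suc l) + 1)"
        "agree_off {0, 1, 2, 3, 17, 18} M2 M'" "t2 \<le> t' + 2 + 20 + 20 * (R' 33 div 2)"
      have e2: "env R2" "R2 35 = Suc l" using P(1) I l by (auto simp: env_def)
      let ?R = "R2(35 := l)"
      have "wp b ws add_code ?I ?R M2 (t2 + 1)"
      proof (rule add_level_wp)
        show "env ?R" using e2 by (simp add: env_def)
        have "M2 16 = M 16" "M2 15 = M 15" using P(5) I by auto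
        then show "linked (M2 16) (M2 15 (?R 35)) (members (rank ws p) (?R 35) n)" using assms(2) by simp
        show "level M2 (?R 34) (?R 33) {i. i < n \<and> Suc (?R 35) \<le> rank ws p i} (v p + 1 - real (?R 35))"
        proof -
          have "v p + 1 - real (Suc l) + 1 = v p + 1 - real l" by simp
          from P(4)[unfolded this] show ?thesis by simp
        qed
        fix R3 M3 t3
        assume F: "agree_off {33, 36} R3 ?R" "R3 33 = ?R 33 + length (members (rank ws p) (?R 35) n)"
          "level M3 (R3 34) (R3 33) {i. i < n \<and> ?R 35 \<le> rank ws p i} (v p + 1 - real (?R 35))"
          "agree_off {17, 18} M3 M2"
          "t3 \<le> t2 + 1 + 3 + 7 * length (members (rank ws p) (?R 35) n)"
        have e3: "env R3" "R3 35 = l" "R3 34 = R2 34" using F(1) e2 by (auto simp: env_def)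
        have "R3 33 = node_count ws p l"
          using F(2) P(2) I node_count_step[OF ln, of p] by (simp add: l)
        moreover have "t3 + 60 * l \<le> t + 20 + 60 * n + 40 * (R3 34 + R3 33) + 60 * R3 34"
        proof -
          have "R2 34 + R2 33 = R' 34 + R' 33" unfolding P(2,3) cdiv_2 by linarith
          moreover have "t' + 60 * Suc l \<le> t + 20 + 60 * n + 40 * (R' 34 + R' 33) + 60 * R' 34"
            using I l by simp
          ultimately show ?thesis using F(2,5) P(3,6) e3(3) by simp
        qed
        moreover have "?fr M3" using F(4) P(5) I by simp
        ultimately show "?I R3 M3 t3" using e3 F(3) ln by simp
      qed (use assms in auto)
      from wp_cong_state[OF this]
      show "wp b ws (Ins (Op Sub 35 35 3) ;; add_code) ?I R2 M2 t2"
        using e2 ln by (simp add: env_def word_ops)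
    qed auto
  next
    fix R' M' t' assume I: "?I R' M' t'" and "\<not> R' 2 < R' 35"
    then have l: "R' 35 = 0" by (auto simp: env_def)
    have "?J R' M' (t' + 2)" using I A0 by (auto simp: l intro!: exI[of _ 0])
    then show "wp b ws (While 3 33 pairs_code) (wp b ws ?end Q) R' M' (t' + 2)" by (rule final)
  qed
  have "wp b ws add_code (wp b ws (While 2 35 (pairs_code ;; Ins (Op Sub 35 35 3) ;; add_code))
      (wp b ws (While 3 33 pairs_code) (wp b ws ?end Q))) (R(33 := 0, 34 := 0, 35 := n)) M (t + 3)"
    (is "wp b ws add_code ?next ?R M _")
  proof (rule add_level_wp)
    show "env ?R" using assms(1) by (simp add: env_def)
    show "linked (M 16) (M 15 (?R 35)) (members (rank ws p) (?R 35) n)" using assms(2) by simp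
    have "\<not> Suc n \<le> rank ws p i" if "i < n" for i using rank_le[OF that, of p] by simp
    then have e: "{i. i < n \<and> Suc n \<le> rank ws p i} = {}" by blast
    have "level M 0 0 {} (v p + 1 - real n)" by (simp add: level_def forest_def)
    then have "level M 0 0 {i. i < n \<and> Suc n \<le> rank ws p i} (v p + 1 - real n)" by (simp only: e)
    then show "level M (?R 34) (?R 33) {i. i < n \<and> Suc (?R 35) \<le> rank ws p i} (v p + 1 - real (?R 35))"
      by simp
    fix R' M' t'
    assume F: "agree_off {33, 36} R' ?R" "R' 33 = ?R 33 + length (members (rank ws p) (?R 35) n)"
      "level M' (R' 34) (R' 33) {i. i < n \<and> ?R 35 \<le> rank ws p i} (v p + 1 - real (?R 35))"
      "agree_off {17, 18} M' M"
      "t' \<le> t + 3 + 3 + 7 * length (members (rank ws p) (?R 35) n)"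
    have "?I R' M' t'"
      using F assms(1) node_count_top[of ws p] by (simp add: env_def)
    then show "?next R' M' t'" by (rule loop)
  qed (use assms in auto)
  from wp_cong_state[OF this] show ?thesis
    using assms(1) by (simp add: build_code_def env_def wp_Seq_fun)
qed

lemma main_wp:
  assumes "R 0 = n" "\<And>m a. M m a = 0"
    and Q: "\<And>R' M' t' u c. built M' c (R' 0) (R' 1) u \<Longrightarrow> leaves u = mset [0..<n] \<Longrightarrow>
      minimax_tree (mset ws) (map_btree ((!) ws) u) \<Longrightarrow> t' \<le> t + 210000 * n \<Longrightarrow> Q R' M' t'"
  shows "wp b ws main_code Q R M t"
  unfolding main_code_def wp_Seq
proof (rule find_top_wp, fact)
  fix R1 t1 assume A1: "env R1" "R1 5 < n" "ws ! R1 5 = top_weight ws" "t1 \<le> t + 20 * n"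
  show "wp b ws split_weights (wp b ws (bucket 6 7 8) (wp b ws chain_code (wp b ws search_code
    (wp b ws rank_code (wp b ws (bucket 14 15 16) (wp b ws build_code Q)))))) R1 M t1"
  proof (rule split_weights_wp[OF A1(1-3)])
    fix R2 M2 t2 assume A2: "env R2" "weights_in M2" "agree_off {4, 5, 6} M2 M" "t2 \<le> t1 + 20 * n"
    show "wp b ws (bucket 6 7 8) (wp b ws chain_code (wp b ws search_code
      (wp b ws rank_code (wp b ws (bucket 14 15 16) (wp b ws build_code Q))))) R2 M2 t2"
    proof (rule bucket_wp[OF A2(1)])
      show "M2 7 l = 0" for l using A2(3) assms(2) by simp
      fix R3 M3 t3
      assume A3: "env R3" "\<forall>r<10. R3 r = R2 r" "\<forall>l. linked (M3 8) (M3 7 l) (members (M2 6) l n)"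
        "agree_off {7, 8} M3 M2" "t3 \<le> t2 + 20 * n"
      have w3: "weights_in M3" using A2(2) A3(4) by (simp add: weights_in_def)
      have li: "\<forall>l. linked (M3 8) (M3 7 l) (members (M3 6) l n)" using A3(3,4) by simp
      show "wp b ws chain_code (wp b ws search_code (wp b ws rank_code (wp b ws (bucket 14 15 16)
        (wp b ws build_code Q)))) R3 M3 t3"
      proof (rule chain_wp[OF A3(1) w3 li])
        fix R4 M4 t4 h
        assume A4: "env R4" "R4 6 = n" "wf_chain n (chain M4 n)" "distinct (map fst (chain M4 n))"
          "set (map fst (chain M4 n)) = {..<n}"
          "\<forall>X. (extra X 0 (chain M4 n) = 0) = (kraft ws X \<le> 2 ^ (n + h))"
          "2 ^ (n + h) < kraft ws UNIV" "agree_off {9, 10, 11} M4 M3" "t4 \<le> t3 + 300 * n"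
        have w4: "weights_in M4" using w3 A4(8) by (simp add: weights_in_def)
        have inv: "search_inv ws (2 ^ (n + h)) {} (chain M4 (R4 6)) (R4 7)"
          unfolding A4(2) using A4(3-6) by (intro search_inv_init) auto
        show "wp b ws search_code (wp b ws rank_code (wp b ws (bucket 14 15 16)
          (wp b ws build_code Q))) R4 M4 t4"
        proof (rule search_wp[OF A4(1) w4 inv A4(7)])
          fix R5 M5 t5
          assume A5: "env R5" "agree_off {9, 10, 11, 12, 13} M5 M4" "R5 7 < n"
            "kraft ws {i. v (R5 7) < v i} \<le> 2 ^ (n + h)" "2 ^ (n + h) < kraft ws {i. v (R5 7) \<le> v i}"
            "t5 \<le> t4 + 2 + 200000 * R4 6"
          define p where "p = R5 7"
          have w5: "weights_in M5" using w4 A5(2) by (simp add: weights_in_def)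
          show "wp b ws rank_code (wp b ws (bucket 14 15 16) (wp b ws build_code Q)) R5 M5 t5"
          proof (rule rank_wp[OF A5(1) w5 refl A5(3)])
            fix R6 M6 t6
            assume A6: "env R6" "\<forall>m. m \<noteq> 14 \<longrightarrow> M6 m = M5 m" "\<forall>i<n. M6 14 i = rank ws (R5 7) i"
              "t6 \<le> t5 + 5 + 12 * n"
            show "wp b ws (bucket 14 15 16) (wp b ws build_code Q) R6 M6 t6"
            proof (rule bucket_wp[OF A6(1)])
              show "M6 15 l = 0" for l using A6(2) A5(2) A4(8) A3(4) A2(3) assms(2) by simp
              fix R7 M7 t7
              assume A7: "env R7" "\<forall>r<10. R7 r = R6 r" "\<forall>l. linked (M7 16) (M7 15 l) (members (M6 14) l n)"
                "agree_off {15, 16} M7 M6" "t7 \<le> t6 + 20 * n"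
              have "members (M6 14) l n = members (rank ws p) l n" for l
                using A6(3) by (intro members_cong) (simp add: p_def)
              with A7(3) have "\<forall>l. linked (M7 16) (M7 15 l) (members (rank ws p) l n)" by simp
              then show "wp b ws build_code Q R7 M7 t7"
              proof (rule build_wp[OF A7(1) _ A5(3,4), folded p_def])
                fix R8 :: regfile and M8 t8 u c
                assume A8: "built M8 c (R8 0) (R8 1) u" "leaves u = mset [0..<n]"
                  "weight ws u \<le> v p + 1 + real h" "t8 \<le> t7 + 50 + 300 * n"
                have l: "leaves (map_btree ((!) ws) u) = mset ws"
                  unfolding leaves_map_btree A8(2) mset_map[symmetric] map_nth ..
                have "weight ws u \<le> root_weight y" if "leaves y = mset ws" for y
                proof -
                  have "v p + real (Suc h) \<le> root_weight y"
                  proof (rule minimax_lower_bound[OF _ that])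
                    show "ws \<noteq> []" using two_le by auto
                    have e: "n - 1 + Suc h = n + h" using two_le by simp
                    show "2 ^ (n - 1 + Suc h) < kraft ws {i. v p \<le> v i}"
                      unfolding e p_def by (rule A5(5))
                  qed (use A5(3) in \<open>simp add: p_def\<close>)
                  then show ?thesis using A8(3) by simp
                qed
                then have "minimax_tree (mset ws) (map_btree ((!) ws) u)"
                  using l by (auto simp: minimax_tree_def is_arg_min_def weight_def not_less)
                moreover have "t8 \<le> t + 210000 * n"
                  using A8(4) A7(5) A6(4) A5(6) A4(9) A3(5) A2(4) A1(4) two_le unfolding A4(2) by linarith
                ultimately show "Q R8 M8 t8" using A8(1,2) by (intro Q)
              qed
            qed auto
          qed
        qed
      qed
    qed auto
  qed
qed

end

lemma minimax_wp:
  assumes "ws \<noteq> []" "length ws < 2 ^ b"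
  shows "wp b ws minimax_code
    (\<lambda>R M t. t \<le> 210003 * length ws \<and> outputs_minimax_tree ws \<lparr>pc = a, regs = R, mem = M\<rparr>)
    ((\<lambda>_. 0)(0 := length ws)) (\<lambda>_ _. 0) 0"
proof -
  have "1 \<le> length ws" using assms(1) by (simp add: Suc_le_eq)
  then have b: "b \<noteq> 0" using assms(2) by (cases b) auto
  then have one: "take_bit b (Suc 0) = Suc 0" by (simp add: take_bit_nat_eq_self)
  show ?thesis
  proof (cases "1 < length ws")
    case True
    then interpret ram b ws using assms(2) by unfold_locales auto
    have "wp b ws main_code
      (\<lambda>R M t. t \<le> 210003 * length ws \<and> outputs_minimax_tree ws \<lparr>pc = a, regs = R, mem = M\<rparr>)
      ((\<lambda>_. 0)(0 := length ws, 3 := 1)) (\<lambda>_ _. 0) 2"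
    proof (rule main_wp)
      fix R' :: regfile and M' t' u c
      assume A: "built M' c (R' 0) (R' 1) u" "leaves u = mset [0..<length ws]"
        "minimax_tree (mset ws) (map_btree ((!) ws) u)" "t' \<le> 2 + 210000 * length ws"
      then show "t' \<le> 210003 * length ws \<and> outputs_minimax_tree ws \<lparr>pc = a, regs = R', mem = M'\<rparr>"
        using True built_tree_at[OF A(1)] by (auto simp: outputs_minimax_tree_def)
    qed auto
    then show ?thesis using True one
      by (simp add: minimax_code_def numeral_2_eq_2)
  next
    case False
    then obtain w where w: "ws = [w]" using assms(1) by (cases ws) (auto simp: Suc_le_eq)
    have "minimax_tree (mset ws) (map_btree ((!) ws) (Leaf 0))"
      by (auto simp: minimax_tree_def is_arg_min_def w not_less intro!: leaf_le_root)
    then have "outputs_minimax_tree ws \<lparr>pc = a, regs = R, mem = M\<rparr>" if "R 0 = 1" "R 1 = 0" for R :: regfile and M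
      using that tree_at.intros(1)[of M 0]
      by (auto simp: outputs_minimax_tree_def w intro!: exI[of _ "Leaf 0"])
    then show ?thesis using False one w by (simp add: minimax_code_def)
  qed
qed

theorem theorem4:
  "\<exists>(P :: program) (c :: nat). \<forall>(b :: nat) (ws :: real list).
     ws \<noteq> [] \<and> length ws < 2 ^ b \<longrightarrow>
       (\<exists>t s. halts_in b ws P (initial_config (length ws)) t s \<and>
              t \<le> c * length ws \<and>
              outputs_minimax_tree ws s)"
proof (rule exI[of _ "compile minimax_code 0 @ [Halt]"], rule exI[of _ 210003], intro allI impI)
  fix b :: nat and ws :: "real list"
  let ?P = "compile minimax_code 0 @ [Halt]"
  let ?a = "code_size minimax_code"
  assume "ws \<noteq> [] \<and> length ws < 2 ^ b"
  then obtain k R M where run: "run b ws minimax_code ((\<lambda>_. 0)(0 := length ws)) (\<lambda>_ _. 0) k R M"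
    and out: "k \<le> 210003 * length ws" "outputs_minimax_tree ws \<lparr>pc = ?a, regs = R, mem = M\<rparr>"
    using minimax_wp[of ws b ?a] by (auto simp: wp_def)
  have "halts_in b ws ?P \<lparr>pc = ?a, regs = R, mem = M\<rparr> 0 \<lparr>pc = ?a, regs = R, mem = M\<rparr>"
    by (rule halts_in.halt) (auto simp: nth_append)
  then have "halts_in b ws ?P \<lparr>pc = 0, regs = (\<lambda>_. 0)(0 := length ws), mem = \<lambda>_ _. 0\<rparr> (k + 0)
    \<lparr>pc = ?a, regs = R, mem = M\<rparr>"
    using code_at_self[of "[]" "compile minimax_code 0" "[Halt]"]
    by (intro compile_correct[OF run]) auto
  then show "\<exists>t s. halts_in b ws ?P (initial_config (length ws)) t s \<and> t \<le> 210003 * length ws \<and>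
    outputs_minimax_tree ws s"
    using out by (auto simp: initial_config_def)
qed

end
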